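(* Let $\mathcal{E}=(L|K,v)$ be an Artin-Schreier extension of valued fields of degree $p=(vL:vK)$ (where $p=\mathrm{char}\,K$). Then there exists an Artin-Schreier generator $\vartheta$ of $L|K$ of value $v\vartheta<0$ such that $vL=vK+\mathbb{Z}v\vartheta$ and, for some $j\in\{1,\dots,p-1\}$, $$\mathcal{O}_L=\bigcup_{c\in K,\ v(c\vartheta^j)>0}\mathcal{O}_K[c\vartheta^j],$$ and we have $$\Omega_{\mathcal{O}_L|\mathcal{O}_K}\cong\vartheta^{-1}\mathcal{M}_{\mathcal{E}}/(\vartheta^{-1}\mathcal{M}_{\mathcal{E}})^p=I_{\mathcal{E}}\mathcal{M}_{\mathcal{E}}/(I_{\mathcal{E}}\mathcal{M}_{\mathcal{E}})^p$$ as $\mathcal{O}_L$-modules; in particular, $\Omega_{\mathcal{O}_L|\mathcal{O}_K}\neq0$.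
   Context: Valuations are Krull valuations of arbitrary rank. $(L|K,v)$ denotes a field extension $L|K$ with a valuation $v$ on $L$, $K$ being endowed with the restriction of $v$. $\mathcal{O}_K,\mathcal{O}_L$ are the valuation rings, $vK,vL$ the value groups, and $vx$ is the value of an element $x$. $\Omega_{B|A}$ is the module of relative Kähler differentials. An Artin-Schreier extension is a Galois extension $L|K$ of degree $p=\mathrm{char}\,K>0$; an Artin-Schreier generator is an element $\vartheta$ with $L=K(\vartheta)$ and $\vartheta^p-\vartheta\in K$. The extensions considered here are automatically unibranched. For an extension $\mathcal{E}=(L|K,v)$ of prime degree equal to $(vL:vK)$, $H_{\mathcal{E}}$ denotes the largest convex subgroup of $vL$ that is also a convex subgroup of $vK$, and $\mathcal{M}_{\mathcal{E}}=\{a\in L\mid va>\gamma\text{ for all }\gamma\in H_{\mathcal{E}}\}$, which is an $\mathcal{O}_L$-ideal (it is the maximal ideal of the valuation ring $\mathcal{O}_{\mathcal{E}}=\{a\in L\mid\exists\gamma\in H_{\mathcal{E}}:va\ge\gamma\}$). $I_{\mathcal{E}}$ is the ramification ideal of $\mathcal{E}$: the $\mathcal{O}_L$-ideal generated by all elements $\frac{\sigma b-b}{b}$ with $\sigma\in\mathrm{Gal}(L|K)$ and $b\in L^\times$. Products and powers are those of $\mathcal{O}_L$-ideals. *)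

theory Defs
  imports "HOL-Algebra.Algebraic_Closure_Type" "HOL-Algebra.Ideal_Product"
    "HOL-Algebra.Generated_Fields" "HOL-Algebra.Finite_Extensions" "HOL-Algebra.Module"
begin

section \<open>Modules over a ring\<close>

text \<open>The components \<open>mult\<close> and \<open>one\<close> of the record type of modules play no role for modules.\<close>

definition free_module :: "('a, 'm) ring_scheme \<Rightarrow> 'x set \<Rightarrow> ('a, 'x \<Rightarrow> 'a) module" where
  "free_module B S =
    \<lparr> carrier = {f. (\<forall>x\<in>S. f x \<in> carrier B) \<and> (\<forall>x. x \<notin> S \<longrightarrow> f x = \<zero>\<^bsub>B\<^esub>) \<and> finite {x. f x \<noteq> \<zero>\<^bsub>B\<^esub>}},
      monoid.mult = undefined, one = undefined,
      ring.zero = (\<lambda>_. \<zero>\<^bsub>B\<^esub>),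
      add = (\<lambda>f g x. f x \<oplus>\<^bsub>B\<^esub> g x),
      module.smult = (\<lambda>b f x. b \<otimes>\<^bsub>B\<^esub> f x) \<rparr>"

lemma free_module_is_module:
  fixes B (structure)
  assumes "cring B" shows "module B (free_module B S)"
proof -
  interpret cring B by fact
  have fin: "finite {x. f x \<oplus> g x \<noteq> \<zero>}" if "finite {x. f x \<noteq> \<zero>}" "finite {x. g x \<noteq> \<zero>}" for f g :: "'c \<Rightarrow> 'a"
    by (rule finite_subset[of _ "{x. f x \<noteq> \<zero>} \<union> {x. g x \<noteq> \<zero>}"]) (use that in auto)
  have car: "f x \<in> carrier B" if "f \<in> carrier (free_module B S)" for f x
    using that by (cases "x \<in> S") (auto simp: free_module_def)
  show ?thesis
  proof (rule moduleI)
    show "abelian_group (free_module B S)"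
    proof (rule abelian_groupI)
      fix f assume f: "f \<in> carrier (free_module B S)"
      show "\<exists>y\<in>carrier (free_module B S). y \<oplus>\<^bsub>free_module B S\<^esub> f = \<zero>\<^bsub>free_module B S\<^esub>"
      proof (rule bexI[of _ "\<lambda>x. \<ominus> f x"])
        show "(\<lambda>x. \<ominus> f x) \<oplus>\<^bsub>free_module B S\<^esub> f = \<zero>\<^bsub>free_module B S\<^esub>"
          using car[OF f] by (auto simp: free_module_def l_neg)
        have "finite {x. \<ominus> f x \<noteq> \<zero>}"
          by (rule finite_subset[of _ "{x. f x \<noteq> \<zero>}"]) (use f in \<open>auto simp: free_module_def\<close>)
        then show "(\<lambda>x. \<ominus> f x) \<in> carrier (free_module B S)"
          using f by (auto simp: free_module_def)
      qed
    next
      fix f g assume "f \<in> carrier (free_module B S)" "g \<in> carrier (free_module B S)"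
      then show "f \<oplus>\<^bsub>free_module B S\<^esub> g \<in> carrier (free_module B S)"
        using fin[of f g] by (auto simp: free_module_def)
    next
      fix f g h assume "f \<in> carrier (free_module B S)" "g \<in> carrier (free_module B S)" "h \<in> carrier (free_module B S)"
      note c = this[THEN car]
      show "f \<oplus>\<^bsub>free_module B S\<^esub> g \<oplus>\<^bsub>free_module B S\<^esub> h = f \<oplus>\<^bsub>free_module B S\<^esub> (g \<oplus>\<^bsub>free_module B S\<^esub> h)"
        using c by (auto simp: free_module_def a_assoc)
    next
      fix f g assume "f \<in> carrier (free_module B S)" "g \<in> carrier (free_module B S)"
      note c = this[THEN car]
      show "f \<oplus>\<^bsub>free_module B S\<^esub> g = g \<oplus>\<^bsub>free_module B S\<^esub> f"
        using c by (auto simp: free_module_def a_comm)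
    next
      fix f assume "f \<in> carrier (free_module B S)"
      note c = this[THEN car]
      show "\<zero>\<^bsub>free_module B S\<^esub> \<oplus>\<^bsub>free_module B S\<^esub> f = f"
        using c by (auto simp: free_module_def)
    qed (auto simp: free_module_def)
  next
    fix a f assume a: "a \<in> carrier B" and f: "f \<in> carrier (free_module B S)"
    have "finite {x. a \<otimes> f x \<noteq> \<zero>}"
      by (rule finite_subset[of _ "{x. f x \<noteq> \<zero>}"]) (use f a in \<open>auto simp: free_module_def\<close>)
    then show "a \<odot>\<^bsub>free_module B S\<^esub> f \<in> carrier (free_module B S)"
      using a f by (auto simp: free_module_def)
  next
    fix a b f assume "a \<in> carrier B" "b \<in> carrier B" and f: "f \<in> carrier (free_module B S)"
    note c = this(1,2) f[THEN car]
    show "(a \<oplus> b) \<odot>\<^bsub>free_module B S\<^esub> f = a \<odot>\<^bsub>free_module B S\<^esub> f \<oplus>\<^bsub>free_module B S\<^esub> b \<odot>\<^bsub>free_module B S\<^esub> f"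
      using c by (auto simp: free_module_def l_distr)
    show "a \<otimes> b \<odot>\<^bsub>free_module B S\<^esub> f = a \<odot>\<^bsub>free_module B S\<^esub> (b \<odot>\<^bsub>free_module B S\<^esub> f)"
      using c by (auto simp: free_module_def m_assoc)
  next
    fix a f g assume a: "a \<in> carrier B" and f: "f \<in> carrier (free_module B S)" "g \<in> carrier (free_module B S)"
    note c = a f[THEN car]
    show "a \<odot>\<^bsub>free_module B S\<^esub> (f \<oplus>\<^bsub>free_module B S\<^esub> g) = a \<odot>\<^bsub>free_module B S\<^esub> f \<oplus>\<^bsub>free_module B S\<^esub> a \<odot>\<^bsub>free_module B S\<^esub> g"
      using c by (auto simp: free_module_def r_distr)
  next
    fix f assume f: "f \<in> carrier (free_module B S)"
    show "\<one> \<odot>\<^bsub>free_module B S\<^esub> f = f"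
      using f[THEN car] by (auto simp: free_module_def)
  qed (fact assms)
qed

definition ideal_module :: "('a, 'm) ring_scheme \<Rightarrow> 'a set \<Rightarrow> ('a, 'a) module" where
  "ideal_module B I =
    \<lparr> carrier = I, monoid.mult = undefined, one = undefined, ring.zero = \<zero>\<^bsub>B\<^esub>,
      add = add B, module.smult = monoid.mult B \<rparr>"

definition span_submodule ::
  "('a, 'm) ring_scheme \<Rightarrow> ('a, 'b, 'n) module_scheme \<Rightarrow> 'b set \<Rightarrow> 'b set" where
  "span_submodule B M S = \<Inter>{N. submodule N B M \<and> S \<subseteq> N}"

definition quotient_module :: "('a, 'b, 'n) module_scheme \<Rightarrow> 'b set \<Rightarrow> ('a, 'b set) module" where
  "quotient_module M N =
    \<lparr> carrier = a_rcosets\<^bsub>M\<^esub> N, monoid.mult = undefined, one = undefined, ring.zero = N,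
      add = set_add M, module.smult = (\<lambda>b C. \<Union>x\<in>C. N +>\<^bsub>M\<^esub> (b \<odot>\<^bsub>M\<^esub> x)) \<rparr>"

lemma quotient_module_smult:
  fixes B (structure)
  assumes "module B M" "submodule N B M" "b \<in> carrier B" "x \<in> carrier M"
  shows "b \<odot>\<^bsub>quotient_module M N\<^esub> (N +>\<^bsub>M\<^esub> x) = N +>\<^bsub>M\<^esub> (b \<odot>\<^bsub>M\<^esub> x)"
proof -
  interpret module B M by fact
  interpret submodule N B M by fact
  interpret A: abelian_subgroup N M
    by (rule abelian_subgroupI3) (auto simp: additive_subgroup_def subgroup_axioms M.abelian_group_axioms)
  have "N +>\<^bsub>M\<^esub> (b \<odot>\<^bsub>M\<^esub> y) = N +>\<^bsub>M\<^esub> (b \<odot>\<^bsub>M\<^esub> x)" if y: "y \<in> N +>\<^bsub>M\<^esub> x" for y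
  proof -
    obtain n where n: "n \<in> N" "y = n \<oplus>\<^bsub>M\<^esub> x"
      using y by (auto simp: a_r_coset_def r_coset_def)
    have "b \<odot>\<^bsub>M\<^esub> y = b \<odot>\<^bsub>M\<^esub> n \<oplus>\<^bsub>M\<^esub> b \<odot>\<^bsub>M\<^esub> x"
      using n assms by (simp add: smult_r_distr A.a_Hcarr)
    moreover have "b \<odot>\<^bsub>M\<^esub> n \<in> N" using n assms by simp
    ultimately have "b \<odot>\<^bsub>M\<^esub> y \<in> N +>\<^bsub>M\<^esub> (b \<odot>\<^bsub>M\<^esub> x)"
      by (auto simp: a_r_coset_def r_coset_def)
    then show ?thesis using A.a_repr_independence' assms(3,4) by simp
  qed
  then have "(\<Union>y\<in>N +>\<^bsub>M\<^esub> x. N +>\<^bsub>M\<^esub> (b \<odot>\<^bsub>M\<^esub> y)) = (\<Union>y\<in>N +>\<^bsub>M\<^esub> x. N +>\<^bsub>M\<^esub> (b \<odot>\<^bsub>M\<^esub> x))"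
    by (rule SUP_cong[OF refl])
  moreover have "N +>\<^bsub>M\<^esub> x \<noteq> {}" using A.a_rcos_self assms(4) by blast
  ultimately show ?thesis unfolding quotient_module_def by simp
qed

definition module_isomorphic ::
  "('a, 'm) ring_scheme \<Rightarrow> ('a, 'b, 'n) module_scheme \<Rightarrow> ('a, 'c, 'k) module_scheme \<Rightarrow> bool" where
  "module_isomorphic B M N \<longleftrightarrow>
    (\<exists>f. bij_betw f (carrier M) (carrier N) \<and>
      (\<forall>x\<in>carrier M. \<forall>y\<in>carrier M. f (x \<oplus>\<^bsub>M\<^esub> y) = f x \<oplus>\<^bsub>N\<^esub> f y) \<and>
      (\<forall>b\<in>carrier B. \<forall>x\<in>carrier M. f (b \<odot>\<^bsub>M\<^esub> x) = b \<odot>\<^bsub>N\<^esub> f x))"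


section \<open>Kaehler differentials\<close>

text \<open>The free module on symbols \<open>d b\<close> for \<open>b \<in> B\<close>, modulo additivity, the Leibniz rule, and
  \<open>d a = 0\<close> for \<open>a\<close> in the subring \<open>A\<close>.\<close>

definition kaehler_symbol :: "('a, 'm) ring_scheme \<Rightarrow> 'a \<Rightarrow> 'a \<Rightarrow> 'a" where
  "kaehler_symbol B b = (\<lambda>x. if x = b then \<one>\<^bsub>B\<^esub> else \<zero>\<^bsub>B\<^esub>)"

definition kaehler_relations :: "('a, 'm) ring_scheme \<Rightarrow> 'a set \<Rightarrow> ('a \<Rightarrow> 'a) set" where
  "kaehler_relations B A =
    (let F = free_module B (carrier B); d = kaehler_symbol B in
      {d (b \<oplus>\<^bsub>B\<^esub> c) \<ominus>\<^bsub>F\<^esub> (d b \<oplus>\<^bsub>F\<^esub> d c) | b c. b \<in> carrier B \<and> c \<in> carrier B} \<union>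
      {d (b \<otimes>\<^bsub>B\<^esub> c) \<ominus>\<^bsub>F\<^esub> (b \<odot>\<^bsub>F\<^esub> d c \<oplus>\<^bsub>F\<^esub> c \<odot>\<^bsub>F\<^esub> d b) | b c. b \<in> carrier B \<and> c \<in> carrier B} \<union>
      {d a | a. a \<in> A})"

definition kaehler_differentials ::
  "('a, 'm) ring_scheme \<Rightarrow> 'a set \<Rightarrow> ('a, ('a \<Rightarrow> 'a) set) module" where
  "kaehler_differentials B A =
    (let F = free_module B (carrier B) in
      quotient_module F (span_submodule B F (kaehler_relations B A)))"


section \<open>Valued fields\<close>

text \<open>
  The field \<open>L\<close> is a type of class \<^class>\<open>field\<close>, regarded as a ring structure through
  \<^const>\<open>ring_of_type_algebra\<close>, and \<open>K\<close> is a subset of it.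
  A valuation is written additively as a map from the nonzero elements to an ordered abelian group;
  it need not be surjective. The function value at \<open>0\<close> is arbitrary, and the convention
  \<open>v 0 = \<infinity>\<close> appears as a separate disjunct \<open>x = 0\<close> wherever \<open>0\<close> may occur.
\<close>

abbreviation field_ring :: "'a::field ring" where
  "field_ring \<equiv> ring_of_type_algebra"

definition krull_valuation :: "('a::field \<Rightarrow> 'g::linordered_ab_group_add) \<Rightarrow> bool" where
  "krull_valuation v \<longleftrightarrow>
    (\<forall>x y. x \<noteq> 0 \<and> y \<noteq> 0 \<longrightarrow> v (x * y) = v x + v y) \<and>
    (\<forall>x y. x \<noteq> 0 \<and> y \<noteq> 0 \<and> x + y \<noteq> 0 \<longrightarrow> min (v x) (v y) \<le> v (x + y))"

definition value_group :: "('a::field \<Rightarrow> 'g::linordered_ab_group_add) \<Rightarrow> 'a set \<Rightarrow> 'g set" where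
  "value_group v K = v ` (K - {0})"

definition valuation_ring :: "('a::field \<Rightarrow> 'g::linordered_ab_group_add) \<Rightarrow> 'a set \<Rightarrow> 'a ring" where
  "valuation_ring v K = field_ring\<lparr>carrier := {x \<in> K. x = 0 \<or> 0 \<le> v x}\<rparr>"

definition group_index :: "'g::ab_group_add set \<Rightarrow> 'g set \<Rightarrow> nat" where
  "group_index G H = card ((\<lambda>\<gamma>. (+) \<gamma> ` H) ` G)"

definition int_multiple :: "int \<Rightarrow> 'g::ab_group_add \<Rightarrow> 'g" where
  "int_multiple n \<gamma> = (if 0 \<le> n then (\<Sum>i<nat n. \<gamma>) else - (\<Sum>i<nat (- n). \<gamma>))"

definition convex_subgroup :: "'g::linordered_ab_group_add set \<Rightarrow> 'g set \<Rightarrow> bool" where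
  "convex_subgroup H G \<longleftrightarrow>
    H \<subseteq> G \<and> 0 \<in> H \<and> (\<forall>\<alpha>\<in>H. \<forall>\<beta>\<in>H. \<alpha> + \<beta> \<in> H) \<and> (\<forall>\<alpha>\<in>H. - \<alpha> \<in> H) \<and>
    (\<forall>\<alpha>\<in>H. \<forall>\<gamma>\<in>G. 0 \<le> \<gamma> \<and> \<gamma> \<le> \<alpha> \<longrightarrow> \<gamma> \<in> H)"

definition common_convex_subgroup ::
  "('a::field \<Rightarrow> 'g::linordered_ab_group_add) \<Rightarrow> 'a set \<Rightarrow> 'g set" where
  "common_convex_subgroup v K =
    (GREATEST H. convex_subgroup H (value_group v UNIV) \<and> convex_subgroup H (value_group v K))"

lemma common_convex_subgroup_greatest:
  fixes v :: "'a::field \<Rightarrow> 'g::linordered_ab_group_add"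
  assumes v: "krull_valuation v" and K: "subfield K field_ring"
  defines "P \<equiv> \<lambda>H. convex_subgroup H (value_group v UNIV) \<and> convex_subgroup H (value_group v K)"
  shows "P (common_convex_subgroup v K)" "\<And>H. P H \<Longrightarrow> H \<subseteq> common_convex_subgroup v K"
proof -
  have mult: "v (x * y) = v x + v y" if "x \<noteq> 0" "y \<noteq> 0" for x y
    using v that by (auto simp: krull_valuation_def)
  have v1: "v 1 = 0" using mult[of 1 1] by simp
  have oneK: "1 \<in> K"
    using K subringE(3)[OF subfieldE(1)] by (fastforce simp: ring_of_type_algebra_def)
  have L: "convex_subgroup H (value_group v UNIV)" if "P H" for H
    using that by (simp add: P_def)
  note D = L[unfolded convex_subgroup_def]
  have le: "\<gamma> \<in> H" if "P H" "\<alpha> \<in> H" "\<gamma> \<in> value_group v UNIV" "0 \<le> \<gamma>" "\<gamma> \<le> \<alpha>" for H \<alpha> \<gamma>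
    using D[OF that(1)] that(2-) by auto
  have um: "- \<gamma> \<in> H" if "P H" "\<gamma> \<in> H" for H \<gamma>
    using D[OF that(1), THEN conjunct2, THEN conjunct2, THEN conjunct2, THEN conjunct1] that(2) by (rule bspec)
  have add: "\<gamma> + \<delta> \<in> H" if "P H" "\<gamma> \<in> H" "\<delta> \<in> H" for H \<gamma> \<delta>
    using D[OF that(1), THEN conjunct2, THEN conjunct2, THEN conjunct1] that(2,3) by (iprover dest: bspec)
  have um': "\<gamma> \<in> H" if "P H" "- \<gamma> \<in> H" for H \<gamma> using um[OF that] by simp
  have sub: "\<gamma> \<in> value_group v UNIV" if "P H" "\<gamma> \<in> H" for H \<gamma>
    using conjunct1[OF that(1)[unfolded P_def], unfolded convex_subgroup_def, THEN conjunct1] that(2) by (rule subsetD)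
  have cmp: "\<alpha> \<in> H'" if "P H" "P H'" "\<alpha> \<in> H" "\<beta> \<in> H'" "max \<alpha> (-\<alpha>) \<le> max \<beta> (-\<beta>)" for H H' \<alpha> \<beta>
  proof -
    define b where "b = max \<beta> (-\<beta>)"
    have b: "b \<in> H'" using that(4) um[OF that(2,4)] by (simp add: b_def max_def)
    show ?thesis
    proof (cases "0 \<le> \<alpha>")
      case True
      have "\<alpha> \<le> b" using that(5) by (simp add: b_def)
      then show ?thesis by (rule le[OF that(2) b sub[OF that(1,3)] True])
    next
      case False
      have "- \<alpha> \<le> b" "0 \<le> - \<alpha>" using that(5) False by (simp_all add: b_def)
      then have "- \<alpha> \<in> H'" by (intro le[OF that(2) b sub[OF that(1) um[OF that(1,3)]]])
      then show ?thesis by (rule um'[OF that(2)])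
    qed
  qed
  have "0 \<in> value_group v UNIV" "0 \<in> value_group v K"
    using v1 oneK unfolding value_group_def by (metis DiffI UNIV_I empty_iff image_eqI insert_iff zero_neq_one)+
  then have pz: "P {0}" by (auto simp: P_def convex_subgroup_def)
  have "P (\<Union>{H. P H})"
  proof -
    have s: "\<alpha> + \<beta> \<in> \<Union>{H. P H}" if "\<alpha> \<in> H" "P H" "\<beta> \<in> H'" "P H'" for \<alpha> \<beta> H H'
    proof (cases "max \<alpha> (-\<alpha>) \<le> max \<beta> (-\<beta>)")
      case True
      then have "\<alpha> \<in> H'" using cmp[OF that(2,4,1,3)] by blast
      then show ?thesis using that add[OF that(4)] by (intro UnionI[of H']) auto
    next
      case False
      then have "\<beta> \<in> H" by (intro cmp[OF that(4,2,3,1)]) (simp only: not_le less_imp_le)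
      then show ?thesis using that add[OF that(2)] by (intro UnionI[of H]) auto
    qed
    have "convex_subgroup (\<Union>{H. P H}) G" if G: "\<And>H. P H \<Longrightarrow> convex_subgroup H G" for G
      unfolding convex_subgroup_def
    proof (intro conjI ballI impI)
      show "\<Union>{H. P H} \<subseteq> G"
        using G by (intro Union_least) (simp add: convex_subgroup_def)
      show "0 \<in> \<Union>{H. P H}" using pz by (intro UnionI[of "{0}"]) auto
    next
      fix \<alpha> assume "\<alpha> \<in> \<Union>{H. P H}"
      then obtain H where H: "P H" "\<alpha> \<in> H" by auto
      show "- \<alpha> \<in> \<Union>{H. P H}" using um[OF H] H(1) by (intro UnionI[of H]) auto
      fix \<gamma> assume "\<gamma> \<in> G" "0 \<le> \<gamma> \<and> \<gamma> \<le> \<alpha>"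
      then have "\<gamma> \<in> H" using G[OF H(1)] H(2) by (auto simp: convex_subgroup_def)
      then show "\<gamma> \<in> \<Union>{H. P H}" using H(1) by (intro UnionI[of H]) auto
    next
      fix \<alpha> \<beta> assume "\<alpha> \<in> \<Union>{H. P H}" "\<beta> \<in> \<Union>{H. P H}"
      then show "\<alpha> + \<beta> \<in> \<Union>{H. P H}" using s by (elim UnionE) simp
    qed
    then show ?thesis by (simp add: P_def)
  qed
  then have "common_convex_subgroup v K = \<Union>{H. P H}"
    unfolding common_convex_subgroup_def by (intro Greatest_equality) (auto simp: P_def)
  then show "P (common_convex_subgroup v K)" "\<And>H. P H \<Longrightarrow> H \<subseteq> common_convex_subgroup v K"
    using \<open>P (\<Union>{H. P H})\<close> by auto
qed

definition M_ideal :: "('a::field \<Rightarrow> 'g::linordered_ab_group_add) \<Rightarrow> 'a set \<Rightarrow> 'a set" where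
  "M_ideal v K = {a. a = 0 \<or> (\<forall>\<gamma>\<in>common_convex_subgroup v K. \<gamma> < v a)}"


section \<open>Artin-Schreier extensions\<close>

definition galois_group :: "'a::field set \<Rightarrow> ('a \<Rightarrow> 'a) set" where
  "galois_group K = {\<sigma> \<in> ring_iso field_ring field_ring. \<forall>c\<in>K. \<sigma> c = c}"

text \<open>A finite extension is Galois if its base is the fixed field of its automorphism group.\<close>

definition galois_extension_of_degree :: "nat \<Rightarrow> 'a::field set \<Rightarrow> bool" where
  "galois_extension_of_degree n K \<longleftrightarrow>
    subfield K field_ring \<and> ring.dimension field_ring n K (UNIV :: 'a set) \<and>
    {x. \<forall>\<sigma>\<in>galois_group K. \<sigma> x = x} = K"

text \<open>Since \<open>K\<close> is a subfield of \<open>L\<close>, both fields have characteristic \<open>CHAR('a)\<close>.\<close>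

definition artin_schreier_extension :: "'a::field set \<Rightarrow> bool" where
  "artin_schreier_extension K \<longleftrightarrow> CHAR('a) > 0 \<and> galois_extension_of_degree CHAR('a) K"

definition artin_schreier_generator :: "'a::field set \<Rightarrow> 'a \<Rightarrow> bool" where
  "artin_schreier_generator K \<theta> \<longleftrightarrow>
    generate_field field_ring (insert \<theta> K) = UNIV \<and> \<theta> ^ CHAR('a) - \<theta> \<in> K"

text \<open>For a unibranched extension the generators lie in the valuation ring, as \<^const>\<open>genideal\<close>
  requires.\<close>

definition ramification_ideal ::
  "('a::field \<Rightarrow> 'g::linordered_ab_group_add) \<Rightarrow> 'a set \<Rightarrow> 'a set" where
  "ramification_ideal v K =
    Idl\<^bsub>valuation_ring v UNIV\<^esub> {(\<sigma> b - b) / b | \<sigma> b. \<sigma> \<in> galois_group K \<and> b \<noteq> 0}"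

abbreviation ideal_power :: "'a ring \<Rightarrow> 'a set \<Rightarrow> nat \<Rightarrow> 'a set" where
  "ideal_power B I n \<equiv> I [^]\<^bsub>ideals_set B\<^esub> n"

end

(*
  An element y with vy outside vK has powers 1, y, ..., y^(p-1) of pairwise distinct value modulo vK,
  so they form a K-basis of L and the value of a linear combination is the least value of its terms.
  This makes L explicit: a nontrivial automorphism has order p, additive Hilbert 90 gives an
  Artin-Schreier generator, and removing its constant coordinate gives theta with v theta < 0 outside vK.

  Let P be the set of positive elements of vL outside vK.  Then M = {a | va >= g for some g in P}, the
  ramification ideal is theta^-1 O_L, and (theta^-1 M)^n consists of the elements of value
  at least n (e - v theta) for some e in P.  There is a j such that every positive element of the
  coset k j v theta + vK is bounded below by k times a positive element of the coset j v theta + vK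
  (0 < k < p).  Hence every element of O_L lies in O_K[z] for all z = c theta^j, c in K, of
  sufficiently small positive value.

  Put y = theta^j and let E be the K-linear map with E y^k = k y^k for k < p.  It violates the Leibniz
  rule only through E(y^p), whose value is exactly v(y^p) - (p-1) v theta, so b |-> theta^-1 E b is a
  derivation from O_L into theta^-1 M modulo (theta^-1 M)^p.  The induced map on differentials is an
  isomorphism: every differential is a multiple of a single dz, and d(z^p) = 0 gives the relation
  (E(z^p)/z) dz = 0, whose coefficient has the value needed for injectivity.
*)
theory Submission
  imports Defs "HOL-Library.Function_Algebras"
begin

section \<open>Subgroups of prime index in ordered abelian groups\<close>

text \<open>Being separable over \<open>K\<close>, the field \<open>L\<close> has no nonzero
  \<open>K\<close>-derivation, so no derivation of \<open>L\<close> can detect the differentials; a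
  linear map that is a derivation only modulo an ideal takes its place. The exponent
  \<open>p\<close> comes from its defect. Terms of degrees \<open>k\<close> and \<open>l\<close> in
  \<open>y\<close> with values at least \<open>k e\<close> and \<open>l e\<close> violate the
  Leibniz rule only when \<open>k + l \<ge> p\<close>, hence by an error of value at least
  \<open>p e - (p - 1) v \<theta>\<close>, and division by \<theta> turns this bound into
  \<open>p (e - v \<theta>)\<close>.

  In general \<open>O_L\<close> is not generated by a single element over \<open>O_K\<close>, so no
  \<open>z\<close> serves all differentials. But each element of the free module has finite support,
  which is why conditions on \<open>z\<close> are collected through \<open>small\<close> and
  \<open>z\<close> is chosen last.

  The group \<open>vL\<close> may be dense or discrete, and the coset of \<open>v \<theta>\<close>
  need not contain the small values: if \<open>vL\<close> is the group of integers and
  \<open>vK\<close> its multiples of \<open>p\<close>, then \<open>z\<close> must have value 1,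
  which fixes the class of \<open>j v \<theta>\<close>. Hence the exponent \<open>j\<close>.\<close>

primrec nmul :: "nat \<Rightarrow> 'g::ab_group_add \<Rightarrow> 'g" where
  "nmul 0 a = 0"
| "nmul (Suc n) a = a + nmul n a"

lemma nmul_zero [simp]: "nmul n 0 = 0"
  by (induction n) auto

lemma nmul_add: "nmul (m + n) a = nmul m a + nmul n a"
  by (induction m) (auto simp: algebra_simps)

lemma nmul_mult: "nmul (m * n) a = nmul m (nmul n a)"
  by (induction m) (auto simp: nmul_add)

lemma nmul_plus: "nmul n (a + b) = nmul n a + nmul n b"
  by (induction n) (auto simp: algebra_simps)

lemma nmul_minus: "nmul n (- a) = - nmul n a"
  by (induction n) (auto simp: algebra_simps)

lemma nmul_diff: "nmul n (a - b) = nmul n a - nmul n b"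
  by (induction n) (auto simp: algebra_simps)

lemma nmul_mono: "a \<le> b \<Longrightarrow> nmul n a \<le> nmul n (b::'g::linordered_ab_group_add)"
  by (induction n) (auto intro: add_mono)

lemma nmul_nonneg: "0 \<le> a \<Longrightarrow> 0 \<le> nmul n (a::'g::linordered_ab_group_add)"
  by (induction n) auto

lemma nmul_mono_left: "0 \<le> a \<Longrightarrow> m \<le> n \<Longrightarrow> nmul m a \<le> nmul n (a::'g::linordered_ab_group_add)"
  using nmul_add[of m "n - m" a] nmul_nonneg[of a "n - m"] by simp

lemma nmul_pos: "0 < a \<Longrightarrow> 0 < n \<Longrightarrow> 0 < nmul n (a::'g::linordered_ab_group_add)"
  by (cases n) (auto intro!: add_pos_nonneg nmul_nonneg)

lemma nmul_eq_0_iff: "nmul n a = 0 \<longleftrightarrow> n = 0 \<or> a = (0::'g::linordered_ab_group_add)"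
proof (cases "n = 0")
  case False
  then have "0 < nmul n a" if "0 < a" using that by (simp add: nmul_pos)
  moreover have "0 < nmul n (- a)" if "a < 0" using that False by (simp add: nmul_pos)
  ultimately show ?thesis using False by (cases a "0::'g" rule: linorder_cases) (auto simp: nmul_minus)
qed auto

lemma int_multiple_of_nat: "int_multiple (int n) a = nmul n a"
proof -
  have "(\<Sum>i<n. a) = nmul n a" by (induction n) (auto simp: add.commute)
  then show ?thesis by (simp add: int_multiple_def)
qed

lemma int_multiple_cases:
  obtains m where "int_multiple n a = nmul m a" | m where "int_multiple n a = - nmul m a"
proof (cases "0 \<le> n")
  case True
  then show ?thesis using that(1) int_multiple_of_nat[of "nat n" a] by simp
next
  case False
  then show ?thesis
    using that(2) int_multiple_of_nat[of "nat (- n)" a] by (simp add: int_multiple_def split: if_splits)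
qed

text \<open>Only the exponent of \<open>U / V\<close> is assumed here. For value groups, the
  cyclicity demanded in \<open>prime_index_subgroup\<close> is deduced from a basis of powers, whose
  construction already uses \<open>nmul_in_V_iff\<close>.\<close>

locale prime_exponent_subgroup =
  fixes U V :: "'g::linordered_ab_group_add set" and p :: nat
  assumes prime: "prime p"
    and U_zero: "0 \<in> U" and U_diff: "a \<in> U \<Longrightarrow> b \<in> U \<Longrightarrow> a - b \<in> U"
    and V_zero: "0 \<in> V" and V_diff: "a \<in> V \<Longrightarrow> b \<in> V \<Longrightarrow> a - b \<in> V"
    and V_sub: "V \<subseteq> U"
    and p_mult: "a \<in> U \<Longrightarrow> nmul p a \<in> V"
begin

lemma p_gt_1: "1 < p"
  using prime prime_gt_1_nat by blast

lemma V_uminus: "a \<in> V \<Longrightarrow> - a \<in> V"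
  using V_diff[OF V_zero] by simp

lemma V_add: "a \<in> V \<Longrightarrow> b \<in> V \<Longrightarrow> a + b \<in> V"
  using V_diff[of a "- b"] V_uminus[of b] by simp

lemma U_uminus: "a \<in> U \<Longrightarrow> - a \<in> U"
  using U_diff[OF U_zero] by simp

lemma U_add: "a \<in> U \<Longrightarrow> b \<in> U \<Longrightarrow> a + b \<in> U"
  using U_diff[of a "- b"] U_uminus[of b] by simp

lemma V_nmul: "a \<in> V \<Longrightarrow> nmul n a \<in> V"
  by (induction n) (auto simp: V_zero V_add)

lemma U_nmul: "a \<in> U \<Longrightarrow> nmul n a \<in> U"
  by (induction n) (auto simp: U_zero U_add)

lemma V_cong: "a - b \<in> V \<Longrightarrow> a \<in> V \<longleftrightarrow> b \<in> V"
  using V_diff[of a "a - b"] V_add[of "a - b" b] by auto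

text \<open>The class of \<open>a\<close> in \<open>U / V\<close> is nonzero and killed by the prime
  \<open>p\<close>, so its order is exactly \<open>p\<close>; Bezout makes this explicit.\<close>

lemma nmul_in_V_iff:
  assumes "a \<in> U" "a \<notin> V"
  shows "nmul i a \<in> V \<longleftrightarrow> p dvd i"
proof
  assume i: "nmul i a \<in> V"
  show "p dvd i"
  proof (rule ccontr)
    assume n: "\<not> p dvd i"
    then have "gcd i p = 1" using prime by (metis coprime_iff_gcd_eq_1 gcd.commute prime_imp_coprime_nat)
    moreover have "i \<noteq> 0" using n by (metis dvd_0_right)
    ultimately obtain x y where xy: "i * x = p * y + 1" using bezout_nat[of i p] by auto
    have "nmul (x * i) a \<in> V" using V_nmul[OF i] by (simp add: nmul_mult)
    moreover have "nmul (y * p) a \<in> V" using V_nmul[OF p_mult[OF assms(1)]] by (simp add: nmul_mult)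
    ultimately have "nmul (x * i) a - nmul (y * p) a \<in> V" by (rule V_diff)
    moreover have "x * i = y * p + 1" using xy by (simp add: mult.commute)
    ultimately show False using assms(2) by (simp add: nmul_add)
  qed
next
  assume "p dvd i"
  then obtain m where "i = m * p" by (auto simp: dvd_def mult.commute)
  then show "nmul i a \<in> V" using V_nmul[OF p_mult[OF assms(1)]] by (simp add: nmul_mult)
qed

definition Pos :: "'g set" where
  "Pos = {d \<in> U. d \<notin> V \<and> 0 < d}"

end

locale prime_index_subgroup = prime_exponent_subgroup +
  assumes gen: "a \<in> U \<Longrightarrow> a \<notin> V \<Longrightarrow> b \<in> U \<Longrightarrow> \<exists>i<p. b - nmul i a \<in> V"
begin

text \<open>
  Either \<^const>\<open>Pos\<close> contains arbitrarily small elements in every coset, or up to elements of the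
  largest convex subgroup contained in \<open>V\<close> it has a smallest element \<open>\<gamma>\<close>, whose coset then
  determines \<open>j\<close>.
\<close>

lemma small_coset:
  assumes eta: "\<eta> \<in> U" "\<eta> \<notin> V"
  shows "\<exists>j\<in>{1..p - 1}. \<forall>k\<in>{1..p - 1}. \<forall>d. 0 < d \<and> d - nmul (k * j) \<eta> \<in> V \<longrightarrow>
    (\<exists>e. 0 < e \<and> e - nmul j \<eta> \<in> V \<and> nmul k e \<le> d)"
proof (cases "\<forall>g\<in>Pos. \<exists>h\<in>Pos. nmul 2 h \<le> g")
  case True
  have halve: "\<exists>h\<in>Pos. nmul (2 ^ n) h \<le> g" if "g \<in> Pos" for g n
  proof (induction n)
    case 0
    then show ?case using that by auto
  next
    case (Suc n)
    then obtain h where h: "h \<in> Pos" "nmul (2 ^ n) h \<le> g" by auto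
    obtain h' where h': "h' \<in> Pos" "nmul 2 h' \<le> h" using True h(1) by auto
    have "nmul (2 ^ Suc n) h' = nmul (2 ^ n) (nmul 2 h')" by (simp add: nmul_mult[symmetric] mult.commute)
    also have "\<dots> \<le> g" using nmul_mono[OF h'(2), of "2 ^ n"] h(2) by simp
    finally show ?case using h'(1) by blast
  qed
  show ?thesis
  proof (rule bexI[of _ 1], intro ballI allI impI)
    fix k d assume k: "k \<in> {1..p - 1}" and d: "0 < d \<and> d - nmul (k * 1) \<eta> \<in> V"
    have kp: "\<not> p dvd k" using k p_gt_1 by (auto dest: dvd_imp_le)
    then have "nmul k \<eta> \<notin> V" using nmul_in_V_iff[OF eta] by blast
    then have "d \<notin> V" using V_cong[of d "nmul k \<eta>"] d by simp
    moreover have "d \<in> U"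
      using U_add[of "d - nmul k \<eta>" "nmul k \<eta>"] V_sub d U_nmul[OF eta(1)] by auto
    ultimately have "d \<in> Pos" using d by (simp add: Pos_def)
    \<comment> \<open>Every multiple \<open>k m\<close> of \<open>h\<close> with
      \<open>k, m < p\<close> stays below \<open>2 ^ (p * p)\<close> times \<open>h\<close>, so
      whichever multiple \<open>m\<close> of \<open>h\<close> falls into the coset of \<eta> is
      small enough.\<close>
    then obtain h where h: "h \<in> Pos" "nmul (2 ^ (p * p)) h \<le> d" using halve by blast
    have hU: "h \<in> U" "h \<notin> V" "0 < h" using h by (auto simp: Pos_def)
    obtain m where m: "m < p" "\<eta> - nmul m h \<in> V" using gen[OF hU(1,2) eta(1)] by blast
    have m0: "m \<noteq> 0" using m(2) eta(2) by (cases m) auto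
    show "\<exists>e. 0 < e \<and> e - nmul 1 \<eta> \<in> V \<and> nmul k e \<le> d"
    proof (intro exI conjI)
      show "0 < nmul m h" using m0 hU by (simp add: nmul_pos)
      show "nmul m h - nmul 1 \<eta> \<in> V" using V_uminus[OF m(2)] by simp
      have "k * m \<le> p * p" using k m by (intro mult_mono) auto
      also have "\<dots> \<le> 2 ^ (p * p)" by (rule less_imp_le[OF less_exp])
      finally have "nmul (k * m) h \<le> d" using order.trans[OF nmul_mono_left h(2)] hU by (simp add: less_imp_le)
      then show "nmul k (nmul m h) \<le> d" by (simp add: nmul_mult)
    qed
  qed (use p_gt_1 in auto)
next
  case False
  then obtain g where g: "g \<in> Pos" and nog: "\<And>h. h \<in> Pos \<Longrightarrow> \<not> nmul 2 h \<le> g" by blast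
  have gU: "g \<in> U" "g \<notin> V" "0 < g" using g by (auto simp: Pos_def)
  obtain j where j: "j < p" "g - nmul j \<eta> \<in> V" using gen[OF eta gU(1)] by blast
  have j0: "j \<noteq> 0" using j(2) gU(2) by (cases j) auto
  show ?thesis
  proof (rule bexI[of _ j], intro ballI allI impI)
    fix k d assume k: "k \<in> {1..p - 1}" and d: "0 < d \<and> d - nmul (k * j) \<eta> \<in> V"
    have "nmul k g - nmul (k * j) \<eta> \<in> V" using V_nmul[OF j(2), of k] by (simp add: nmul_mult nmul_diff)
    with d have dg: "d - nmul k g \<in> V"
      using V_diff[of "d - nmul (k * j) \<eta>" "nmul k g - nmul (k * j) \<eta>"] by simp
    have dU: "d \<in> U" using U_add[of "d - nmul k g" "nmul k g"] V_sub dg U_nmul[OF gU(1)] by auto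
    show "\<exists>e. 0 < e \<and> e - nmul j \<eta> \<in> V \<and> nmul k e \<le> d"
    proof (cases "nmul k g \<le> d")
      case True
      then show ?thesis using gU j by blast
    next
      case lt: False
      define f where "f = nmul k g - d"
      have f: "f \<in> V" "0 < f" using V_uminus[OF dg] lt by (auto simp: f_def)
      \<comment> \<open>If \<open>g \<le> f\<close>, then dividing \<open>d\<close> by
        \<open>g\<close> leaves a remainder \<open>r\<close> such that \<open>r\<close> and
        \<open>g - r\<close> are congruent to \<open>k - q\<close> and \<open>1 - (k - q)\<close>
        times \<open>g\<close>, hence both in \<open>Pos\<close>. They add up to \<open>g\<close>,
        so twice the smaller one is at most \<open>g\<close>, against the choice of
        \<open>g\<close>.\<close>
      have "f < g"
      proof (rule ccontr)
        assume "\<not> f < g"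
        then have "d \<le> nmul k g - g" by (simp add: f_def algebra_simps)
        moreover have ks: "k = Suc (k - 1)" using k by simp
        have "nmul k g = g + nmul (k - 1) g" by (subst ks) (simp only: nmul.simps)
        ultimately have dle: "d \<le> nmul (k - 1) g" by simp
        \<comment> \<open>The bound \<open>q \<le> p\<close> guarantees that the maximum exists; it
          is not attained, because \<open>q \<le> k - 1\<close>.\<close>
        define q where "q = (GREATEST q. nmul q g \<le> d \<and> q \<le> p)"
        have ex: "nmul 0 g \<le> d \<and> 0 \<le> p" using d by auto
        have q: "nmul q g \<le> d \<and> q \<le> p" unfolding q_def
          by (rule GreatestI_nat[where P = "\<lambda>q. nmul q g \<le> d \<and> q \<le> p", OF ex, of p]) auto
        have qmax: "q' \<le> q" if "nmul q' g \<le> d" "q' \<le> p" for q' unfolding q_def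
          by (rule Greatest_le_nat[where P = "\<lambda>q. nmul q g \<le> d \<and> q \<le> p" and b = p]) (use that in auto)
        have qk: "q \<le> k - 1"
        proof (rule ccontr)
          assume "\<not> q \<le> k - 1"
          then have "k \<le> q" by simp
          then have "nmul k g \<le> nmul q g" using gU by (intro nmul_mono_left) auto
          then show False using q lt order.trans by blast
        qed
        define r where "r = d - nmul q g"
        have rg: "r < g"
        proof (rule ccontr)
          assume "\<not> r < g"
          then have "nmul (Suc q) g \<le> d" by (simp add: r_def algebra_simps)
          moreover have "Suc q \<le> p" using qk k by auto
          ultimately show False using qmax[of "Suc q"] by simp
        qed
        have r0: "0 \<le> r" using q by (simp add: r_def)
        have kq: "nmul k g = nmul (k - q) g + nmul q g" using qk k nmul_add[of "k - q" q g] by simp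
        have rc: "r - nmul (k - q) g \<in> V" using dg by (simp add: r_def kq algebra_simps)
        \<comment> \<open>Equality would squeeze \<open>d\<close> between \<open>q g\<close> and
          \<open>(k - 1) g\<close>, and \<open>- g = d - k g\<close> would lie in
          \<open>V\<close>.\<close>
        have "k - q \<noteq> 1"
        proof
          assume "k - q = 1"
          then have "q = k - 1" using qk k by simp
          then have "d = nmul (k - 1) g" using q dle by simp
          then have "- g \<in> V" using dg \<open>nmul k g = g + nmul (k - 1) g\<close> by simp
          then show False using V_uminus[of "- g"] gU by simp
        qed
        moreover have "1 \<le> k" using k by simp
        ultimately have kq2: "2 \<le> k - q" using qk by arith
        have "\<not> p dvd k - q" using kq2 k by (auto dest: dvd_imp_le)
        then have rV: "r \<notin> V" using V_cong[OF rc] nmul_in_V_iff[OF gU(1,2)] by blast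
        have rU: "r \<in> U" using U_diff[OF dU U_nmul[OF gU(1)]] by (simp add: r_def)
        have rP: "r \<in> Pos" using rV rU r0 V_zero by (auto simp: Pos_def less_le)
        have "\<not> p dvd k - q - 1" using kq2 k by (auto dest: dvd_imp_le)
        then have nV: "nmul (k - q - 1) g \<notin> V" using nmul_in_V_iff[OF gU(1,2)] by blast
        have "nmul (k - q) g = g + nmul (k - q - 1) g"
          using kq2 by (cases "k - q") auto
        then have "r - g - nmul (k - q - 1) g \<in> V" using rc by (simp add: algebra_simps)
        then have "r - g \<notin> V" using V_cong nV by blast
        then have "g - r \<notin> V" using V_uminus[of "g - r"] by auto
        moreover have "g - r \<in> U" by (rule U_diff[OF gU(1) rU])
        ultimately have "g - r \<in> Pos" using rg by (simp add: Pos_def)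
        then have "\<not> nmul 2 (g - r) \<le> g" "\<not> nmul 2 r \<le> g" using nog rP by auto
        then have "g < nmul 2 (g - r)" "g < nmul 2 r" by auto
        then have "g + g < nmul 2 (g - r) + nmul 2 r" by (rule add_strict_mono)
        also have "\<dots> = g + g" by (simp add: nmul_plus[symmetric] numeral_2_eq_2)
        finally show False by simp
      qed
      show ?thesis
      proof (intro exI conjI)
        show "0 < g - f" using \<open>f < g\<close> by simp
        show "g - f - nmul j \<eta> \<in> V" using V_diff[OF j(2) f(1)] by (simp add: algebra_simps)
        have "f \<le> nmul k f" using nmul_mono_left[of f 1 k] f k by simp
        then have "nmul k g - nmul k f \<le> nmul k g - f" by simp
        also have "\<dots> = d" by (simp add: f_def)
        finally show "nmul k (g - f) \<le> d" by (simp add: nmul_diff)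
      qed
    qed
  qed (use j j0 in auto)
qed

end

section \<open>Totally ramified extensions of prime degree\<close>

locale krull_valued =
  fixes v :: "'a::field \<Rightarrow> 'g::linordered_ab_group_add"
  assumes krull: "krull_valuation v"
begin

lemma v_mult: "x \<noteq> 0 \<Longrightarrow> y \<noteq> 0 \<Longrightarrow> v (x * y) = v x + v y"
  using krull by (auto simp: krull_valuation_def)

lemma v_add: "x \<noteq> 0 \<Longrightarrow> y \<noteq> 0 \<Longrightarrow> x + y \<noteq> 0 \<Longrightarrow> min (v x) (v y) \<le> v (x + y)"
  using krull by (auto simp: krull_valuation_def)

lemma v_one [simp]: "v 1 = 0"
  using v_mult[of 1 1] by simp

lemma v_power: "x \<noteq> 0 \<Longrightarrow> v (x ^ n) = nmul n (v x)"
  by (induction n) (auto simp: v_mult)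

lemma v_minus: "v (- x) = v x"
proof (cases "x = 0")
  case False
  have "nmul 2 (v (- 1)) = 0" using v_power[of "- 1" 2] by simp
  then have "v (- 1) = 0" by (simp add: nmul_eq_0_iff)
  then show ?thesis using False v_mult[of "- 1" x] by simp
qed simp

lemma v_inverse: "x \<noteq> 0 \<Longrightarrow> v (inverse x) = - v x"
  using v_mult[of x "inverse x"] by (simp add: eq_neg_iff_add_eq_0 add.commute)

lemma v_divide: "x \<noteq> 0 \<Longrightarrow> y \<noteq> 0 \<Longrightarrow> v (x / y) = v x - v y"
  using v_mult[of x "inverse y"] by (simp add: v_inverse divide_inverse)

text \<open>A fractional ideal of the valuation ring. Because it contains \<open>0\<close>, whose
  function value is arbitrary, estimates can be added and multiplied without case
  distinctions.\<close>

definition above :: "'g \<Rightarrow> 'a set" where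
  "above \<gamma> = {x. x = 0 \<or> \<gamma> \<le> v x}"

lemma above_zero [simp]: "0 \<in> above \<gamma>"
  by (simp add: above_def)

lemma above_nonzero: "x \<noteq> 0 \<Longrightarrow> x \<in> above \<gamma> \<longleftrightarrow> \<gamma> \<le> v x"
  by (simp add: above_def)

lemma above_mono: "x \<in> above \<gamma> \<Longrightarrow> \<delta> \<le> \<gamma> \<Longrightarrow> x \<in> above \<delta>"
  by (auto simp: above_def)

lemma above_v [simp]: "x \<in> above (v x)"
  by (simp add: above_def)

lemma above_one [simp]: "1 \<in> above 0"
  by (simp add: above_def)

lemma above_add: "x \<in> above \<gamma> \<Longrightarrow> y \<in> above \<gamma> \<Longrightarrow> x + y \<in> above \<gamma>"
  using v_add[of x y] by (cases "x = 0 \<or> y = 0 \<or> x + y = 0")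
    (auto simp: above_def intro: order_trans[of _ "min (v x) (v y)"])

lemma above_minus: "x \<in> above \<gamma> \<Longrightarrow> - x \<in> above \<gamma>"
  by (auto simp: above_def v_minus)

lemma above_sum: "(\<And>i. i \<in> S \<Longrightarrow> f i \<in> above \<gamma>) \<Longrightarrow> sum f S \<in> above \<gamma>"
  by (induction S rule: infinite_finite_induct) (auto intro: above_add)

lemma above_mult: "x \<in> above \<gamma> \<Longrightarrow> y \<in> above \<delta> \<Longrightarrow> x * y \<in> above (\<gamma> + \<delta>)"
  by (cases "x = 0 \<or> y = 0") (auto simp: above_def v_mult intro: add_mono)

lemma above_mult0: "x \<in> above 0 \<Longrightarrow> y \<in> above \<delta> \<Longrightarrow> x * y \<in> above \<delta>"
  using above_mult[of x 0 y \<delta>] by simp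

lemma above_power: "x \<in> above \<gamma> \<Longrightarrow> x ^ n \<in> above (nmul n \<gamma>)"
  by (induction n) (auto intro: above_mult)

lemma above_of_nat [simp]: "of_nat n \<in> above 0"
  by (induction n) (auto intro: above_add)

lemma above_divide: "x \<in> above \<gamma> \<Longrightarrow> y \<noteq> 0 \<Longrightarrow> x / y \<in> above (\<gamma> - v y)"
  by (cases "x = 0") (auto simp: above_def v_divide)

lemma above_divide_iff: "y \<noteq> 0 \<Longrightarrow> x / y \<in> above \<gamma> \<longleftrightarrow> x \<in> above (\<gamma> + v y)"
  by (cases "x = 0") (auto simp: above_def v_divide le_diff_eq)

lemma v_add_eq:
  assumes "x \<noteq> 0" "y = 0 \<or> v x < v y"
  shows "x + y \<noteq> 0" "v (x + y) = v x"
proof -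
  have "x + y \<noteq> 0 \<and> v (x + y) = v x"
  proof (cases "y = 0")
    case False
    then have lt: "v x < v y" using assms by simp
    have nz: "x + y \<noteq> 0"
    proof
      assume "x + y = 0"
      then have "y = - x" by (simp add: eq_neg_iff_add_eq_0 add.commute)
      then show False using lt by (simp add: v_minus)
    qed
    have "min (v (x + y)) (v (- y)) \<le> v ((x + y) + - y)"
      using nz False assms by (intro v_add) auto
    moreover have "min (v x) (v y) \<le> v (x + y)" using v_add[OF assms(1) False nz] .
    ultimately show ?thesis using lt nz by (auto simp: v_minus min_def split: if_splits)
  qed (use assms in simp)
  then show "x + y \<noteq> 0" "v (x + y) = v x" by auto
qed

lemma v_sum_distinct:
  assumes "finite S" "S \<noteq> {}" "\<And>i. i \<in> S \<Longrightarrow> f i \<noteq> 0" "inj_on (\<lambda>i. v (f i)) S"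
  shows "\<exists>i\<in>S. sum f S \<noteq> 0 \<and> v (sum f S) = v (f i) \<and> (\<forall>l\<in>S. v (f i) \<le> v (f l))"
  using assms
proof (induction S rule: finite_ne_induct)
  case (singleton x)
  then show ?case by simp
next
  case (insert x S)
  have "inj_on (\<lambda>i. v (f i)) S" using insert.prems(2) by (rule inj_on_subset) auto
  then obtain i where i: "i \<in> S" "sum f S \<noteq> 0" "v (sum f S) = v (f i)" "\<forall>l\<in>S. v (f i) \<le> v (f l)"
    using insert by (metis insertCI)
  have ne: "v (f x) \<noteq> v (f i)"
    using insert.prems(2) i(1) insert.hyps by (auto simp: inj_on_def)
  have fx: "f x \<noteq> 0" using insert by auto
  consider "v (f x) < v (f i)" | "v (f i) < v (f x)" using ne by (meson linorder_neqE)
  then show ?case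
  proof cases
    case 1
    then have "f x + sum f S \<noteq> 0" "v (f x + sum f S) = v (f x)"
      using v_add_eq[OF fx, of "sum f S"] i by auto
    then show ?thesis using insert.hyps i 1 by (intro bexI[of _ x]) auto
  next
    case 2
    then have "sum f S + f x \<noteq> 0" "v (sum f S + f x) = v (f i)"
      using v_add_eq[OF i(2), of "f x"] i by auto
    then show ?thesis using insert.hyps i 2 by (intro bexI[of _ i]) (auto simp: add.commute)
  qed
qed

text \<open>In the prime field the inverse of \<open>n\<close> is again an integer. Both have value
  at least 0, and the two values add up to 0.\<close>

lemma v_of_nat:
  assumes "prime CHAR('a)" "\<not> CHAR('a) dvd n"
  shows "of_nat n \<noteq> (0::'a)" "v (of_nat n) = 0"
proof -
  show nz: "of_nat n \<noteq> (0::'a)" using assms(2) by (simp add: of_nat_eq_0_iff_char_dvd)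
  have "gcd n CHAR('a) = 1" using assms by (metis coprime_iff_gcd_eq_1 gcd.commute prime_imp_coprime_nat)
  moreover have "n \<noteq> 0" using assms(2) by (metis dvd_0_right)
  ultimately obtain x y where "n * x = CHAR('a) * y + 1" using bezout_nat[of n "CHAR('a)"] by auto
  then have "of_nat (n * x) = (of_nat (CHAR('a) * y + 1) :: 'a)" by simp
  then have 1: "of_nat n * of_nat x = (1::'a)" by simp
  then have "of_nat x \<noteq> (0::'a)" by auto
  then have "0 = v (of_nat n) + v (of_nat x)" using v_mult[OF nz, of "of_nat x"] 1 by simp
  moreover have "0 \<le> v (of_nat n)" "0 \<le> v (of_nat x)"
    using above_nonzero[OF nz] above_nonzero[OF \<open>of_nat x \<noteq> 0\<close>] above_of_nat by blast+
  ultimately show "v (of_nat n) = 0" by (simp add: add_nonneg_eq_0_iff)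
qed

lemma one_plus_power:
  assumes "s \<in> above \<gamma>" "0 \<le> \<gamma>"
  shows "(1 + s) ^ n - 1 - of_nat n * s \<in> above (\<gamma> + \<gamma>)"
proof (induction n)
  case (Suc n)
  have "(1 + s) ^ Suc n - 1 - of_nat (Suc n) * s = (1 + s) * ((1 + s) ^ n - 1 - of_nat n * s) + of_nat n * (s * s)"
    by (simp add: algebra_simps)
  moreover have "1 + s \<in> above 0" using above_mono[OF assms] by (intro above_add) auto
  ultimately show ?case
    using above_add[OF above_mult0[OF _ Suc] above_mult0[OF above_of_nat above_mult[OF assms(1) assms(1)]]] by simp
qed simp

lemma one_plus_power_above:
  assumes "s \<in> above \<gamma>" "0 \<le> \<gamma>"
  shows "(1 + s) ^ n - 1 \<in> above \<gamma>"
proof -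
  have "(1 + s) ^ n - 1 = ((1 + s) ^ n - 1 - of_nat n * s) + of_nat n * s" by simp
  also have "\<dots> \<in> above \<gamma>"
    using one_plus_power[OF assms, of n] assms
    by (intro above_add above_mult0) (auto elim: above_mono)
  finally show ?thesis .
qed

text \<open>The linear term \<open>n s\<close> has value \<open>v s\<close>, since \<open>n\<close>
  is prime to the characteristic, and dominates the remainder, whose value is at least twice
  \<open>v s\<close>.\<close>

lemma v_one_plus_power:
  assumes "s \<noteq> 0" "0 < v s" "prime CHAR('a)" "\<not> CHAR('a) dvd n"
  shows "(1 + s) ^ n - 1 \<noteq> 0" "v ((1 + s) ^ n - 1) = v s"
proof -
  define r where "r = (1 + s) ^ n - 1 - of_nat n * s"
  note n = v_of_nat[OF assms(3,4)]
  have vn: "v (of_nat n * s) = v s" using n assms(1) by (simp add: v_mult)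
  have "r \<in> above (v s + v s)" unfolding r_def using assms by (intro one_plus_power) auto
  then have "r = 0 \<or> v (of_nat n * s) < v r"
    using assms(2) vn by (auto simp: above_def intro: less_le_trans[of _ "v s + v s"])
  note * = v_add_eq[OF _ this]
  have "of_nat n * s + r = (1 + s) ^ n - 1" by (simp add: r_def)
  then show "(1 + s) ^ n - 1 \<noteq> 0" "v ((1 + s) ^ n - 1) = v s" using * n assms(1) vn by auto
qed

end

section \<open>The field type as a ring structure\<close>

lemma field_ring_simps [simp]:
  "carrier field_ring = UNIV" "monoid.mult field_ring = (*)" "one field_ring = 1"
  "ring.zero field_ring = 0" "add field_ring = (+)"
  by (simp_all add: ring_of_type_algebra_def fun_eq_iff)

interpretation FR: ring "field_ring :: 'a::field ring"
  by (rule ring_from_type_algebra)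

lemma field_ring_uminus [simp]: "\<ominus>\<^bsub>field_ring\<^esub> x = - (x::'a::field)"
  using FR.minus_equality[of "- x" x] by simp

lemma field_ring_combine:
  "FR.combine Ks Us = (\<Sum>i<length Us. (if i < length Ks then Ks ! i else 0) * Us ! i)"
proof (induction Us arbitrary: Ks)
  case (Cons u Us)
  show ?case
  proof (cases Ks)
    case (Cons k Ks')
    then show ?thesis using Cons.IH[of Ks'] by (simp add: sum.lessThan_Suc_shift del: sum.lessThan_Suc cong: if_cong)
  qed simp
qed simp

lemma subfield_field_ring:
  assumes "subfield K (field_ring :: 'a::field ring)"
  shows "0 \<in> K" "1 \<in> K" "x \<in> K \<Longrightarrow> - x \<in> K" "x \<in> K \<Longrightarrow> y \<in> K \<Longrightarrow> x + y \<in> K"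
    "x \<in> K \<Longrightarrow> y \<in> K \<Longrightarrow> x * y \<in> K" "x \<in> K \<Longrightarrow> inverse x \<in> K"
proof -
  note s = subringE[OF subfieldE(1)[OF assms]]
  show "0 \<in> K" "1 \<in> K" "x \<in> K \<Longrightarrow> - x \<in> K" "x \<in> K \<Longrightarrow> y \<in> K \<Longrightarrow> x + y \<in> K"
    "x \<in> K \<Longrightarrow> y \<in> K \<Longrightarrow> x * y \<in> K"
    using s(2) s(3) s(5)[of x] s(7)[of x y] s(6)[of x y] by auto
  show "x \<in> K \<Longrightarrow> inverse x \<in> K"
  proof (cases "x = 0")
    case False
    assume "x \<in> K"
    then show ?thesis
      using FR.subfield_m_inv_simprule[OF assms, of x "inverse x"] False s(3) by simp
  qed (use s(2) in simp)
qed

lemma (in krull_valued) value_group_diff: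
  assumes "subfield K field_ring" "a \<in> value_group v K" "b \<in> value_group v K"
  shows "a - b \<in> value_group v K"
proof -
  obtain c d where "c \<in> K" "c \<noteq> 0" "v c = a" "d \<in> K" "d \<noteq> 0" "v d = b"
    using assms(2,3) unfolding value_group_def by blast
  moreover from this have "c * inverse d \<in> K - {0}" using subfield_field_ring(5,6)[OF assms(1)] by auto
  ultimately show ?thesis
    unfolding value_group_def by (intro image_eqI[of _ _ "c * inverse d"]) (auto simp: v_mult v_inverse)
qed

locale totally_ramified = krull_valued v
  for v :: "'a::field \<Rightarrow> 'g::linordered_ab_group_add" +
  fixes K :: "'a set" and p :: nat
  assumes subfield: "subfield K field_ring"
    and p_prime: "prime p" and char: "CHAR('a) = p"
    and dimension: "ring.dimension field_ring p K (UNIV :: 'a set)"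
    and p_value: "\<And>x. x \<noteq> 0 \<Longrightarrow> nmul p (v x) \<in> value_group v K"
begin

abbreviation "vL \<equiv> value_group v UNIV"
abbreviation "vK \<equiv> value_group v K"

lemmas K_zero = subfield_field_ring(1)[OF subfield]
lemmas K_one = subfield_field_ring(2)[OF subfield]
lemmas K_minus = subfield_field_ring(3)[OF subfield]
lemmas K_add = subfield_field_ring(4)[OF subfield]
lemmas K_mult = subfield_field_ring(5)[OF subfield]
lemmas K_inverse = subfield_field_ring(6)[OF subfield]

lemma K_diff: "x \<in> K \<Longrightarrow> y \<in> K \<Longrightarrow> x - y \<in> K"
  using K_add[of x "- y"] K_minus[of y] by simp

lemma K_divide: "x \<in> K \<Longrightarrow> y \<in> K \<Longrightarrow> x / y \<in> K"
  using K_mult[of x "inverse y"] K_inverse[of y] by (simp add: divide_inverse)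

lemma K_power: "x \<in> K \<Longrightarrow> x ^ n \<in> K"
  by (induction n) (auto simp: K_one K_mult)

lemma K_of_nat: "of_nat n \<in> K"
  by (induction n) (auto simp: K_zero K_one K_add)

lemma vK_iff: "\<gamma> \<in> vK \<longleftrightarrow> (\<exists>c\<in>K. c \<noteq> 0 \<and> v c = \<gamma>)"
  by (auto simp: value_group_def)

lemma vL_iff: "\<gamma> \<in> vL \<longleftrightarrow> (\<exists>c. c \<noteq> 0 \<and> v c = \<gamma>)"
  by (auto simp: value_group_def)

lemma v_in_vL: "x \<noteq> 0 \<Longrightarrow> v x \<in> vL"
  by (auto simp: value_group_def)

lemma v_in_vK: "x \<noteq> 0 \<Longrightarrow> x \<in> K \<Longrightarrow> v x \<in> vK"
  by (auto simp: value_group_def)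

sublocale prime_exponent_subgroup vL vK p
proof
  show "prime p" by (rule p_prime)
  show "0 \<in> vL" using v_in_vL[of 1] by simp
  show "0 \<in> vK" using v_in_vK[of 1] K_one by simp
  show "vK \<subseteq> vL" by (auto simp: value_group_def)
  fix a b
  show "a - b \<in> vL" if "a \<in> vL" "b \<in> vL"
    using that v_divide unfolding vL_iff by (metis divide_eq_0_iff)
  show "a - b \<in> vK" if "a \<in> vK" "b \<in> vK"
    using value_group_diff[OF subfield that] .
  show "nmul p a \<in> vK" if "a \<in> vL" using that p_value by (auto simp: vL_iff)
qed

lemma K_coeff: "c \<in> K \<Longrightarrow> c = 0 \<or> v c \<in> vK"
  using v_in_vK by blast

text \<open>Two terms of equal value would put \<open>(l - i) v y\<close> with
  \<open>0 < l - i < p\<close> into \<open>vK\<close>, so the values are distinct and the least one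
  prevails. The assumption concerns only the values of the coefficients, since
  \<open>aut_fixed\<close> needs it for coefficients not yet known to lie in
  \<open>K\<close>.\<close>

lemma pow_sum_value:
  assumes y: "y \<noteq> 0" "v y \<notin> vK"
    and a: "\<And>k. k < p \<Longrightarrow> a k = 0 \<or> v (a k) \<in> vK" and k: "k < p" "a k \<noteq> 0"
  shows "\<exists>i<p. a i \<noteq> 0 \<and> (\<Sum>k<p. a k * y ^ k) \<noteq> 0 \<and> v (\<Sum>k<p. a k * y ^ k) = v (a i * y ^ i) \<and>
    (\<forall>l<p. a l \<noteq> 0 \<longrightarrow> v (a i * y ^ i) \<le> v (a l * y ^ l))"
proof -
  define S where "S = {k. k < p \<and> a k \<noteq> 0}"
  have S: "finite S" "S \<noteq> {}" using k by (auto simp: S_def)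
  have inj: "inj_on (\<lambda>k. v (a k * y ^ k)) S"
  proof (rule linorder_inj_onI')
    fix i l assume il: "i \<in> S" "l \<in> S" "i < l"
    show "v (a i * y ^ i) \<noteq> v (a l * y ^ l)"
    proof
      assume eq: "v (a i * y ^ i) = v (a l * y ^ l)"
      have "nmul l (v y) = nmul (l - i) (v y) + nmul i (v y)"
        using nmul_add[of "l - i" i "v y"] il by simp
      then have "v (a i) - v (a l) = nmul (l - i) (v y)"
        using eq il y(1) by (simp add: S_def v_mult v_power algebra_simps)
      moreover have "v (a i) - v (a l) \<in> vK" using a[of i] a[of l] il by (intro V_diff) (auto simp: S_def)
      ultimately have "p dvd l - i" using nmul_in_V_iff[of "v y" "l - i"] y v_in_vL by auto
      then show False using il by (auto simp: S_def dest: dvd_imp_le)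
    qed
  qed
  have "(\<Sum>k<p. a k * y ^ k) = (\<Sum>k\<in>S. a k * y ^ k)"
    by (rule sum.mono_neutral_right) (auto simp: S_def)
  moreover obtain i where "i \<in> S" "(\<Sum>k\<in>S. a k * y ^ k) \<noteq> 0"
      "v (\<Sum>k\<in>S. a k * y ^ k) = v (a i * y ^ i)" "\<forall>l\<in>S. v (a i * y ^ i) \<le> v (a l * y ^ l)"
    using v_sum_distinct[OF S _ inj] y(1) by (auto simp: S_def)
  ultimately show ?thesis by (auto simp: S_def)
qed

lemma pow_sum_eq_0:
  assumes "y \<noteq> 0" "v y \<notin> vK" "\<And>k. k < p \<Longrightarrow> a k = 0 \<or> v (a k) \<in> vK"
    "(\<Sum>k<p. a k * y ^ k) = 0" "k < p"
  shows "a k = 0"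
  using pow_sum_value[of y a k] assms by blast

lemma pow_sum_above:
  assumes "y \<noteq> 0" "v y \<notin> vK" "\<And>k. k < p \<Longrightarrow> a k \<in> K"
    "(\<Sum>k<p. a k * y ^ k) \<in> above \<gamma>" "k < p"
  shows "a k * y ^ k \<in> above \<gamma>"
proof (cases "a k = 0")
  case False
  have "\<And>k. k < p \<Longrightarrow> a k = 0 \<or> v (a k) \<in> vK" using K_coeff[OF assms(3)] .
  from pow_sum_value[where y = y and a = a, OF assms(1,2) this assms(5) False] False assms(4,5) show ?thesis
    by (auto simp: above_def intro: order_trans)
qed simp

lemma pow_basis:
  assumes y: "y \<noteq> 0" "v y \<notin> vK"
  shows "\<exists>a. (\<forall>k. a k \<in> K) \<and> x = (\<Sum>k<p. a k * y ^ k)"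
proof -
  define Us where "Us = map (\<lambda>k. y ^ k) [0..<p]"
  have len: "length Us = p" by (simp add: Us_def)
  have comb: "FR.combine Ks Us = (\<Sum>k<p. (if k < length Ks then Ks ! k else 0) * y ^ k)" for Ks
    by (simp add: field_ring_combine Us_def)
  have "FR.independent K Us"
  proof (rule FR.trivial_combine_imp_independent[OF subfield])
    fix Ks assume Ks: "set Ks \<subseteq> K" "FR.combine Ks Us = \<zero>\<^bsub>field_ring\<^esub>"
    define a where "a = (\<lambda>k. if k < length Ks then Ks ! k else 0)"
    have aK: "a k \<in> K" for k using Ks(1) K_zero by (auto simp: a_def)
    have a0: "a k = 0" if "k < p" for k
      using y _ _ that by (rule pow_sum_eq_0) (use K_coeff[OF aK] Ks(2) comb in \<open>auto simp: a_def\<close>)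
    have "Ks ! k = 0" if "k < p" "k < length Ks" for k using a0[OF that(1)] that(2) by (simp add: a_def)
    then show "set (take (length Us) Ks) \<subseteq> {\<zero>\<^bsub>field_ring\<^esub>}"
      by (auto simp: len in_set_conv_nth)
  qed simp
  then have "FR.Span K Us = UNIV"
    using FR.independent_length_eq_dimension[OF subfield dimension, of Us] len by simp
  then obtain Ks where "set Ks \<subseteq> K" "length Ks = p" "x = FR.combine Ks Us"
    using FR.Span_mem_iff_length_version[OF subfield, of Us x] len by auto
  then show ?thesis
    using K_zero by (intro exI[of _ "\<lambda>k. if k < length Ks then Ks ! k else 0"]) (auto simp: comb)
qed

text \<open>The dominant term in the expansion of \<open>x\<close> in powers of \<open>y\<close>
  exhibits \<open>v x\<close> modulo \<open>vK\<close> as a multiple of \<open>v y\<close>.\<close>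

sublocale prime_index_subgroup vL vK p
proof
  fix a b assume a: "a \<in> vL" "a \<notin> vK" and b: "b \<in> vL"
  obtain y where y: "y \<noteq> 0" "v y = a" using a by (auto simp: vL_iff)
  obtain x where x: "x \<noteq> 0" "v x = b" using b by (auto simp: vL_iff)
  obtain c where c: "\<And>k. c k \<in> K" "x = (\<Sum>k<p. c k * y ^ k)" using pow_basis[of y x] y a by blast
  have "\<exists>k<p. c k \<noteq> 0" using x(1) c(2) by (metis (no_types, lifting) lessThan_iff mult_eq_0_iff sum.neutral)
  then obtain k where k: "k < p" "c k \<noteq> 0" by blast
  have "c k = 0 \<or> v (c k) \<in> vK" for k using K_coeff[OF c(1)] .
  from pow_sum_value[of y c, OF y(1) _ this k] a y obtain i where
    "i < p" "c i \<noteq> 0" "v x = v (c i * y ^ i)" using c(2) by auto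
  then have "b - nmul i a = v (c i)" using x y by (simp add: v_mult v_power)
  then show "\<exists>i<p. b - nmul i a \<in> vK" using v_in_vK[of "c i"] c(1) \<open>i < p\<close> \<open>c i \<noteq> 0\<close> by auto
qed

text \<open>Unspecified unless \<open>v y \<notin> vK\<close>.\<close>

definition coord :: "'a \<Rightarrow> 'a \<Rightarrow> nat \<Rightarrow> 'a" where
  "coord y x = (SOME a. (\<forall>k. a k \<in> K) \<and> x = (\<Sum>k<p. a k * y ^ k))"

context
  fixes y assumes y: "y \<noteq> 0" "v y \<notin> vK"
begin

lemma coord_in_K: "coord y x k \<in> K"
  and coord_sum: "x = (\<Sum>k<p. coord y x k * y ^ k)"
  using someI_ex[OF pow_basis[OF y, of x]] unfolding coord_def by auto

lemma coord_unique:
  assumes "\<And>k. k < p \<Longrightarrow> a k \<in> K" "x = (\<Sum>k<p. a k * y ^ k)" "k < p"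
  shows "coord y x k = a k"
proof -
  have "(\<Sum>k<p. (coord y x k - a k) * y ^ k) = 0"
    using assms(2) coord_sum[of x] by (simp add: left_diff_distrib sum_subtractf)
  then have "coord y x k - a k = 0"
    using assms(3) K_coeff[OF K_diff[OF coord_in_K assms(1)]]
    by (intro pow_sum_eq_0[where a = "\<lambda>k. coord y x k - a k", OF y])
  then show ?thesis by simp
qed

lemma coord_add: "k < p \<Longrightarrow> coord y (x + x') k = coord y x k + coord y x' k"
proof (rule coord_unique)
  show "x + x' = (\<Sum>k<p. (coord y x k + coord y x' k) * y ^ k)"
    using coord_sum[of x] coord_sum[of x'] by (simp add: distrib_right sum.distrib)
qed (auto simp: K_add coord_in_K)

lemma coord_scale: "c \<in> K \<Longrightarrow> k < p \<Longrightarrow> coord y (c * x) k = c * coord y x k"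
proof (rule coord_unique)
  have "c * x = c * (\<Sum>k<p. coord y x k * y ^ k)" using coord_sum[of x] by simp
  then show "c * x = (\<Sum>k<p. c * coord y x k * y ^ k)"
    by (simp add: sum_distrib_left mult.assoc)
qed (auto simp: K_mult coord_in_K)

lemma coord_pow: "i < p \<Longrightarrow> k < p \<Longrightarrow> coord y (y ^ i) k = (if k = i then 1 else 0)"
proof (rule coord_unique)
  assume i: "i < p"
  have "(\<Sum>k<p. (if k = i then 1 else 0) * y ^ k) = (\<Sum>k<p. if k = i then y ^ k else 0)"
    by (rule sum.cong) auto
  then show "y ^ i = (\<Sum>k<p. (if k = i then 1 else 0) * y ^ k)" using i by simp
qed (auto simp: K_zero K_one)

lemma coord_above: "x \<in> above \<gamma> \<Longrightarrow> k < p \<Longrightarrow> coord y x k * y ^ k \<in> above \<gamma>"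
  using pow_sum_above[OF y, of "coord y x"] coord_in_K coord_sum[of x] by auto

section \<open>A linear map close to a derivation\<close>

definition euler :: "'a \<Rightarrow> 'a" where
  "euler x = (\<Sum>k<p. of_nat k * (coord y x k * y ^ k))"

lemma euler_add: "euler (x + x') = euler x + euler x'"
  by (simp add: euler_def coord_add distrib_right distrib_left sum.distrib)

lemma euler_scale: "c \<in> K \<Longrightarrow> euler (c * x) = c * euler x"
  by (simp add: euler_def coord_scale sum_distrib_left mult_ac)

lemma euler_zero [simp]: "euler 0 = 0"
  using euler_scale[of 0 0] K_zero by simp

lemma euler_sum: "euler (sum f S) = (\<Sum>i\<in>S. euler (f i))"
  by (induction S rule: infinite_finite_induct) (auto simp: euler_add)

lemma euler_pow: "i < p \<Longrightarrow> euler (y ^ i) = of_nat i * y ^ i"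
proof -
  assume i: "i < p"
  have "euler (y ^ i) = (\<Sum>k<p. if k = i then of_nat i * y ^ i else 0)"
    unfolding euler_def by (rule sum.cong) (auto simp: coord_pow i)
  then show ?thesis using i by simp
qed

lemma euler_K: "c \<in> K \<Longrightarrow> euler c = 0"
  using euler_scale[of c 1] euler_pow[of 0] p_gt_1 by simp

text \<open>The map deletes the constant term and multiplies the others by the units
  \<open>1, ..., p - 1\<close>. As \<open>v x\<close> is outside \<open>vK\<close>, the term of
  least value is not the constant one and survives unchanged in value.\<close>

lemma v_euler:
  assumes "x \<noteq> 0" "v x \<notin> vK"
  shows "euler x \<noteq> 0" "v (euler x) = v x"
proof -
  have nd: "\<not> p dvd k" if "0 < k" "k < p" for k using that by (auto dest: dvd_imp_le)
  define b where "b = (\<lambda>k. of_nat k * coord y x k)"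
  have e: "euler x = (\<Sum>k<p. b k * y ^ k)" by (simp add: euler_def b_def mult.assoc)
  have "\<exists>k<p. coord y x k \<noteq> 0"
    using assms(1) coord_sum[of x] by (metis (no_types, lifting) lessThan_iff mult_eq_0_iff sum.neutral)
  then obtain k where k: "k < p" "coord y x k \<noteq> 0" by blast
  have "coord y x k = 0 \<or> v (coord y x k) \<in> vK" for k using K_coeff[OF coord_in_K] .
  from pow_sum_value[of y "coord y x", OF y this k] obtain i where
    i: "i < p" "coord y x i \<noteq> 0" "v x = v (coord y x i * y ^ i)"
    and imin: "\<And>l. l < p \<Longrightarrow> coord y x l \<noteq> 0 \<Longrightarrow> v (coord y x i * y ^ i) \<le> v (coord y x l * y ^ l)"
    using coord_sum[of x] by metis
  have i0: "0 < i"
  proof (rule ccontr)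
    assume "\<not> 0 < i"
    then show False using i assms(2) coord_in_K v_in_vK by simp
  qed
  have vb: "v (b l * y ^ l) = v (coord y x l * y ^ l)" if "0 < l" "l < p" "coord y x l \<noteq> 0" for l
    using v_of_nat[of l] nd[OF that(1,2)] that y p_prime char by (simp add: b_def v_mult)
  have b0: "b l \<noteq> 0 \<longleftrightarrow> 0 < l \<and> coord y x l \<noteq> 0" if "l < p" for l
    using v_of_nat[of l] nd[of l] that p_prime char by (cases "l = 0") (auto simp: b_def)
  have "b k = 0 \<or> v (b k) \<in> vK" for k
    using K_coeff[OF K_mult[OF K_of_nat coord_in_K]] by (simp add: b_def)
  from pow_sum_value[of y b, OF y this i(1)] obtain l where
    l: "l < p" "b l \<noteq> 0" "euler x \<noteq> 0" "v (euler x) = v (b l * y ^ l)"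
    and lmin: "\<And>l'. l' < p \<Longrightarrow> b l' \<noteq> 0 \<Longrightarrow> v (b l * y ^ l) \<le> v (b l' * y ^ l')"
    using b0[OF i(1)] i0 i(2) e by auto
  show "euler x \<noteq> 0" by fact
  have l0: "0 < l" "coord y x l \<noteq> 0" using b0 l by auto
  have "v (b l * y ^ l) \<le> v (b i * y ^ i)" using lmin[OF i(1)] b0 i i0 by auto
  moreover have "v (coord y x i * y ^ i) \<le> v (coord y x l * y ^ l)" using imin[OF l(1) l0(2)] .
  ultimately show "v (euler x) = v x" using vb[OF l0(1) l(1) l0(2)] vb[OF i0 i(1,2)] l i by simp
qed

text \<open>
  The operator \<^const>\<open>euler\<close> is \<open>y \<cdot> d/dy\<close> on polynomials in \<open>y\<close> of degree below \<open>p\<close>. It fails to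
  be a derivation only through the reduction of \<open>y^p\<close>, which makes \<open>euler (y ^ p)\<close> the only
  source of error terms.
\<close>

lemma euler_y_mult: "euler (y * x) = y * euler x + y * x + coord y x (p - 1) * euler (y ^ p)"
proof -
  have *: "euler (y * (c * y ^ k)) = y * (of_nat k * (c * y ^ k)) + y * (c * y ^ k) +
      (if k = p - 1 then c * euler (y ^ p) else 0)" if "c \<in> K" "k < p" for c k
  proof (cases "k = p - 1")
    case True
    \<comment> \<open>Here \<open>k + 1 = p\<close> vanishes in \<open>L\<close>, so the first two
      summands cancel and only the contribution of \<open>y ^ p\<close> is left.\<close>
    have "of_nat k + 1 = (of_nat (Suc k) :: 'a)" by simp
    also have "\<dots> = 0" using True char p_gt_1 of_nat_CHAR[where 'a = 'a] by simp
    finally have k0: "of_nat k = (- 1 :: 'a)" by (simp add: eq_neg_iff_add_eq_0)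
    have "y * y ^ k = y ^ p" using True p_gt_1 by (cases p) auto
    then have "y * (c * y ^ k) = c * y ^ p" by (simp add: mult.left_commute)
    then have "euler (y * (c * y ^ k)) = c * euler (y ^ p)" using that by (simp only: euler_scale)
    then show ?thesis using True k0 by simp
  next
    case False
    then have "Suc k < p" using that by simp
    moreover have "y * (c * y ^ k) = c * y ^ Suc k" by simp
    ultimately show ?thesis
      using False that euler_scale[of c "y ^ Suc k"] euler_pow[of "Suc k"] by (simp add: algebra_simps)
  qed
  have "y * x = (\<Sum>k<p. y * (coord y x k * y ^ k))"
    using coord_sum[of x] by (simp add: sum_distrib_left[symmetric])
  then have "euler (y * x) = (\<Sum>k<p. euler (y * (coord y x k * y ^ k)))" by (simp add: euler_sum)
  also have "\<dots> = (\<Sum>k<p. y * (of_nat k * (coord y x k * y ^ k)) + y * (coord y x k * y ^ k) +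
      (if k = p - 1 then coord y x k * euler (y ^ p) else 0))"
    by (rule sum.cong) (auto simp: * coord_in_K)
  also have "\<dots> = y * euler x + y * x + coord y x (p - 1) * euler (y ^ p)"
    using p_gt_1 coord_sum[of x] by (simp add: sum.distrib euler_def sum_distrib_left[symmetric])
  finally show ?thesis .
qed

text \<open>Here \<delta> bounds how far the value of \<open>euler (y ^ p)\<close> lies below that
  of \<open>y ^ p\<close>. Each further factor \<open>y\<close> adds one error term of
  \<open>euler_y_mult\<close>, whose top coordinate is controlled by the value of the argument;
  errors of the same bound are added, so the loss \<delta> does not accumulate.\<close>

lemma euler_pow_mult:
  assumes "euler (y ^ p) \<in> above (v (y ^ p) - \<delta>)"
  shows "euler (y ^ k * x) - y ^ k * euler x - of_nat k * (y ^ k * x) \<in> above (v (y ^ k) + v x - \<delta>)"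
proof (induction k)
  case (Suc k)
  show ?case
  proof (cases "x = 0")
    case False
    define z where "z = y ^ k * x"
    have vz: "v z = v (y ^ k) + v x" using False y by (simp add: z_def v_mult)
    have pp: "y ^ p = y * y ^ (p - 1)" using p_gt_1 by (cases p) auto
    have e: "euler (y ^ Suc k * x) - y ^ Suc k * euler x - of_nat (Suc k) * (y ^ Suc k * x) =
      y * (euler (y ^ k * x) - y ^ k * euler x - of_nat k * (y ^ k * x)) + coord y z (p - 1) * euler (y ^ p)"
      using euler_y_mult[of z] by (simp add: z_def algebra_simps)
    have "y * (euler (y ^ k * x) - y ^ k * euler x - of_nat k * (y ^ k * x)) \<in> above (v y + (v (y ^ k) + v x - \<delta>))"
      using Suc by (intro above_mult) auto
    moreover have "v y + (v (y ^ k) + v x - \<delta>) = v (y ^ Suc k) + v x - \<delta>"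
      using y by (simp add: v_mult algebra_simps)
    ultimately have 1: "y * (euler (y ^ k * x) - y ^ k * euler x - of_nat k * (y ^ k * x))
        \<in> above (v (y ^ Suc k) + v x - \<delta>)" by (simp only:)
    have "coord y z (p - 1) * y ^ (p - 1) \<in> above (v z)"
      using p_gt_1 by (intro coord_above) auto
    then have "(coord y z (p - 1) * y ^ (p - 1)) * (euler (y ^ p) / y ^ (p - 1)) \<in>
        above (v z + (v (y ^ p) - \<delta> - v (y ^ (p - 1))))"
      using assms y by (intro above_mult above_divide) auto
    then have "coord y z (p - 1) * euler (y ^ p) \<in> above (v z + (v (y ^ p) - \<delta> - v (y ^ (p - 1))))"
      using y by simp
    moreover have "v z + (v (y ^ p) - \<delta> - v (y ^ (p - 1))) = v (y ^ Suc k) + v x - \<delta>"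
      using y vz pp by (simp add: v_mult algebra_simps)
    ultimately have "coord y z (p - 1) * euler (y ^ p) \<in> above (v (y ^ Suc k) + v x - \<delta>)" by (simp only:)
    with 1 show ?thesis unfolding e by (rule above_add)
  qed simp
qed simp

end

end

section \<open>Artin-Schreier generators\<close>

text \<open>The dominant term has degree \<open>i\<close> with \<open>0 < i < p\<close>, and
  \<open>i v y\<close> is not in \<open>vK\<close>.\<close>

lemma (in totally_ramified) v_notin_vK_if_coord_0:
  assumes y: "y \<noteq> 0" "v y \<notin> vK" and x: "x \<noteq> 0" "coord y x 0 = 0"
  shows "v x \<notin> vK"
proof -
  have "\<exists>k<p. coord y x k \<noteq> 0"
    using x(1) coord_sum[OF y, of x] by (metis (no_types, lifting) lessThan_iff mult_eq_0_iff sum.neutral)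
  then obtain k where k: "k < p" "coord y x k \<noteq> 0" by blast
  have "coord y x k = 0 \<or> v (coord y x k) \<in> vK" for k using K_coeff[OF coord_in_K[OF y]] .
  from pow_sum_value[of y "coord y x", OF y this k] obtain i where
    i: "i < p" "coord y x i \<noteq> 0" "v x = v (coord y x i * y ^ i)"
    using coord_sum[OF y, of x] by metis
  have "i \<noteq> 0" using i(2) x(2) by metis
  then have "nmul i (v y) \<notin> vK"
    using nmul_in_V_iff[of "v y" i] y v_in_vL i(1) by (auto dest: dvd_imp_le)
  moreover have "v x - nmul i (v y) \<in> vK"
    using i y coord_in_K[OF y] v_in_vK by (simp add: v_mult v_power)
  ultimately show ?thesis using V_cong by blast
qed

locale artin_schreier = totally_ramified v K p
  for v :: "'a::field \<Rightarrow> 'g::linordered_ab_group_add" and K :: "'a set" and p :: nat +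
  assumes fixed_field: "{x. \<forall>\<sigma>\<in>galois_group K. \<sigma> x = x} = K"
    and ramified: "\<exists>y. y \<noteq> 0 \<and> v y \<notin> value_group v K"
begin

context
  fixes \<sigma> assumes sigma: "\<sigma> \<in> galois_group K"
begin

lemma aut_iso: "\<sigma> \<in> ring_iso field_ring field_ring"
  using sigma by (simp add: galois_group_def)

lemma aut_add: "\<sigma> (x + y) = \<sigma> x + \<sigma> y"
  using ring_iso_memE(3)[OF aut_iso, of x y] by simp

lemma aut_mult: "\<sigma> (x * y) = \<sigma> x * \<sigma> y"
  using ring_iso_memE(2)[OF aut_iso, of x y] by simp

lemma aut_K: "c \<in> K \<Longrightarrow> \<sigma> c = c"
  using sigma by (simp add: galois_group_def)

lemma aut_inj: "\<sigma> x = \<sigma> y \<longleftrightarrow> x = y"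
  using ring_iso_memE(5)[OF aut_iso] by (auto simp: bij_betw_def inj_on_def)

lemma aut_0: "\<sigma> 0 = 0" and aut_1: "\<sigma> 1 = 1"
  using aut_K K_zero K_one by auto

lemma aut_minus: "\<sigma> (- x) = - \<sigma> x"
  using aut_add[of x "- x"] by (simp add: aut_0 eq_neg_iff_add_eq_0 add.commute)

lemma aut_diff: "\<sigma> (x - y) = \<sigma> x - \<sigma> y"
  using aut_add[of x "- y"] by (simp add: aut_minus)

lemma aut_power: "\<sigma> (x ^ n) = \<sigma> x ^ n"
  by (induction n) (auto simp: aut_1 aut_mult)

lemma aut_sum: "\<sigma> (sum f S) = (\<Sum>i\<in>S. \<sigma> (f i))"
  by (induction S rule: infinite_finite_induct) (auto simp: aut_0 aut_add)

lemma aut_eq_id: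
  assumes y: "y \<noteq> 0" "v y \<notin> vK" and "\<sigma> y = y"
  shows "\<sigma> x = x"
proof -
  have "\<sigma> x = \<sigma> (\<Sum>k<p. coord y x k * y ^ k)" using coord_sum[OF y, of x] by simp
  also have "\<dots> = (\<Sum>k<p. coord y x k * y ^ k)"
    by (simp add: aut_sum aut_mult aut_power assms(3) aut_K coord_in_K[OF y])
  finally show ?thesis using coord_sum[OF y, of x] by simp
qed

text \<open>A nonzero fixed element with value outside \<open>vK\<close> would generate
  \<open>L\<close> and make \<sigma> trivial. So nonzero fixed elements have values in
  \<open>vK\<close>, and expansions in powers of \<open>y\<close> are unique even among fixed
  coefficients. Comparing the expansion of \<open>x\<close> over \<open>K\<close> with
  \<open>x = x * y ^ 0\<close> shows that \<open>x\<close> is its own constant coordinate.\<close>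

lemma aut_fixed:
  assumes "\<sigma> z \<noteq> z" "\<sigma> x = x"
  shows "x \<in> K"
proof -
  obtain y where y: "y \<noteq> 0" "v y \<notin> vK" using ramified by blast
  have fixed: "w = 0 \<or> v w \<in> vK" if "\<sigma> w = w" for w
    using aut_eq_id[of w z] that assms(1) by blast
  define a where "a = (\<lambda>k. coord y x k - (if k = 0 then x else 0))"
  have "(\<Sum>k<p. a k * y ^ k) = (\<Sum>k<p. coord y x k * y ^ k) - (\<Sum>k<p. (if k = 0 then x else 0) * y ^ k)"
    by (simp add: a_def left_diff_distrib sum_subtractf)
  also have "(\<Sum>k<p. (if k = 0 then x else 0) * y ^ k) = (\<Sum>k<p. if k = 0 then x else 0)"
    by (rule sum.cong) auto
  also have "\<dots> = x" using p_gt_1 by simp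
  finally have "(\<Sum>k<p. a k * y ^ k) = 0" using coord_sum[OF y, of x] by simp
  moreover have "a k = 0 \<or> v (a k) \<in> vK" for k
    by (rule fixed) (auto simp: a_def aut_diff aut_0 assms(2) aut_K coord_in_K[OF y])
  ultimately have "a 0 = 0" using pow_sum_eq_0[OF y, of a 0] p_gt_1 by auto
  then show ?thesis using coord_in_K[OF y, of x 0] by (simp add: a_def)
qed

lemma aut_coeff_prod:
  "finite S \<Longrightarrow> \<sigma> (Polynomial.coeff (\<Prod>i\<in>S. [:- f i, 1:]) k) = Polynomial.coeff (\<Prod>i\<in>S. [:- \<sigma> (f i), 1:]) k"
proof (induction S arbitrary: k rule: finite_induct)
  case empty
  then show ?case by (simp add: coeff_1 aut_0 aut_1)
next
  case (insert x S)
  then show ?case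
    by (cases k) (simp_all add: mult_pCons_left aut_add aut_mult aut_minus aut_diff)
qed

text \<open>
  The orbit of \<open>y\<close> under \<open>\<sigma>\<close> has at most \<open>p\<close> elements because \<open>y\<close> has degree at most \<open>p\<close> over
  \<open>K\<close>, and at least \<open>p\<close> because the polynomial with the orbit as its set of roots has coefficients
  in \<open>K\<close>, while no polynomial of degree below \<open>p\<close> vanishes at \<open>y\<close>.
\<close>

lemma aut_order:
  assumes y: "y \<noteq> 0" "v y \<notin> vK" and "\<sigma> y \<noteq> y"
  shows "inj_on (\<lambda>i. (\<sigma> ^^ i) y) {..<p}" "(\<sigma> ^^ p) x = x"
proof -
  define q where "q = Polynomial.monom 1 p - (\<Sum>k<p. Polynomial.monom (coord y (y ^ p) k) k)"
  have polyq: "poly q x = x ^ p - (\<Sum>k<p. coord y (y ^ p) k * x ^ k)" for x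
    by (simp add: q_def poly_monom poly_sum)
  have lead: "Polynomial.coeff q p = 1"
    by (simp add: q_def coeff_sum)
  have "Polynomial.degree q \<le> p"
    unfolding q_def
    by (intro degree_diff_le degree_sum_le) (auto intro: order.trans[OF degree_monom_le])
  have "q \<noteq> 0" using lead by auto
  have roots: "poly q ((\<sigma> ^^ i) y) = 0" for i
  proof (induction i)
    case 0
    then show ?case using coord_sum[OF y, of "y ^ p"] by (simp add: polyq)
  next
    case (Suc i)
    have "poly q (\<sigma> z) = \<sigma> (poly q z)" for z
      by (simp add: polyq aut_diff aut_sum aut_mult aut_power aut_K coord_in_K[OF y])
    then show ?case using Suc by (simp add: aut_0)
  qed
  have card: "card S \<le> p" if "inj_on (\<lambda>i. (\<sigma> ^^ i) y) S" for S :: "nat set"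
  proof -
    have "card S = card ((\<lambda>i. (\<sigma> ^^ i) y) ` S)" using that by (simp add: card_image)
    also have "\<dots> \<le> card {x. poly q x = 0}"
      using roots by (intro card_mono poly_roots_finite \<open>q \<noteq> 0\<close>) auto
    also have "\<dots> \<le> Polynomial.degree q" by (rule card_poly_roots_bound[OF \<open>q \<noteq> 0\<close>])
    finally show ?thesis using \<open>Polynomial.degree q \<le> p\<close> by simp
  qed
  have cancel: "(\<sigma> ^^ (j - i)) y = y" if "i < j" "(\<sigma> ^^ i) y = (\<sigma> ^^ j) y" for i j
  proof -
    have "(\<sigma> ^^ j) y = (\<sigma> ^^ i) ((\<sigma> ^^ (j - i)) y)"
      using that(1) by (metis comp_apply funpow_add le_add_diff_inverse less_imp_le)
    moreover have "inj (\<sigma> ^^ i)"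
      using aut_inj by (intro inj_fn) (auto simp: inj_def)
    ultimately show ?thesis using that(2) by (metis injD)
  qed
  define n where "n = (LEAST n. 0 < n \<and> (\<sigma> ^^ n) y = y)"
  have "\<not> inj_on (\<lambda>i. (\<sigma> ^^ i) y) {..p}" using card[of "{..p}"] by auto
  then obtain i j where "i < j" "(\<sigma> ^^ i) y = (\<sigma> ^^ j) y"
    by (meson linorder_inj_onI')
  then have "0 < j - i \<and> (\<sigma> ^^ (j - i)) y = y" using cancel by simp
  then have n: "0 < n \<and> (\<sigma> ^^ n) y = y" unfolding n_def by (rule LeastI)
  have inj: "inj_on (\<lambda>i. (\<sigma> ^^ i) y) {..<n}"
  proof (rule linorder_inj_onI')
    fix i j assume ij: "i \<in> {..<n}" "j \<in> {..<n}" "i < j"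
    show "(\<sigma> ^^ i) y \<noteq> (\<sigma> ^^ j) y"
    proof
      assume "(\<sigma> ^^ i) y = (\<sigma> ^^ j) y"
      then have "0 < j - i \<and> (\<sigma> ^^ (j - i)) y = y" using cancel ij by simp
      then have "n \<le> j - i" unfolding n_def by (rule Least_le)
      then show False using ij by simp
    qed
  qed
  have "n \<le> p" using card[OF inj] by simp
  moreover have "\<not> n < p"
  proof
    assume np: "n < p"
    define P where "P = (\<Prod>i<n. [:- (\<sigma> ^^ i) y, 1:])"
    have "\<sigma> (Polynomial.coeff P k) = Polynomial.coeff P k" for k
    proof -
      \<comment> \<open>As \<open>(\<sigma> ^^ n) y = y\<close>, the automorphism permutes the
        linear factors cyclically.\<close>
      have "(\<Prod>i<n. [:- \<sigma> ((\<sigma> ^^ i) y), 1:]) = (\<Prod>i<n. [:- (\<sigma> ^^ Suc i) y, 1:])" by simp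
      also have "\<dots> = P"
      proof -
        obtain m where m: "n = Suc m" using n by (cases n) auto
        have "(\<Prod>i<Suc m. [:- (\<sigma> ^^ Suc i) y, 1:]) = (\<Prod>i<m. [:- (\<sigma> ^^ Suc i) y, 1:]) * [:- (\<sigma> ^^ n) y, 1:]"
          by (simp add: m)
        also have "\<dots> = [:- (\<sigma> ^^ 0) y, 1:] * (\<Prod>i<m. [:- (\<sigma> ^^ Suc i) y, 1:])"
          using n by (simp add: mult.commute)
        also have "\<dots> = P" unfolding P_def m by (rule prod.lessThan_Suc_shift[symmetric])
        finally show ?thesis using m by simp
      qed
      finally show ?thesis using aut_coeff_prod[of "{..<n}" "\<lambda>i. (\<sigma> ^^ i) y" k] by (simp add: P_def)
    qed
    then have PK: "Polynomial.coeff P k \<in> K" for k using aut_fixed[of y] assms(3) by blast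
    have "Polynomial.lead_coeff P = 1" by (simp add: P_def lead_coeff_prod)
    moreover have deg: "Polynomial.degree P = n"
      by (simp add: P_def degree_prod_eq_sum_degree)
    ultimately have "Polynomial.coeff P n = 1" by simp
    have "poly P y = 0" using n unfolding P_def poly_prod by (intro prod_zero bexI[of _ 0]) auto
    then have "(\<Sum>k\<le>n. Polynomial.coeff P k * y ^ k) = 0" by (simp add: poly_altdef deg)
    also have "(\<Sum>k\<le>n. Polynomial.coeff P k * y ^ k) = (\<Sum>k<p. Polynomial.coeff P k * y ^ k)"
      by (rule sum.mono_neutral_left) (use np deg le_degree in auto)
    finally have "Polynomial.coeff P n = 0"
      by (rule pow_sum_eq_0[OF y K_coeff[OF PK] _ np])
    then show False using \<open>Polynomial.coeff P n = 1\<close> by simp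
  qed
  ultimately have np: "n = p" by simp
  then show "inj_on (\<lambda>i. (\<sigma> ^^ i) y) {..<p}" using inj by simp
  have "(\<sigma> ^^ p) y = y" using n np by simp
  have "(\<sigma> ^^ p) x = (\<sigma> ^^ p) (\<Sum>k<p. coord y x k * y ^ k)" using coord_sum[OF y, of x] by simp
  have h: "(\<sigma> ^^ m) (u + w) = (\<sigma> ^^ m) u + (\<sigma> ^^ m) w" "(\<sigma> ^^ m) (u * w) = (\<sigma> ^^ m) u * (\<sigma> ^^ m) w"
    "(\<sigma> ^^ m) 0 = 0" "(\<sigma> ^^ m) 1 = 1" for m u w
    by (induction m) (auto simp: aut_add aut_mult aut_0 aut_1)
  have hs: "(\<sigma> ^^ m) (sum f S) = (\<Sum>i\<in>S. (\<sigma> ^^ m) (f i))" for m f and S :: "nat set"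
    by (induction S rule: infinite_finite_induct) (auto simp: h)
  have hp: "(\<sigma> ^^ m) (u ^ k) = (\<sigma> ^^ m) u ^ k" for m u k
    by (induction k) (auto simp: h)
  have hK: "(\<sigma> ^^ m) c = c" if "c \<in> K" for m c using that by (induction m) (auto simp: aut_K)
  have "(\<sigma> ^^ p) (\<Sum>k<p. coord y x k * y ^ k) = (\<Sum>k<p. coord y x k * y ^ k)"
    by (simp only: hs h hp hK coord_in_K[OF y] \<open>(\<sigma> ^^ p) y = y\<close>)
  then show "(\<sigma> ^^ p) x = x" using coord_sum[OF y, of x] by simp
qed

text \<open>If all traces vanish, so do the power sums of the conjugates of \<open>y\<close>, and
  with them the sum of \<open>Q\<close> over these conjugates for every polynomial \<open>Q\<close>
  over \<open>L\<close>. For \<open>Q\<close> vanishing at all conjugates except \<open>y\<close>,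
  this sum is the value of \<open>Q\<close> at \<open>y\<close>, nonzero because the conjugates are
  distinct.\<close>

lemma aut_trace_nonzero:
  assumes y: "y \<noteq> 0" "v y \<notin> vK" and "\<sigma> y \<noteq> y"
  shows "\<exists>z. (\<Sum>i<p. (\<sigma> ^^ i) z) \<noteq> 0"
proof (rule ccontr)
  assume "\<not> ?thesis"
  then have tr: "(\<Sum>i<p. (\<sigma> ^^ i) z) = 0" for z by blast
  define Q where "Q = (\<Prod>i\<in>{1..<p}. [:- (\<sigma> ^^ i) y, 1:])"
  have hp: "(\<sigma> ^^ m) (u ^ k) = (\<sigma> ^^ m) u ^ k" for m u k
    by (induction m) (auto simp: aut_power)
  have "(\<Sum>i<p. poly Q ((\<sigma> ^^ i) y)) =
      (\<Sum>k\<le>Polynomial.degree Q. Polynomial.coeff Q k * (\<Sum>i<p. (\<sigma> ^^ i) (y ^ k)))"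
    unfolding poly_altdef sum_distrib_left hp by (rule sum.swap)
  also have "\<dots> = 0" by (simp add: tr)
  finally have "(\<Sum>i<p. poly Q ((\<sigma> ^^ i) y)) = 0" .
  moreover have "poly Q ((\<sigma> ^^ i) y) = 0" if "i \<in> {1..<p}" for i
    unfolding Q_def poly_prod by (rule prod_zero) (use that in auto)
  then have "(\<Sum>i\<in>{..<p} - {0}. poly Q ((\<sigma> ^^ i) y)) = 0" by (intro sum.neutral) auto
  then have "(\<Sum>i<p. poly Q ((\<sigma> ^^ i) y)) = poly Q y"
    using p_gt_1 by (subst sum.remove[of _ 0]) auto
  ultimately have "poly Q y = 0" by simp
  then obtain i where "i \<in> {1..<p}" "y = (\<sigma> ^^ i) y" by (auto simp: Q_def poly_prod)
  then show False using inj_onD[OF aut_order(1)[OF assms], of 0 i] p_gt_1 by auto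
qed

lemma aut_shift_exists:
  assumes "\<sigma> z \<noteq> z"
  shows "\<exists>\<theta>. \<sigma> \<theta> = \<theta> + 1"
proof -
  obtain y where y: "y \<noteq> 0" "v y \<notin> vK" using ramified by blast
  have sy: "\<sigma> y \<noteq> y" using aut_eq_id[OF y] assms by blast
  obtain x where x: "(\<Sum>i<p. (\<sigma> ^^ i) x) \<noteq> 0" using aut_trace_nonzero[OF y sy] by blast
  define t where "t = (\<Sum>i<p. (\<sigma> ^^ i) x)"
  \<comment> \<open>Shifting the index by one changes \<open>w\<close> by the trace
    \<open>t\<close>, and the boundary term carries the factor \<open>p = 0\<close>. So
    \<open>- w / t\<close> is the element sought.\<close>
  define w where "w = (\<Sum>i<p. of_nat i * (\<sigma> ^^ i) x)"
  have shift: "(\<Sum>i<p. f (Suc i)) = (\<Sum>i<p. f i) + f p - f 0" for f :: "nat \<Rightarrow> 'a"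
    using sum.lessThan_Suc_shift[of f p] by (simp add: algebra_simps)
  have st: "(\<Sum>i<p. (\<sigma> ^^ Suc i) x) = t"
    using shift[of "\<lambda>i. (\<sigma> ^^ i) x"] aut_order(2)[OF y sy, of x] by (simp add: t_def)
  then have "\<sigma> t = t" by (simp add: t_def aut_sum)
  have "\<sigma> w = (\<Sum>i<p. of_nat i * (\<sigma> ^^ Suc i) x)"
    by (simp add: w_def aut_sum aut_mult aut_K K_of_nat)
  also have "\<dots> = (\<Sum>i<p. of_nat (Suc i) * (\<sigma> ^^ Suc i) x - (\<sigma> ^^ Suc i) x)"
    by (rule sum.cong) (auto simp: algebra_simps)
  also have "\<dots> = (\<Sum>i<p. of_nat (Suc i) * (\<sigma> ^^ Suc i) x) - t"
    by (simp only: sum_subtractf st)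
  also have "(\<Sum>i<p. of_nat (Suc i) * (\<sigma> ^^ Suc i) x) = w"
    using shift[of "\<lambda>i. of_nat i * (\<sigma> ^^ i) x"] char of_nat_CHAR[where 'a = 'a] by (simp add: w_def)
  finally have sw: "\<sigma> w = w - t" .
  have "\<sigma> (- w / t) * \<sigma> t = \<sigma> (- w)" using aut_mult[of "- w / t" t] x by (simp add: t_def)
  then have "\<sigma> (- w / t) = (t - w) / t"
    using \<open>\<sigma> t = t\<close> x sw by (simp add: aut_minus eq_divide_eq t_def)
  then have "\<sigma> (- w / t) = - w / t + 1" using x by (simp add: t_def diff_divide_distrib)
  then show ?thesis by blast
qed

end

theorem generator_exists:
  "\<exists>\<theta>. \<theta> \<noteq> 0 \<and> v \<theta> \<notin> vK \<and> v \<theta> < 0 \<and> \<theta> ^ p - \<theta> \<in> K"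
proof -
  obtain y where y: "y \<noteq> 0" "v y \<notin> vK" using ramified by blast
  then have "y \<notin> K" using v_in_vK by blast
  then obtain \<sigma> where s: "\<sigma> \<in> galois_group K" "\<sigma> y \<noteq> y" using fixed_field by blast
  obtain \<theta>' where t': "\<sigma> \<theta>' = \<theta>' + 1" using aut_shift_exists[OF s] by blast
  define \<theta> where "\<theta> = \<theta>' - coord y \<theta>' 0"
  have st: "\<sigma> \<theta> = \<theta> + 1"
    by (simp add: \<theta>_def aut_diff[OF s(1)] t' aut_K[OF s(1)] coord_in_K[OF y])
  then have t0: "\<theta> \<noteq> 0" using aut_0[OF s(1)] by auto
  have "coord y \<theta> 0 = coord y \<theta>' 0 + coord y (- coord y \<theta>' 0 * 1) 0"
    using coord_add[OF y, of 0 \<theta>' "- coord y \<theta>' 0"] p_gt_1 by (simp add: \<theta>_def)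
  also have "coord y (- coord y \<theta>' 0 * 1) 0 = - coord y \<theta>' 0 * coord y 1 0"
    using p_gt_1 by (intro coord_scale[OF y]) (auto simp: K_minus coord_in_K[OF y])
  also have "coord y 1 0 = 1" using coord_pow[OF y, of 0 0] p_gt_1 by simp
  finally have "coord y \<theta> 0 = 0" by simp
  then have vt: "v \<theta> \<notin> vK" by (rule v_notin_vK_if_coord_0[OF y t0])
  have "\<sigma> (\<theta> ^ p - \<theta>) = (\<theta> + 1) ^ p - (\<theta> + 1)"
    by (simp add: aut_diff[OF s(1)] aut_power[OF s(1)] st)
  also have "(\<theta> + 1) ^ p = \<theta> ^ p + 1 ^ p" by (rule freshmans_dream) (simp_all add: p_prime char)
  finally have "\<sigma> (\<theta> ^ p - \<theta>) = \<theta> ^ p - \<theta>" by simp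
  then have K: "\<theta> ^ p - \<theta> \<in> K" using aut_fixed[OF s] by blast
  have "v \<theta> \<noteq> 0" using vt V_zero by auto
  moreover have "\<not> 0 < v \<theta>"
  proof
    assume pos: "0 < v \<theta>"
    have "v \<theta> + 0 < v \<theta> + nmul (p - 1) (v \<theta>)"
      using nmul_pos[OF pos, of "p - 1"] p_gt_1 by (intro add_strict_left_mono) auto
    also have "\<dots> = v (\<theta> ^ p)" using t0 p_gt_1 by (cases p) (auto simp: v_mult v_power)
    finally have "- \<theta> + \<theta> ^ p \<noteq> 0" "v (- \<theta> + \<theta> ^ p) = v (- \<theta>)"
      using v_add_eq[of "- \<theta>" "\<theta> ^ p"] t0 by (auto simp: v_minus)
    then have "v \<theta> = v (\<theta> ^ p - \<theta>)" "\<theta> ^ p - \<theta> \<noteq> 0" by (auto simp: v_minus)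
    then show False using vt v_in_vK K by metis
  qed
  ultimately show ?thesis using t0 vt K by (intro exI[of _ \<theta>]) auto
qed

end

section \<open>The ideal \<open>\<theta>\<^sup>-\<^sup>1M\<close> and the Leibniz rule\<close>

text \<open>The largest common convex subgroup is the set \<open>H'\<close> of elements that lie,
  with either sign, below all of \<open>Pos\<close>: \<open>H'\<close> is itself a common convex
  subgroup, and by convexity none can reach an element of \<open>Pos\<close> without containing it,
  although it is contained in \<open>vK\<close>.\<close>

lemma (in totally_ramified) M_ideal_eq:
  "M_ideal v K = {a. a = 0 \<or> (\<exists>g\<in>Pos. g \<le> v a)}"
proof -
  let ?P = "\<lambda>H. convex_subgroup H vL \<and> convex_subgroup H vK"
  note H = common_convex_subgroup_greatest[OF krull subfield]
  let ?H = "common_convex_subgroup v K"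
  define H' where "H' = {a \<in> vL. \<forall>g\<in>Pos. a < g \<and> - a < g}"
  have H'K: "a \<in> vK" if "a \<in> H'" for a
  proof (rule ccontr)
    assume "a \<notin> vK"
    moreover from this have "- a \<notin> vK" using V_uminus[of "- a"] by auto
    moreover have "a \<noteq> 0" using \<open>a \<notin> vK\<close> V_zero by auto
    moreover have "a \<in> vL" using that by (simp add: H'_def)
    ultimately have "a \<in> Pos \<or> - a \<in> Pos" by (auto simp: Pos_def U_uminus)
    then show False using that by (auto simp: H'_def)
  qed
  have less: "a + b < g" if "g \<in> Pos" "a \<in> H'" "b \<in> H'" for a b g
  proof (rule ccontr)
    assume le: "\<not> a + b < g"
    have "b < g" using that by (auto simp: H'_def)
    moreover have "g - b \<in> vL" using that by (intro U_diff) (auto simp: H'_def Pos_def)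
    moreover have "g - b \<notin> vK" using V_add[of "g - b" b] H'K[OF that(3)] that(1) by (auto simp: Pos_def)
    ultimately have "g - b \<in> Pos" by (simp add: Pos_def)
    then have "a < g - b" using that by (auto simp: H'_def)
    then show False using le by (simp add: less_diff_eq)
  qed
  have minus: "- a \<in> H'" if "a \<in> H'" for a using that by (auto simp: H'_def U_uminus)
  have "convex_subgroup H' vL"
    unfolding convex_subgroup_def
  proof (intro conjI ballI impI)
    show "H' \<subseteq> vL" by (auto simp: H'_def)
    show "0 \<in> H'" by (auto simp: H'_def U_zero Pos_def)
    fix a assume a: "a \<in> H'"
    show "- a \<in> H'" using minus[OF a] .
    show "a + b \<in> H'" if b: "b \<in> H'" for b
      using less[of _ a b] less[of _ "- a" "- b"] minus a b U_add[of a b] by (simp add: H'_def)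
    show "c \<in> H'" if c: "c \<in> vL" "0 \<le> c \<and> c \<le> a" for c
    proof -
      have "c < g \<and> - c < g" if g: "g \<in> Pos" for g
      proof
        have "a < g" using a g by (simp add: H'_def)
        with c show "c < g" by (auto intro: le_less_trans)
        have "- c \<le> 0" "0 < g" using c g by (simp_all add: Pos_def)
        then show "- c < g" by (rule le_less_trans)
      qed
      then show ?thesis using c by (simp add: H'_def)
    qed
  qed
  moreover from this have "convex_subgroup H' vK"
    using H'K V_sub by (auto simp: convex_subgroup_def)
  ultimately have sub: "H' \<subseteq> ?H" by (intro H(2)) simp
  have "convex_subgroup ?H vL" "convex_subgroup ?H vK" using H(1) by (rule conjunct1, rule conjunct2)
  then have H0: "0 \<in> ?H" and HK: "?H \<subseteq> vK"
      and "\<forall>a\<in>?H. \<forall>c\<in>vL. 0 \<le> c \<and> c \<le> a \<longrightarrow> c \<in> ?H"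
    unfolding convex_subgroup_def by iprover+
  note Hc = bspec[OF bspec[OF this(3)], rule_format]
  have HH': "h < g" if "h \<in> ?H" "g \<in> Pos" for h g
  proof (rule ccontr)
    assume "\<not> h < g"
    then have "g \<in> vL" "0 \<le> g \<and> g \<le> h" using that(2) by (auto simp: Pos_def)
    then have "g \<in> ?H" by (intro Hc[OF that(1)]) auto
    then show False using HK that(2) by (auto simp: Pos_def)
  qed
  have "(\<forall>h\<in>?H. h < v a) \<longleftrightarrow> (\<exists>g\<in>Pos. g \<le> v a)" if nz: "a \<noteq> 0" for a
  proof
    assume l: "\<forall>h\<in>?H. h < v a"
    have pos: "0 < v a" using l H0 by (rule bspec)
    have "v a \<notin> ?H" using l by auto
    then have "v a \<notin> H'" using sub by blast
    then obtain g where g: "g \<in> Pos" "\<not> (v a < g \<and> - v a < g)"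
      using v_in_vL[OF nz] by (auto simp: H'_def)
    have "- v a < 0" "0 < g" using pos g by (auto simp: Pos_def)
    then have "- v a < g" by (rule less_trans)
    then show "\<exists>g\<in>Pos. g \<le> v a" using g by (intro bexI[of _ g]) auto
  next
    assume "\<exists>g\<in>Pos. g \<le> v a"
    then show "\<forall>h\<in>?H. h < v a" using HH' less_le_trans by blast
  qed
  then show ?thesis unfolding M_ideal_def by auto
qed

locale artin_schreier_generated = artin_schreier v K p
  for v :: "'a::field \<Rightarrow> 'g::linordered_ab_group_add" and K :: "'a set" and p :: nat +
  fixes \<theta> :: 'a
  assumes theta: "\<theta> \<noteq> 0" and v_theta: "v \<theta> \<notin> value_group v K" and theta_neg: "v \<theta> < 0"
    and theta_K: "\<theta> ^ p - \<theta> \<in> K"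
begin

abbreviation "\<eta> \<equiv> v \<theta>"

definition a0 :: 'a where "a0 = \<theta> ^ p - \<theta>"

lemma nmul_p_Suc: "nmul p g = g + nmul (p - 1) g"
  using p_gt_1 by (cases p) auto

lemma nmul_eta_neg: "0 < n \<Longrightarrow> nmul n \<eta> < 0"
  using nmul_pos[of "- \<eta>" n] theta_neg by (simp add: nmul_minus)

lemma a0_props: "a0 \<in> K" "a0 \<noteq> 0" "v a0 = nmul p \<eta>"
proof -
  show "a0 \<in> K" using theta_K by (simp add: a0_def)
  have "v (\<theta> ^ p) < v (- \<theta>)"
    using theta nmul_eta_neg[of "p - 1"] p_gt_1 by (simp add: v_power v_minus nmul_p_Suc)
  then show "a0 \<noteq> 0" "v a0 = nmul p \<eta>"
    using v_add_eq[of "\<theta> ^ p" "- \<theta>"] theta by (auto simp: a0_def v_power)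
qed

lemma theta_pow:
  assumes "0 < j" "j < p"
  shows "\<theta> ^ j \<noteq> 0" "v (\<theta> ^ j) \<notin> vK"
  using assms theta nmul_in_V_iff[OF v_in_vL[OF theta] v_theta, of j]
  by (auto simp: v_power dest: dvd_imp_le)

text \<open>Write \<open>\<theta> ^ p = a0 * (1 + s)\<close> with \<open>a0\<close> in
  \<open>K\<close>. The part \<open>a0 ^ j\<close> of the power is annihilated; the rest
  \<open>w\<close> has value congruent to \<eta> modulo \<open>vK\<close>, hence keeps its value.
  The shift \<open>- (p - 1) \<eta>\<close> is \<open>v s\<close>.\<close>

lemma v_euler_top:
  assumes j: "0 < j" "j < p"
  shows "euler (\<theta> ^ j) ((\<theta> ^ j) ^ p) \<noteq> 0"
    "v (euler (\<theta> ^ j) ((\<theta> ^ j) ^ p)) = v ((\<theta> ^ j) ^ p) - nmul (p - 1) \<eta>"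
proof -
  define s where "s = \<theta> / a0"
  define w where "w = a0 ^ j * ((1 + s) ^ j - 1)"
  have vs: "v s = - nmul (p - 1) \<eta>"
    using theta a0_props by (simp add: s_def v_divide nmul_p_Suc)
  have s: "s \<noteq> 0" "0 < v s" using theta a0_props vs nmul_eta_neg[of "p - 1"] p_gt_1 by (auto simp: s_def)
  have "\<not> p dvd j" using j by (auto dest: dvd_imp_le)
  note b = v_one_plus_power[OF s, of j, unfolded char, OF p_prime this]
  have "(\<theta> ^ j) ^ p = (\<theta> ^ p) ^ j" by (simp add: power_mult[symmetric] mult.commute)
  also have "\<theta> ^ p = a0 * (1 + s)" using a0_props(2) by (simp add: s_def a0_def distrib_left)
  finally have yp: "(\<theta> ^ j) ^ p = a0 ^ j + w" by (simp add: w_def power_mult_distrib right_diff_distrib)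
  have vyp: "v ((\<theta> ^ j) ^ p) = nmul j (nmul p \<eta>)"
    using theta by (simp add: v_power nmul_mult[symmetric] mult.commute)
  have w: "w \<noteq> 0" "v w = v ((\<theta> ^ j) ^ p) - nmul (p - 1) \<eta>"
    using a0_props b vs by (auto simp: w_def v_mult v_power vyp)
  have "v w - \<eta> = nmul j (nmul p \<eta>) - nmul p \<eta>" by (simp add: w vyp nmul_p_Suc algebra_simps)
  also have "\<dots> \<in> vK" using p_value[OF theta] by (intro V_diff V_nmul[of "nmul p \<eta>"])
  finally have "v w \<notin> vK" using V_cong v_theta by blast
  note e = v_euler[OF theta_pow[OF j] w(1) this]
  have "euler (\<theta> ^ j) ((\<theta> ^ j) ^ p) = euler (\<theta> ^ j) w"
    unfolding yp using euler_add[OF theta_pow[OF j]] euler_K[OF theta_pow[OF j]] a0_props(1) K_power by simp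
  then show "euler (\<theta> ^ j) ((\<theta> ^ j) ^ p) \<noteq> 0"
    "v (euler (\<theta> ^ j) ((\<theta> ^ j) ^ p)) = v ((\<theta> ^ j) ^ p) - nmul (p - 1) \<eta>"
    using e w by simp_all
qed

lemma eta_Pos: "- \<eta> \<in> Pos"
  using U_uminus[OF v_in_vL[OF theta]] V_uminus[of "- \<eta>"] v_theta theta_neg by (auto simp: Pos_def)

text \<open>This is the \<open>n\<close>-th power of the ideal \<open>\<theta>\<^sup>-\<^sup>1M\<close>.\<close>

definition J :: "nat \<Rightarrow> 'a set" where
  "J n = {x. \<exists>e\<in>Pos. x \<in> above (nmul n (e - \<eta>))}"

lemma J_zero: "0 \<in> J n"
  using eta_Pos by (auto simp: J_def)

lemma J_mult: "b \<in> above 0 \<Longrightarrow> x \<in> J n \<Longrightarrow> b * x \<in> J n"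
  by (auto simp: J_def intro: above_mult0)

lemma J_minus: "x \<in> J n \<Longrightarrow> - x \<in> J n"
  by (auto simp: J_def intro: above_minus)

lemma J_add:
  assumes "x \<in> J n" "y \<in> J n"
  shows "x + y \<in> J n"
proof -
  obtain e f where e: "e \<in> Pos" "x \<in> above (nmul n (e - \<eta>))" "f \<in> Pos" "y \<in> above (nmul n (f - \<eta>))"
    using assms by (auto simp: J_def)
  have m: "nmul n (min e f - \<eta>) \<le> nmul n (e - \<eta>)" "nmul n (min e f - \<eta>) \<le> nmul n (f - \<eta>)"
    by (intro nmul_mono diff_right_mono; simp)+
  have "x + y \<in> above (nmul n (min e f - \<eta>))"
    using above_mono[OF e(2) m(1)] above_mono[OF e(4) m(2)] by (rule above_add)
  moreover have "min e f \<in> Pos" using e by (simp add: min_def)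
  ultimately show ?thesis by (auto simp: J_def)
qed

lemma J_subset: "J n \<subseteq> above 0"
proof
  fix x assume "x \<in> J n"
  then obtain e where "e \<in> Pos" "x \<in> above (nmul n (e - \<eta>))" by (auto simp: J_def)
  moreover from this have "0 \<le> nmul n (e - \<eta>)"
    using theta_neg by (intro nmul_nonneg) (auto simp: Pos_def)
  ultimately show "x \<in> above 0" by (auto elim: above_mono)
qed

lemma J_antimono:
  assumes "m \<le> n"
  shows "J n \<subseteq> J m"
proof
  fix x assume "x \<in> J n"
  then obtain e where e: "e \<in> Pos" "x \<in> above (nmul n (e - \<eta>))" by (auto simp: J_def)
  moreover have "nmul m (e - \<eta>) \<le> nmul n (e - \<eta>)"
    using e theta_neg assms by (intro nmul_mono_left) (auto simp: Pos_def)
  ultimately show "x \<in> J m" by (auto simp: J_def elim: above_mono)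
qed

text \<open>The value \<open>- 2 \<eta>\<close> occurs in \<open>J 1\<close> with
  \<open>e = - \<eta>\<close>, whereas by \<open>p \<ge> 2\<close> nonzero elements of
  \<open>J p\<close> have values of at least \<open>2 e - 2 \<eta>\<close> for some
  \<open>e > 0\<close>. This is what makes the differentials nonzero.\<close>

lemma J_p_witness: "inverse (\<theta> ^ 2) \<in> J 1" "inverse (\<theta> ^ 2) \<notin> J p"
proof -
  have t2: "v (\<theta> ^ 2) = \<eta> + \<eta>" using theta by (simp add: power2_eq_square v_mult)
  then have vt: "v (inverse (\<theta> ^ 2)) = - \<eta> - \<eta>" using theta v_inverse[of "\<theta> ^ 2"] by simp
  show "inverse (\<theta> ^ 2) \<in> J 1" using eta_Pos theta vt by (auto simp: J_def above_def)
  show "inverse (\<theta> ^ 2) \<notin> J p"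
  proof
    assume "inverse (\<theta> ^ 2) \<in> J p"
    then obtain e where e: "e \<in> Pos" "nmul p (e - \<eta>) \<le> - \<eta> - \<eta>"
      using theta vt by (auto simp: J_def above_def)
    have "nmul 2 (e - \<eta>) \<le> nmul p (e - \<eta>)"
      using e theta_neg p_gt_1 by (intro nmul_mono_left) (auto simp: Pos_def)
    also note e(2)
    also have "nmul 2 (e - \<eta>) = e + e - \<eta> - \<eta>" by (simp add: numeral_2_eq_2)
    finally have "e + e \<le> 0" by (simp add: algebra_simps)
    then show False using e(1) by (simp add: Pos_def add_pos_pos leD)
  qed
qed

end

section \<open>Approximation from one coset of values, and the Leibniz rule\<close>

locale artin_schreier_coset = artin_schreier_generated v K p \<theta>
  for v :: "'a::field \<Rightarrow> 'g::linordered_ab_group_add" and K :: "'a set" and p :: nat and \<theta> :: 'a +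
  fixes j :: nat
  assumes j: "j \<in> {1..p - 1}"
    and small_multiple: "\<And>k d. k \<in> {1..p - 1} \<Longrightarrow> 0 < d \<Longrightarrow> d - nmul (k * j) (v \<theta>) \<in> value_group v K \<Longrightarrow>
      \<exists>e. 0 < e \<and> e - nmul j (v \<theta>) \<in> value_group v K \<and> nmul k e \<le> d"
begin

abbreviation "y \<equiv> \<theta> ^ j"

lemma j_bounds: "0 < j" "j < p"
  using j p_gt_1 by auto

lemma y: "y \<noteq> 0" "v y \<notin> vK"
  using theta_pow[OF j_bounds] by auto

lemma v_y: "v y = nmul j \<eta>"
  using theta by (simp add: v_power)

definition good :: "'g \<Rightarrow> bool" where
  "good e \<longleftrightarrow> 0 < e \<and> e - v y \<in> vK"

text \<open>Read: eventually, as \<open>e\<close> decreases within the positive part of the coset of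
  \<open>v y\<close>. Finitely many such conditions are met by a common \<open>e\<close>.\<close>

definition small :: "('g \<Rightarrow> bool) \<Rightarrow> bool" where
  "small P \<longleftrightarrow> (\<exists>f. good f \<and> (\<forall>e. good e \<and> e \<le> f \<longrightarrow> P e))"

lemma good_Pos: "good e \<Longrightarrow> e \<in> Pos"
  using V_cong[of e "v y"] y U_add[of "e - v y" "v y"] V_sub v_in_vL[OF y(1)]
  by (auto simp: good_def Pos_def)

lemma good_coeff:
  assumes "good e"
  shows "\<exists>c\<in>K. c \<noteq> 0 \<and> v (c * y) = e"
proof -
  obtain c where "c \<in> K" "c \<noteq> 0" "v c = e - v y" using assms by (auto simp: good_def vK_iff)
  then show ?thesis using y by (intro bexI[of _ c]) (auto simp: v_mult)
qed

lemma small_ex: "small P \<Longrightarrow> \<exists>e. good e \<and> P e"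
  by (auto simp: small_def)

lemma small_conj:
  assumes "small P" "small Q"
  shows "small (\<lambda>e. P e \<and> Q e)"
proof -
  obtain f g where "good f" "\<forall>e. good e \<and> e \<le> f \<longrightarrow> P e" "good g" "\<forall>e. good e \<and> e \<le> g \<longrightarrow> Q e"
    using assms by (auto simp: small_def)
  then show ?thesis unfolding small_def by (intro exI[of _ "min f g"]) (auto simp: min_def)
qed

lemma small_multiple_le:
  assumes "k \<in> {1..p - 1}" "0 < d" "d - nmul k (v y) \<in> vK"
  shows "small (\<lambda>e. nmul k e \<le> d)"
proof -
  obtain f where "good f" "nmul k f \<le> d"
    using small_multiple[of k d] assms by (auto simp: good_def v_y nmul_mult)
  then show ?thesis
    unfolding small_def by (intro exI[of _ f]) (auto intro: order_trans[OF nmul_mono])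
qed

text \<open>The coset of \<open>v y\<close> goes below every element of \<open>Pos\<close>, not just
  those in the same coset: \<open>d\<close> lies in the coset of some \<open>k v y\<close> with
  \<open>0 < k < p\<close>, where even \<open>k e \<le> d\<close> can be achieved.\<close>

lemma small_le:
  assumes d: "d \<in> Pos"
  shows "small (\<lambda>e. e \<le> d)"
proof -
  obtain k where k: "k < p" "d - nmul k (v y) \<in> vK"
    using gen[of "v y" d] y v_in_vL d by (auto simp: Pos_def)
  have "k \<noteq> 0" using k(2) d by (cases k) (auto simp: Pos_def)
  then have "small (\<lambda>e. nmul k e \<le> d)" using k d by (intro small_multiple_le) (auto simp: Pos_def)
  moreover have "e \<le> nmul k e" if "good e" for e
    using that \<open>k \<noteq> 0\<close> nmul_mono_left[of e 1 k] by (auto simp: good_def)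
  ultimately show ?thesis by (auto simp: small_def intro: order_trans)
qed

lemma small_True: "small (\<lambda>_. True)"
  using small_le[OF eta_Pos] by (auto simp: small_def)

lemma small_ball: "finite S \<Longrightarrow> (\<And>i. i \<in> S \<Longrightarrow> small (P i)) \<Longrightarrow> small (\<lambda>e. \<forall>i\<in>S. P i e)"
proof (induction S rule: finite_induct)
  case empty
  then show ?case using small_True by simp
next
  case (insert x S)
  then show ?case using small_conj[of "P x" "\<lambda>e. \<forall>i\<in>S. P i e"] by simp
qed

text \<open>If \<open>e = v (c y)\<close> with \<open>c \<in> K\<close>, this says that \<open>x\<close> lies in \<open>O\<^sub>K[c y]\<close>.\<close>

definition adapted :: "'a \<Rightarrow> 'g \<Rightarrow> bool" where
  "adapted x e \<longleftrightarrow> (\<forall>k<p. coord y x k * y ^ k \<in> above (nmul k e))"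

text \<open>A nonzero term of degree \<open>k > 0\<close> has value in the coset of
  \<open>k v y\<close>, hence outside \<open>vK\<close>. Its value is therefore not just nonnegative
  but positive, and \<open>small_multiple_le\<close> applies.\<close>

lemma small_adapted:
  assumes x: "x \<in> above 0"
  shows "small (adapted x)"
proof -
  have "small (\<lambda>e. coord y x k * y ^ k \<in> above (nmul k e))" if k: "k < p" for k
  proof (cases "k = 0 \<or> coord y x k = 0")
    case True
    then have "coord y x k * y ^ k \<in> above (nmul k e)" for e
      using coord_above[OF y x k] by auto
    then show ?thesis using small_True by (simp add: small_def)
  next
    case False
    define d where "d = v (coord y x k * y ^ k)"
    have nz: "coord y x k * y ^ k \<noteq> 0" using False y by simp
    have "0 \<le> d" using coord_above[OF y x k] nz by (auto simp: above_def d_def)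
    moreover have dk: "d - nmul k (v y) \<in> vK"
      using False y coord_in_K[OF y] v_in_vK by (simp add: d_def v_mult v_power)
    then have "d \<notin> vK"
      using V_cong nmul_in_V_iff[of "v y" k] y v_in_vL k False by (auto dest: dvd_imp_le)
    then have "d \<noteq> 0" using V_zero by auto
    ultimately have "small (\<lambda>e. nmul k e \<le> d)" using dk False k by (intro small_multiple_le) auto
    then show ?thesis by (simp add: above_nonzero[OF nz] d_def)
  qed
  then have "small (\<lambda>e. \<forall>k\<in>{..<p}. coord y x k * y ^ k \<in> above (nmul k e))"
    by (intro small_ball) auto
  moreover have "adapted x = (\<lambda>e. \<forall>k\<in>{..<p}. coord y x k * y ^ k \<in> above (nmul k e))"
    by (auto simp: adapted_def fun_eq_iff)
  ultimately show ?thesis by simp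
qed

lemma adapted_coeff:
  assumes "adapted x (v (c * y))" "c \<in> K" "c \<noteq> 0" "k < p"
  shows "coord y x k / c ^ k \<in> K \<inter> above 0" "coord y x k * y ^ k = coord y x k / c ^ k * (c * y) ^ k"
proof -
  show eq: "coord y x k * y ^ k = coord y x k / c ^ k * (c * y) ^ k"
    using assms by (simp add: power_mult_distrib)
  have "coord y x k / c ^ k * (c * y) ^ k \<in> above (nmul k (v (c * y)))"
    using assms(1,4) unfolding adapted_def eq[symmetric] by blast
  then have "coord y x k / c ^ k * (c * y) ^ k / (c * y) ^ k \<in> above (nmul k (v (c * y)) - v ((c * y) ^ k))"
    using assms y by (intro above_divide) auto
  then show "coord y x k / c ^ k \<in> K \<inter> above 0"
    using assms y by (auto simp: v_power coord_in_K K_divide K_power)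
qed

lemma euler_adapted:
  assumes "adapted x e" "0 < e"
  shows "euler y x \<in> above e"
  unfolding euler_def[OF y]
proof (intro above_sum)
  fix k assume k: "k \<in> {..<p}"
  show "of_nat k * (coord y x k * y ^ k) \<in> above e"
  proof (cases "k = 0")
    case False
    then have "e \<le> nmul k e" using nmul_mono_left[of e 1 k] assms by simp
    then have "coord y x k * y ^ k \<in> above e"
      using assms k by (auto simp: adapted_def intro: above_mono)
    then show ?thesis by (rule above_mult0[OF above_of_nat])
  qed simp
qed

text \<open>The constant coordinate is deleted, and every other term of an adapted element has value
  at least \<open>e\<close>.\<close>

lemma euler_in_J:
  assumes "x \<in> above 0"
  shows "euler y x / \<theta> \<in> J 1"
proof -
  obtain e where e: "good e" "adapted x e" using small_ex[OF small_adapted[OF assms]] by blast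
  then have "euler y x \<in> above e" by (intro euler_adapted) (auto simp: good_def)
  then have "euler y x / \<theta> \<in> above (e - \<eta>)" using theta by (intro above_divide)
  then show ?thesis using good_Pos[OF e(1)] by (auto simp: J_def)
qed

text \<open>In total degree below \<open>p\<close> the rule holds exactly. Otherwise the defect is
  that of \<open>euler_pow_mult\<close> with \<open>\<delta> = (p - 1) \<eta>\<close>, and the
  product \<open>s * t\<close> has value at least \<open>(k + l) e \<ge> p e\<close>.\<close>

lemma euler_leibniz_monomial:
  assumes e: "0 \<le> e" and a: "a \<in> K" "a * y ^ k \<in> above (nmul k e)" "k < p"
    and b: "b \<in> K" "b * y ^ l \<in> above (nmul l e)" "l < p"
  defines "s \<equiv> a * y ^ k" and "t \<equiv> b * y ^ l"
  shows "euler y (s * t) - s * euler y t - t * euler y s \<in> above (nmul p e - nmul (p - 1) \<eta>)"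
proof (cases "a = 0 \<or> b = 0")
  case True
  then show ?thesis using K_zero by (auto simp: s_def t_def euler_zero[OF y])
next
  case False
  have st: "s * t = (a * b) * (y ^ k * y ^ l)" by (simp add: s_def t_def)
  have "euler y (s * t) - s * euler y t - t * euler y s =
      a * b * (euler y (y ^ k * y ^ l) - y ^ k * euler y (y ^ l) - of_nat k * (y ^ k * y ^ l))"
    unfolding st using a b
    by (simp add: s_def t_def euler_scale[OF y] euler_pow[OF y] K_mult algebra_simps)
  moreover have "\<dots> \<in> above (nmul p e - nmul (p - 1) \<eta>)"
  proof (cases "k + l < p")
    case True
    then have "euler y (y ^ k * y ^ l) = of_nat (k + l) * (y ^ k * y ^ l)"
      using euler_pow[OF y, of "k + l"] by (simp add: power_add)
    then show ?thesis using euler_pow[OF y b(3)] by (simp add: algebra_simps)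
  next
    case False
    have "v (euler y (y ^ p)) = v (y ^ p) - nmul (p - 1) \<eta>" using v_euler_top(2)[OF j_bounds] .
    then have "euler y (y ^ p) \<in> above (v (y ^ p) - nmul (p - 1) \<eta>)" by (metis above_v)
    from euler_pow_mult[OF y this]
    have "euler y (y ^ k * y ^ l) - y ^ k * euler y (y ^ l) - of_nat k * (y ^ k * y ^ l) \<in>
        above (v (y ^ k) + v (y ^ l) - nmul (p - 1) \<eta>)" .
    then have "a * b * (euler y (y ^ k * y ^ l) - y ^ k * euler y (y ^ l) - of_nat k * (y ^ k * y ^ l)) \<in>
        above (v (a * b) + (v (y ^ k) + v (y ^ l) - nmul (p - 1) \<eta>))"
      by (intro above_mult) auto
    moreover have "nmul p e - nmul (p - 1) \<eta> \<le> v (a * b) + (v (y ^ k) + v (y ^ l) - nmul (p - 1) \<eta>)"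
    proof -
      have "nmul p e \<le> nmul (k + l) e" using False e by (intro nmul_mono_left) auto
      also have "\<dots> \<le> v s + v t"
        using a b \<open>\<not> (a = 0 \<or> b = 0)\<close> y by (auto simp: nmul_add above_def s_def t_def intro: add_mono)
      finally show ?thesis
        using \<open>\<not> (a = 0 \<or> b = 0)\<close> y by (simp add: s_def t_def v_mult algebra_simps)
    qed
    ultimately show ?thesis by (rule above_mono)
  qed
  ultimately show ?thesis by simp
qed

lemma euler_leibniz:
  assumes "x \<in> above 0" "x' \<in> above 0"
  shows "(euler y (x * x') - x * euler y x' - x' * euler y x) / \<theta> \<in> J p"
proof -
  obtain e where e: "good e" "adapted x e" "adapted x' e"
    using small_ex[OF small_conj[OF small_adapted[OF assms(1)] small_adapted[OF assms(2)]]] by blast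
  define L where "L = (\<lambda>s t. euler y (s * t) - s * euler y t - t * euler y s)"
  have Ls: "L (sum f S) t = (\<Sum>i\<in>S. L (f i) t)" for f t and S :: "nat set"
    by (simp add: L_def sum_distrib_left sum_distrib_right euler_sum[OF y] sum_subtractf)
  have Lt: "L s (sum f S) = (\<Sum>i\<in>S. L s (f i))" for f s and S :: "nat set"
    by (simp add: L_def sum_distrib_left sum_distrib_right euler_sum[OF y] sum_subtractf)
  have "L x x' = (\<Sum>k<p. \<Sum>l<p. L (coord y x k * y ^ k) (coord y x' l * y ^ l))"
    using Ls[of "\<lambda>k. coord y x k * y ^ k" "{..<p}" x'] Lt[of _ "\<lambda>l. coord y x' l * y ^ l" "{..<p}"]
      coord_sum[OF y, of x] coord_sum[OF y, of x'] by simp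
  also have "\<dots> \<in> above (nmul p e - nmul (p - 1) \<eta>)"
    unfolding L_def using e by (intro above_sum euler_leibniz_monomial)
      (auto simp: good_def adapted_def coord_in_K[OF y])
  finally have "L x x' / \<theta> \<in> above (nmul p e - nmul (p - 1) \<eta> - \<eta>)" using theta by (intro above_divide)
  moreover have "nmul p e - nmul (p - 1) \<eta> - \<eta> = nmul p (e - \<eta>)"
    by (simp add: nmul_diff nmul_p_Suc[of \<eta>])
  ultimately show ?thesis using good_Pos[OF e(1)] by (auto simp: J_def L_def)
qed

text \<open>As \<open>euler\<close> preserves values outside \<open>vK\<close>, the elements
  \<open>euler y b / \<theta>\<close> attain every value \<open>d - \<eta>\<close> with
  \<open>d\<close> in \<open>Pos\<close>; anything of larger or equal value is an integral
  multiple.\<close>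

lemma J_generated:
  assumes "t \<in> J 1"
  shows "\<exists>b\<in>above 0. \<exists>u\<in>above 0. t = u * (euler y b / \<theta>)"
proof -
  obtain d where d: "d \<in> Pos" "t \<in> above (d - \<eta>)" using assms by (auto simp: J_def)
  obtain b where b: "b \<noteq> 0" "v b = d" using d by (auto simp: Pos_def vL_iff)
  have "v b \<notin> vK" "0 < d" using b d by (auto simp: Pos_def)
  note e = v_euler[OF y b(1) this(1)]
  have "t / (euler y b / \<theta>) \<in> above ((d - \<eta>) - v (euler y b / \<theta>))"
    using d e theta by (intro above_divide) auto
  then have "t / (euler y b / \<theta>) \<in> above 0" using e theta b by (simp add: v_divide)
  moreover have "b \<in> above 0" using b \<open>0 < d\<close> by (auto simp: above_def)
  ultimately show ?thesis using e theta
    by (intro bexI[of _ b] bexI[of _ "t / (euler y b / \<theta>)"]) auto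
qed

end

section \<open>Quotients of modules\<close>

lemma submodule_abelian_subgroup:
  assumes "module B M" "submodule N B M"
  shows "abelian_subgroup N M"
proof -
  interpret module B M by fact
  interpret submodule N B M by fact
  show ?thesis
    by (rule abelian_subgroupI3) (auto simp: additive_subgroup_def subgroup_axioms M.abelian_group_axioms)
qed

lemma a_r_coset_eq_iff:
  assumes "module B M" "submodule N B M" "x \<in> carrier M" "y \<in> carrier M"
  shows "N +>\<^bsub>M\<^esub> x = N +>\<^bsub>M\<^esub> y \<longleftrightarrow> x \<ominus>\<^bsub>M\<^esub> y \<in> N"
proof -
  interpret module B M by fact
  interpret submodule N B M by fact
  interpret A: abelian_subgroup N M by (rule submodule_abelian_subgroup[OF assms(1,2)])
  have sub: "N \<subseteq> carrier M" using A.a_subset .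
  show ?thesis
  proof
    assume "N +>\<^bsub>M\<^esub> x = N +>\<^bsub>M\<^esub> y"
    then have "N +>\<^bsub>M\<^esub> (x \<ominus>\<^bsub>M\<^esub> y) = N"
      using M.a_coset_add_inv2[OF _ assms(3,4) sub] by (simp add: M.minus_eq)
    then show "x \<ominus>\<^bsub>M\<^esub> y \<in> N"
      using M.a_coset_join1[of N "x \<ominus>\<^bsub>M\<^esub> y"] assms subgroup_axioms by simp
  next
    assume "x \<ominus>\<^bsub>M\<^esub> y \<in> N"
    then have "(x \<ominus>\<^bsub>M\<^esub> y) \<oplus>\<^bsub>M\<^esub> y \<in> N +>\<^bsub>M\<^esub> y"
      using sub assms by (intro M.a_rcosI)
    moreover have "(x \<ominus>\<^bsub>M\<^esub> y) \<oplus>\<^bsub>M\<^esub> y = x"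
      using assms by (simp add: M.minus_eq M.a_assoc M.l_neg)
    ultimately show "N +>\<^bsub>M\<^esub> x = N +>\<^bsub>M\<^esub> y"
      using M.a_repr_independence[of x N y] assms subgroup_axioms by simp
  qed
qed

text \<open>The first isomorphism theorem, applied to \<open>h\<close> followed by the projection to
  the second quotient.\<close>

lemma quotient_module_isomorphic:
  assumes M: "module B M" "submodule N B M" and T: "module B T" "submodule Q B T"
    and h: "\<And>x. x \<in> carrier M \<Longrightarrow> h x \<in> carrier T"
    and h_add: "\<And>x y. x \<in> carrier M \<Longrightarrow> y \<in> carrier M \<Longrightarrow> h (x \<oplus>\<^bsub>M\<^esub> y) = h x \<oplus>\<^bsub>T\<^esub> h y"
    and h_smult: "\<And>b x. b \<in> carrier B \<Longrightarrow> x \<in> carrier M \<Longrightarrow> h (b \<odot>\<^bsub>M\<^esub> x) = b \<odot>\<^bsub>T\<^esub> h x"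
    and surj: "\<And>t. t \<in> carrier T \<Longrightarrow> \<exists>x\<in>carrier M. h x = t"
    and kernel: "\<And>x. x \<in> carrier M \<Longrightarrow> h x \<in> Q \<longleftrightarrow> x \<in> N"
  shows "module_isomorphic B (quotient_module M N) (quotient_module T Q)"
proof -
  interpret M: module B M by fact
  interpret T: module B T by fact
  interpret AM: abelian_subgroup N M by (rule submodule_abelian_subgroup[OF M])
  interpret AT: abelian_subgroup Q T by (rule submodule_abelian_subgroup[OF T])
  have h_zero: "h \<zero>\<^bsub>M\<^esub> = \<zero>\<^bsub>T\<^esub>"
    using h_add[of "\<zero>\<^bsub>M\<^esub>" "\<zero>\<^bsub>M\<^esub>"] h[of "\<zero>\<^bsub>M\<^esub>"] T.M.add.r_cancel_one' by simp
  have h_minus: "h (x \<ominus>\<^bsub>M\<^esub> y) = h x \<ominus>\<^bsub>T\<^esub> h y" if "x \<in> carrier M" "y \<in> carrier M" for x y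
  proof -
    have "h (\<ominus>\<^bsub>M\<^esub> y) \<oplus>\<^bsub>T\<^esub> h y = \<zero>\<^bsub>T\<^esub>"
      using h_add[of "\<ominus>\<^bsub>M\<^esub> y" y] that h_zero by (simp add: M.M.l_neg)
    then have "h (\<ominus>\<^bsub>M\<^esub> y) = \<ominus>\<^bsub>T\<^esub> h y"
      using T.M.minus_equality[of "h (\<ominus>\<^bsub>M\<^esub> y)" "h y"] that h by simp
    then show ?thesis using that h_add[of x "\<ominus>\<^bsub>M\<^esub> y"] by (simp add: M.M.minus_eq T.M.minus_eq)
  qed
  have eq_iff: "Q +>\<^bsub>T\<^esub> h x = Q +>\<^bsub>T\<^esub> h y \<longleftrightarrow> N +>\<^bsub>M\<^esub> x = N +>\<^bsub>M\<^esub> y"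
    if "x \<in> carrier M" "y \<in> carrier M" for x y
    using that h kernel[of "x \<ominus>\<^bsub>M\<^esub> y"]
    by (simp add: a_r_coset_eq_iff[OF M] a_r_coset_eq_iff[OF T] h_minus)
  \<comment> \<open>The union runs over equal sets, which defines \<open>f\<close> on cosets without
    choosing representatives.\<close>
  define f where "f = (\<lambda>C. \<Union>x\<in>C. Q +>\<^bsub>T\<^esub> h x)"
  have f: "f (N +>\<^bsub>M\<^esub> x) = Q +>\<^bsub>T\<^esub> h x" if x: "x \<in> carrier M" for x
  proof -
    have sub: "N +>\<^bsub>M\<^esub> x \<subseteq> carrier M" by (rule M.M.a_r_coset_subset_G[OF AM.a_subset x])
    have "Q +>\<^bsub>T\<^esub> h y = Q +>\<^bsub>T\<^esub> h x" if "y \<in> N +>\<^bsub>M\<^esub> x" for y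
      using that sub x AM.a_repr_independence'[OF that x] by (subst eq_iff) auto
    moreover have "x \<in> N +>\<^bsub>M\<^esub> x" by (rule AM.a_rcos_self[OF x])
    ultimately show ?thesis unfolding f_def by blast
  qed
  have cM: "carrier (quotient_module M N) = (\<lambda>x. N +>\<^bsub>M\<^esub> x) ` carrier M"
    by (auto simp: quotient_module_def A_RCOSETS_def')
  have cT: "carrier (quotient_module T Q) = (\<lambda>x. Q +>\<^bsub>T\<^esub> x) ` carrier T"
    by (auto simp: quotient_module_def A_RCOSETS_def')
  have addM: "(N +>\<^bsub>M\<^esub> x) \<oplus>\<^bsub>quotient_module M N\<^esub> (N +>\<^bsub>M\<^esub> y) = N +>\<^bsub>M\<^esub> (x \<oplus>\<^bsub>M\<^esub> y)"
    if "x \<in> carrier M" "y \<in> carrier M" for x y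
    using AM.a_rcos_sum[OF that] by (simp add: quotient_module_def)
  have addT: "(Q +>\<^bsub>T\<^esub> x) \<oplus>\<^bsub>quotient_module T Q\<^esub> (Q +>\<^bsub>T\<^esub> y) = Q +>\<^bsub>T\<^esub> (x \<oplus>\<^bsub>T\<^esub> y)"
    if "x \<in> carrier T" "y \<in> carrier T" for x y
    using AT.a_rcos_sum[OF that] by (simp add: quotient_module_def)
  show ?thesis
    unfolding module_isomorphic_def
  proof (intro exI[of _ f] conjI ballI)
    show "bij_betw f (carrier (quotient_module M N)) (carrier (quotient_module T Q))"
      unfolding bij_betw_def
    proof
      show "inj_on f (carrier (quotient_module M N))"
        by (auto simp: inj_on_def cM f eq_iff)
      show "f ` carrier (quotient_module M N) = carrier (quotient_module T Q)"
        unfolding cM cT image_image using f h surj by force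
    qed
  next
    fix C D assume "C \<in> carrier (quotient_module M N)" "D \<in> carrier (quotient_module M N)"
    then obtain x y where "x \<in> carrier M" "C = N +>\<^bsub>M\<^esub> x" "y \<in> carrier M" "D = N +>\<^bsub>M\<^esub> y"
      by (auto simp: cM)
    then show "f (C \<oplus>\<^bsub>quotient_module M N\<^esub> D) = f C \<oplus>\<^bsub>quotient_module T Q\<^esub> f D"
      using h by (simp add: addM addT f h_add)
  next
    fix b C assume "b \<in> carrier B" "C \<in> carrier (quotient_module M N)"
    then obtain x where "x \<in> carrier M" "C = N +>\<^bsub>M\<^esub> x" "b \<in> carrier B" by (auto simp: cM)
    then show "f (b \<odot>\<^bsub>quotient_module M N\<^esub> C) = b \<odot>\<^bsub>quotient_module T Q\<^esub> f C"
      using h by (simp add: quotient_module_smult[OF M] quotient_module_smult[OF T] f h_smult)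
  qed
qed

lemma span_submodule:
  assumes "module B M" "S \<subseteq> carrier M"
  shows "submodule (span_submodule B M S) B M" "S \<subseteq> span_submodule B M S"
    and "\<And>N. submodule N B M \<Longrightarrow> S \<subseteq> N \<Longrightarrow> span_submodule B M S \<subseteq> N"
proof -
  interpret module B M by fact
  have "submodule (carrier M) B M" by (rule submoduleI) auto
  then show "submodule (span_submodule B M S) B M"
    unfolding span_submodule_def using assms(2) submoduleE(3-5)
    by (intro submoduleI) (auto simp: subgroup.one_closed[OF submodule.axioms(1), simplified])
qed (auto simp: span_submodule_def)

section \<open>Ideals of the valuation ring\<close>

context krull_valued
begin

abbreviation "O_L \<equiv> valuation_ring v UNIV"

lemma O_L_simps [simp]:
  "carrier O_L = above 0" "monoid.mult O_L = (*)" "one O_L = 1" "ring.zero O_L = 0" "add O_L = (+)"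
  by (simp_all add: valuation_ring_def above_def)

lemma O_L_cring: "cring O_L"
proof (rule cringI)
  show "abelian_group O_L"
    by (rule abelian_groupI) (auto simp: add_ac above_add intro!: bexI[of _ "- _"] above_minus)
  show "comm_monoid O_L"
    by (rule comm_monoidI) (auto simp: mult_ac intro: above_mult0)
qed (auto simp: distrib_right)

sublocale O_L: cring O_L by (rule O_L_cring)

lemma O_L_uminus: "x \<in> above 0 \<Longrightarrow> \<ominus>\<^bsub>O_L\<^esub> x = - x"
  using O_L.minus_equality[of "- x" x] by (simp add: above_minus)

lemma O_L_idealI:
  assumes "S \<subseteq> above 0" "0 \<in> S" "\<And>x y. x \<in> S \<Longrightarrow> y \<in> S \<Longrightarrow> x + y \<in> S"
    "\<And>b x. b \<in> above 0 \<Longrightarrow> x \<in> S \<Longrightarrow> b * x \<in> S"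
  shows "ideal S O_L"
proof (rule idealI)
  show "ring O_L" by (rule O_L.ring_axioms)
  show "subgroup S (add_monoid O_L)"
  proof (rule subgroup.intro)
    fix x assume x: "x \<in> S"
    have "- x \<in> S" using assms(4)[OF above_minus[OF above_one] x] by simp
    then show "inv\<^bsub>add_monoid O_L\<^esub> x \<in> S"
      using x assms(1) O_L_uminus[of x] by (auto simp: a_inv_def)
  qed (use assms in auto)
next
  fix a x assume "a \<in> S" "x \<in> carrier O_L"
  then show "x \<otimes>\<^bsub>O_L\<^esub> a \<in> S" "a \<otimes>\<^bsub>O_L\<^esub> x \<in> S"
    using assms(4)[of x a] by (simp_all add: mult.commute)
qed

lemma O_L_ideal_mult: "ideal S O_L \<Longrightarrow> b \<in> above 0 \<Longrightarrow> x \<in> S \<Longrightarrow> b * x \<in> S"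
  using ideal.I_l_closed[of S O_L x b] by simp

lemma ideal_module_simps [simp]:
  "carrier (ideal_module O_L S) = S" "ring.zero (ideal_module O_L S) = 0"
  "add (ideal_module O_L S) = (+)" "module.smult (ideal_module O_L S) = (*)"
  by (simp_all add: ideal_module_def)

lemma ideal_module_module:
  assumes S: "ideal S O_L"
  shows "module O_L (ideal_module O_L S)"
proof -
  interpret ideal S O_L by fact
  have sub: "S \<subseteq> above 0" using a_subset by simp
  have cl: "x + y \<in> S" "0 \<in> S" if "x \<in> S" "y \<in> S" for x y
    using a_closed[OF that] zero_closed by simp_all
  have minus: "- x \<in> S" if "x \<in> S" for x
    using O_L_ideal_mult[OF S above_minus[OF above_one] that] by simp
  show ?thesis
  proof (rule moduleI)
    show "abelian_group (ideal_module O_L S)"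
      using cl minus zero_closed by (intro abelian_groupI) (auto simp: add_ac intro!: bexI[of _ "- _"])
  qed (auto simp: O_L_cring O_L_ideal_mult[OF S] algebra_simps)
qed

lemma ideal_module_submodule:
  assumes S: "ideal S O_L" and T: "ideal T O_L" "T \<subseteq> S"
  shows "submodule T O_L (ideal_module O_L S)"
proof -
  interpret M: module O_L "ideal_module O_L S" by (rule ideal_module_module[OF S])
  interpret T: ideal T O_L by fact
  show ?thesis
  proof (rule M.submoduleI)
    fix x assume x: "x \<in> T"
    have "- x \<in> T" using O_L_ideal_mult[OF T(1) above_minus[OF above_one] x] by simp
    moreover from this have "\<ominus>\<^bsub>ideal_module O_L S\<^esub> x = - x"
      using x T(2) by (intro M.M.minus_equality) auto
    ultimately show "\<ominus>\<^bsub>ideal_module O_L S\<^esub> x \<in> T" by (simp only:)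
  next
    fix x y assume "x \<in> T" "y \<in> T"
    then show "x \<oplus>\<^bsub>ideal_module O_L S\<^esub> y \<in> T" using T.a_closed[of x y] by simp
  qed (use T T.zero_closed O_L_ideal_mult[OF T(1)] in auto)
qed

lemma above_ideal: "0 \<le> \<gamma> \<Longrightarrow> ideal (above \<gamma>) O_L"
  by (rule O_L_idealI) (auto intro: above_mono above_add above_mult0)

end

context artin_schreier_generated
begin

lemma J_ideal: "ideal (J n) O_L"
  using J_subset J_zero J_add J_mult by (intro O_L_idealI)

lemma J_0: "J 0 = above 0"
  using eta_Pos by (auto simp: J_def)

text \<open>The two factors may come with different bounds from \<open>Pos\<close>, but the smaller
  bound serves both. Conversely, dividing by an element \<open>w\<close> of exact value
  \<open>e - \<eta>\<close> writes \<open>x\<close> as a single product.\<close>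

lemma J_prod: "ideal_prod O_L (J n) (J 1) = J (Suc n)"
proof (intro equalityI subsetI)
  fix x assume "x \<in> ideal_prod O_L (J n) (J 1)"
  then show "x \<in> J (Suc n)"
  proof (induction rule: ideal_prod.induct)
    case (prod s t)
    then obtain e f where e: "e \<in> Pos" "s \<in> above (nmul n (e - \<eta>))" "f \<in> Pos" "t \<in> above (f - \<eta>)"
      by (auto simp: J_def)
    define m where "m = min e f"
    have "nmul n (m - \<eta>) \<le> nmul n (e - \<eta>)" "m - \<eta> \<le> f - \<eta>"
      unfolding m_def by (intro nmul_mono diff_right_mono; simp)+
    then have "t * s \<in> above ((m - \<eta>) + nmul n (m - \<eta>))"
      using e by (intro above_mult) (auto elim: above_mono)
    moreover have "m \<in> Pos" using e by (simp add: m_def min_def)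
    ultimately show ?case by (auto simp: J_def mult.commute)
  next
    case (sum s t)
    then show ?case using J_add by simp
  qed
next
  fix x assume "x \<in> J (Suc n)"
  then obtain e where e: "e \<in> Pos" "x \<in> above (nmul (Suc n) (e - \<eta>))" by (auto simp: J_def)
  have "e - \<eta> \<in> vL" using e v_in_vL[OF theta] by (intro U_diff) (auto simp: Pos_def)
  then obtain w where w: "w \<noteq> 0" "v w = e - \<eta>" by (auto simp: vL_iff)
  have "x / w \<in> above (nmul (Suc n) (e - \<eta>) - v w)" using e w by (intro above_divide)
  then have "x / w \<in> J n" "w \<in> J 1" using e(1) w by (auto simp: J_def above_def)
  then have "x / w \<otimes>\<^bsub>O_L\<^esub> w \<in> ideal_prod O_L (J n) (J 1)" by (rule ideal_prod.prod)
  then show "x \<in> ideal_prod O_L (J n) (J 1)" using w by simp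
qed

lemma J_power: "ideal_power O_L (J 1) n = J n"
proof (induction n)
  case 0
  then show ?case by (simp add: nat_pow_def ideals_set_def J_0)
next
  case (Suc n)
  then show ?case using J_prod[of n] by (simp add: nat_pow_def ideals_set_def)
qed

lemma M_ideal_above: "M_ideal v K = {a. \<exists>g\<in>Pos. a \<in> above g}"
  using eta_Pos unfolding M_ideal_eq by (auto simp: above_def)

lemma theta_M: "(\<lambda>a. inverse \<theta> * a) ` M_ideal v K = J 1"
proof (intro equalityI subsetI)
  fix x assume "x \<in> (\<lambda>a. inverse \<theta> * a) ` M_ideal v K"
  then obtain a g where "g \<in> Pos" "a \<in> above g" "x = a / \<theta>"
    by (auto simp: M_ideal_above divide_inverse mult.commute)
  then show "x \<in> J 1" using theta above_divide[of a g \<theta>] by (auto simp: J_def)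
next
  fix x assume "x \<in> J 1"
  then obtain e where e: "e \<in> Pos" "x \<in> above (e - \<eta>)" by (auto simp: J_def)
  have "\<theta> * x \<in> above (\<eta> + (e - \<eta>))" using e by (intro above_mult) auto
  then have "\<theta> * x \<in> M_ideal v K" using e by (auto simp: M_ideal_above)
  then show "x \<in> (\<lambda>a. inverse \<theta> * a) ` M_ideal v K"
    using theta by (intro image_eqI[of _ _ "\<theta> * x"]) auto
qed

text \<open>\<open>\<sigma> \<theta> - \<theta>\<close> is a root of \<open>X\<^sup>p - X\<close>.\<close>

lemma aut_theta:
  assumes s: "\<sigma> \<in> galois_group K"
  shows "\<sigma> \<theta> - \<theta> = 0 \<or> v (\<sigma> \<theta> - \<theta>) = 0"
proof -
  define k where "k = \<sigma> \<theta> - \<theta>"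
  have "\<sigma> \<theta> ^ p - \<sigma> \<theta> = \<sigma> (\<theta> ^ p - \<theta>)" by (simp add: aut_diff[OF s] aut_power[OF s])
  also have "\<dots> = \<theta> ^ p - \<theta>" by (rule aut_K[OF s theta_K])
  finally have "(\<theta> + k) ^ p - (\<theta> + k) = \<theta> ^ p - \<theta>" by (simp add: k_def)
  moreover have "(\<theta> + k) ^ p = \<theta> ^ p + k ^ p" by (rule freshmans_dream) (simp_all add: p_prime char)
  ultimately have kp: "k ^ p = k" by (simp add: algebra_simps)
  have "v k = 0" if "k \<noteq> 0"
  proof -
    have "nmul p (v k) = v k" using v_power[OF that, of p] kp by simp
    then have "nmul (p - 1) (v k) = 0" by (simp add: nmul_p_Suc)
    then show ?thesis using p_gt_1 by (simp add: nmul_eq_0_iff)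
  qed
  then show ?thesis by (auto simp: k_def)
qed

text \<open>Substituting \<open>\<sigma> \<theta> = \<theta> * (1 + k / \<theta>)\<close> into the
  expansion of \<open>b\<close> multiplies each term, of value at least \<open>v b\<close>, by a
  power of \<open>1 + k / \<theta>\<close>, which differs from 1 by an element of value at least
  \<open>- \<eta>\<close>.\<close>

lemma aut_diff_above:
  assumes s: "\<sigma> \<in> galois_group K" and b: "b \<noteq> 0"
  shows "(\<sigma> b - b) / b \<in> above (- \<eta>)"
proof -
  note th = theta v_theta
  define k where "k = \<sigma> \<theta> - \<theta>"
  have "k \<in> above 0" using aut_theta[OF s] by (auto simp: k_def above_def)
  then have k: "k / \<theta> \<in> above (- \<eta>)" using above_divide[of k 0 \<theta>] theta by simp
  have "\<sigma> b = \<sigma> (\<Sum>i<p. coord \<theta> b i * \<theta> ^ i)" using coord_sum[OF th, of b] by simp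
  also have "\<dots> = (\<Sum>i<p. coord \<theta> b i * (\<theta> + k) ^ i)"
    by (simp add: aut_sum[OF s] aut_mult[OF s] aut_power[OF s] aut_K[OF s] coord_in_K[OF th] k_def)
  finally have "\<sigma> b - b = (\<Sum>i<p. coord \<theta> b i * (\<theta> + k) ^ i) - (\<Sum>i<p. coord \<theta> b i * \<theta> ^ i)"
    using coord_sum[OF th, of b] by simp
  also have "\<dots> = (\<Sum>i<p. (coord \<theta> b i * \<theta> ^ i) * ((1 + k / \<theta>) ^ i - 1))"
  proof -
    have "\<theta> + k = \<theta> * (1 + k / \<theta>)" using theta by (simp add: distrib_left)
    then have "(\<theta> + k) ^ i = \<theta> ^ i * (1 + k / \<theta>) ^ i" for i by (simp add: power_mult_distrib)
    then show ?thesis by (simp add: sum_subtractf[symmetric] algebra_simps)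
  qed
  also have "\<dots> \<in> above (v b + - \<eta>)"
    using theta_neg k by (intro above_sum above_mult coord_above[OF th] one_plus_power_above) auto
  finally have "(\<sigma> b - b) / b \<in> above (v b + - \<eta> - v b)" using b by (intro above_divide)
  then show ?thesis by simp
qed

text \<open>The bound of \<open>aut_diff_above\<close> is attained at \<open>b = \<theta>\<close>,
  where \<open>\<sigma> \<theta> - \<theta>\<close> is a unit for every \<sigma> moving
  \<theta>.\<close>

lemma ramification_ideal_eq: "ramification_ideal v K = above (- \<eta>)"
proof -
  let ?S = "{(\<sigma> b - b) / b | \<sigma> b. \<sigma> \<in> galois_group K \<and> b \<noteq> 0}"
  have ideal: "ideal (above (- \<eta>)) O_L" using theta_neg by (intro above_ideal) simp
  have "above (- \<eta>) \<subseteq> S" if S: "ideal S O_L" "?S \<subseteq> S" for S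
  proof
    fix x assume x: "x \<in> above (- \<eta>)"
    have "\<theta> \<notin> K" using theta v_theta v_in_vK by blast
    then obtain \<sigma> where s: "\<sigma> \<in> galois_group K" "\<sigma> \<theta> \<noteq> \<theta>" using fixed_field by blast
    define t where "t = (\<sigma> \<theta> - \<theta>) / \<theta>"
    have "t \<in> S" using S(2) s theta by (auto simp: t_def)
    have t: "t \<noteq> 0" "v t = - \<eta>" using aut_theta[OF s(1)] s(2) theta by (auto simp: t_def v_divide)
    have "x / t \<in> above (- \<eta> - v t)" using x t by (intro above_divide)
    then have "x / t * t \<in> S" using t \<open>t \<in> S\<close> by (intro O_L_ideal_mult[OF S(1)]) auto
    then show "x \<in> S" using t by simp
  qed
  moreover have "?S \<subseteq> above (- \<eta>)" using aut_diff_above by blast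
  ultimately show ?thesis
    unfolding ramification_ideal_def genideal_def using ideal by (intro equalityI Inf_lower Inf_greatest) auto
qed

lemma I_M: "ideal_prod O_L (ramification_ideal v K) (M_ideal v K) = J 1"
proof (intro equalityI subsetI)
  fix x assume "x \<in> ideal_prod O_L (ramification_ideal v K) (M_ideal v K)"
  then show "x \<in> J 1"
  proof (induction rule: ideal_prod.induct)
    case (prod s t)
    then obtain g where "g \<in> Pos" "t \<in> above g" by (auto simp: M_ideal_above)
    moreover have "s \<in> above (- \<eta>)" using prod by (simp add: ramification_ideal_eq)
    ultimately show ?case using above_mult[of t g s "- \<eta>"] by (auto simp: J_def mult.commute)
  next
    case (sum s t)
    then show ?case using J_add by simp
  qed
next
  fix x assume "x \<in> J 1"
  then obtain a where a: "a \<in> M_ideal v K" "x = inverse \<theta> * a" using theta_M by blast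
  have "inverse \<theta> \<in> ramification_ideal v K"
    using theta by (simp add: ramification_ideal_eq above_def v_inverse)
  then have "inverse \<theta> \<otimes>\<^bsub>O_L\<^esub> a \<in> ideal_prod O_L (ramification_ideal v K) (M_ideal v K)"
    using a by (intro ideal_prod.prod)
  then show "x \<in> ideal_prod O_L (ramification_ideal v K) (M_ideal v K)" using a by simp
qed

lemma generate_theta: "generate_field field_ring (insert \<theta> K) = UNIV"
proof -
  let ?G = "generate_field field_ring (insert \<theta> K)"
  have K: "c \<in> ?G" if "c \<in> K" for c using that by (intro generate_field.incl) simp
  have add: "a + b \<in> ?G" if "a \<in> ?G" "b \<in> ?G" for a b
    using generate_field.eng_add[OF that] by simp
  have mult: "a * b \<in> ?G" if "a \<in> ?G" "b \<in> ?G" for a b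
    using generate_field.eng_mult[OF that] by simp
  have "\<theta> \<in> ?G" by (rule generate_field.incl) simp
  then have pow: "\<theta> ^ k \<in> ?G" for k by (induction k) (auto intro: mult K K_one)
  have "(\<Sum>k<n. coord \<theta> x k * \<theta> ^ k) \<in> ?G" for x n
    by (induction n) (auto intro: add mult[OF K[OF coord_in_K[OF theta v_theta]] pow] K[OF K_zero])
  then have "x \<in> ?G" for x using coord_sum[OF theta v_theta, of x] by metis
  then show ?thesis by blast
qed

lemma value_group_theta: "vL = {\<gamma> + int_multiple n \<eta> | \<gamma> n. \<gamma> \<in> vK}"
proof (intro equalityI subsetI)
  fix b assume "b \<in> vL"
  then obtain i where "b - nmul i \<eta> \<in> vK" using gen[OF v_in_vL[OF theta] v_theta] by blast
  then show "b \<in> {\<gamma> + int_multiple n \<eta> | \<gamma> n. \<gamma> \<in> vK}"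
    by (auto simp: int_multiple_of_nat intro!: exI[of _ "b - nmul i \<eta>"] exI[of _ "int i"])
next
  fix b assume "b \<in> {\<gamma> + int_multiple n \<eta> | \<gamma> n. \<gamma> \<in> vK}"
  then obtain \<gamma> n where b: "b = \<gamma> + int_multiple n \<eta>" "\<gamma> \<in> vK" by blast
  have "int_multiple n \<eta> \<in> vL"
    by (rule int_multiple_cases[of n \<eta>]) (auto simp: U_nmul U_uminus v_in_vL[OF theta])
  then show "b \<in> vL" using b V_sub U_add by auto
qed

end

section \<open>Kaehler differentials\<close>

lemma sum_fun_apply: "(\<Sum>x\<in>S. f x) z = (\<Sum>x\<in>S. f x z)"
  by (induction S rule: infinite_finite_induct) auto

context artin_schreier_coset
begin

abbreviation "O_K \<equiv> carrier (valuation_ring v K)"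
abbreviation "F \<equiv> free_module O_L (above 0)"
abbreviation "d \<equiv> kaehler_symbol O_L"

text \<open>Functions carry pointwise addition, so naming the scalar action allows ordinary additive
  arithmetic in the free module.\<close>

definition sc :: "'a \<Rightarrow> ('a \<Rightarrow> 'a) \<Rightarrow> 'a \<Rightarrow> 'a" where
  "sc b f = (\<lambda>x. b * f x)"

lemma sc_simps: "sc b (f + g) = sc b f + sc b g" "sc (b + c) f = sc b f + sc c f"
  "sc b (f - g) = sc b f - sc b g" "sc (- 1) f = - f" "sc 0 f = 0" "sc 1 f = f" "sc b 0 = 0"
  "sc b (sc c f) = sc (b * c) f"
  by (simp_all add: sc_def fun_eq_iff algebra_simps)

lemma sc_sum: "sc (sum g S) f = (\<Sum>x\<in>S. sc (g x) f)"
  by (induction S rule: infinite_finite_induct) (auto simp: sc_simps)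

lemma O_K_eq: "O_K = K \<inter> above 0"
  by (auto simp: valuation_ring_def above_def)

lemma F_module: "module O_L F"
  by (rule free_module_is_module[OF O_L_cring])

sublocale F: module O_L F by (rule F_module)

lemma F_carrier: "carrier F =
  {f. (\<forall>x\<in>above 0. f x \<in> above 0) \<and> (\<forall>x. x \<notin> above 0 \<longrightarrow> f x = 0) \<and> finite {x. f x \<noteq> 0}}"
  by (simp add: free_module_def)

lemma F_simps [simp]: "ring.zero F = 0" "add F = (+)" "module.smult F = sc"
  by (simp_all add: free_module_def fun_eq_iff sc_def)

lemma F_closed: "f \<in> carrier F \<Longrightarrow> g \<in> carrier F \<Longrightarrow> f + g \<in> carrier F"
  "b \<in> above 0 \<Longrightarrow> f \<in> carrier F \<Longrightarrow> sc b f \<in> carrier F" "0 \<in> carrier F"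
  using F.M.a_closed[of f g] F.smult_closed[of b f] F.M.zero_closed by simp_all

lemma F_uminus: "f \<in> carrier F \<Longrightarrow> \<ominus>\<^bsub>F\<^esub> f = - f"
  using F.M.minus_equality[of "- f" f] F_closed(2)[OF above_minus[OF above_one], of f]
  by (simp add: sc_simps)

lemma F_minus: "f \<in> carrier F \<Longrightarrow> g \<in> carrier F \<Longrightarrow> f \<ominus>\<^bsub>F\<^esub> g = f - g"
  by (simp add: F.M.minus_eq F_uminus)

lemma d_apply: "d b x = (if x = b then 1 else 0)"
  by (simp add: kaehler_symbol_def)

lemma d_carrier: "b \<in> above 0 \<Longrightarrow> d b \<in> carrier F"
  by (auto simp: F_carrier d_apply)

lemma relations_eq: "kaehler_relations O_L O_K =
  {d (b + c) - (d b + d c) | b c. b \<in> above 0 \<and> c \<in> above 0} \<union>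
  {d (b * c) - (sc b (d c) + sc c (d b)) | b c. b \<in> above 0 \<and> c \<in> above 0} \<union> {d a | a. a \<in> O_K}"
proof -
  have minus: "d (b + c) \<ominus>\<^bsub>F\<^esub> (d b + d c) = d (b + c) - (d b + d c)"
    "d (b * c) \<ominus>\<^bsub>F\<^esub> (sc b (d c) + sc c (d b)) = d (b * c) - (sc b (d c) + sc c (d b))"
    if "b \<in> above 0" "c \<in> above 0" for b c
    using that by (simp_all add: F_minus d_carrier F_closed above_add above_mult0)
  show ?thesis
    unfolding kaehler_relations_def Let_def O_L_simps F_simps
    by (intro arg_cong2[where f = "(\<union>)"] Collect_cong iff_exI refl) (auto simp: minus)
qed

abbreviation "N \<equiv> span_submodule O_L F (kaehler_relations O_L O_K)"

lemma relations_carrier: "kaehler_relations O_L O_K \<subseteq> carrier F"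
proof -
  have "f - g \<in> carrier F" if "f \<in> carrier F" "g \<in> carrier F" for f g
    using F_minus[OF that] that F.M.minus_closed by metis
  then show ?thesis
    unfolding relations_eq by (auto simp: O_K_eq d_carrier F_closed above_add above_mult0)
qed

lemmas N_submodule = span_submodule(1)[OF F_module relations_carrier]
  and N_relations = span_submodule(2)[OF F_module relations_carrier]
  and N_least = span_submodule(3)[OF F_module relations_carrier]

lemma N_zero: "0 \<in> N"
  using subgroup.one_closed[OF submodule.axioms(1)[OF N_submodule]] by simp

lemma N_add: "f \<in> N \<Longrightarrow> g \<in> N \<Longrightarrow> f + g \<in> N"
  using F.submoduleE(5)[OF N_submodule, of f g] by simp

lemma N_sc: "b \<in> above 0 \<Longrightarrow> f \<in> N \<Longrightarrow> sc b f \<in> N"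
  using F.submoduleE(4)[OF N_submodule, of b f] by simp

text \<open>Equality of differentials, expressed by representatives in the free module.\<close>

definition cong :: "('a \<Rightarrow> 'a) \<Rightarrow> ('a \<Rightarrow> 'a) \<Rightarrow> bool" where
  "cong f g \<longleftrightarrow> f - g \<in> N"

lemma cong_refl [simp]: "cong f f"
  by (simp add: cong_def N_zero)

lemma cong_trans [trans]: "cong f g \<Longrightarrow> cong g h \<Longrightarrow> cong f h"
  using N_add[of "f - g" "g - h"] by (simp add: cong_def)

lemma cong_sym: "cong f g \<Longrightarrow> cong g f"
  using N_sc[of "- 1" "f - g"] above_minus[OF above_one] by (simp add: cong_def sc_simps)

lemma cong_add: "cong f g \<Longrightarrow> cong f' g' \<Longrightarrow> cong (f + f') (g + g')"
  using N_add[of "f - g" "f' - g'"] by (simp add: cong_def algebra_simps)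

lemma cong_sc: "b \<in> above 0 \<Longrightarrow> cong f g \<Longrightarrow> cong (sc b f) (sc b g)"
  using N_sc[of b "f - g"] by (simp add: cong_def sc_simps)

lemma cong_sum: "(\<And>x. x \<in> S \<Longrightarrow> cong (f x) (g x)) \<Longrightarrow> cong (sum f S) (sum g S)"
  by (induction S rule: infinite_finite_induct) (auto intro: cong_add)

lemma d_add: "b \<in> above 0 \<Longrightarrow> c \<in> above 0 \<Longrightarrow> cong (d (b + c)) (d b + d c)"
  using N_relations unfolding relations_eq cong_def by blast

lemma d_mult: "b \<in> above 0 \<Longrightarrow> c \<in> above 0 \<Longrightarrow> cong (d (b * c)) (sc b (d c) + sc c (d b))"
  using N_relations unfolding relations_eq cong_def by blast

lemma d_const: "a \<in> O_K \<Longrightarrow> cong (d a) 0"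
  using N_relations unfolding relations_eq cong_def by auto

lemma d_const_mult:
  assumes "a \<in> O_K" "x \<in> above 0"
  shows "cong (d (a * x)) (sc a (d x))"
proof -
  have a: "a \<in> above 0" using assms by (simp add: O_K_eq)
  then have "cong (d (a * x)) (sc a (d x) + sc x (d a))" using assms by (intro d_mult)
  also have "cong \<dots> (sc a (d x) + sc x 0)" using assms a by (intro cong_add cong_sc d_const) auto
  finally show ?thesis by (simp only: sc_simps add_0_right)
qed

lemma d_sum:
  assumes "\<And>i. i \<in> S \<Longrightarrow> g i \<in> above 0"
  shows "cong (d (sum g S)) (\<Sum>i\<in>S. d (g i))"
proof -
  have d0: "cong (d 0) 0" by (rule d_const) (simp add: O_K_eq K_zero)
  show ?thesis using assms
  proof (induction S rule: infinite_finite_induct)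
    case (insert x S)
    have "cong (d (g x + sum g S)) (d (g x) + d (sum g S))"
      using insert by (intro d_add above_sum) auto
    also have "cong \<dots> (d (g x) + (\<Sum>i\<in>S. d (g i)))"
      using insert by (intro cong_add) auto
    finally show ?case using insert.hyps by (simp only: sum.insert not_False_eq_True)
  qed (use d0 in auto)
qed

lemma d_power:
  assumes z: "z \<in> above 0"
  shows "cong (d (z ^ k)) (sc (of_nat k * z ^ (k - 1)) (d z))"
proof (induction k)
  case 0
  have "cong (d 1) 0" by (rule d_const) (simp add: O_K_eq K_one)
  then show ?case by (simp only: power_0 of_nat_0 mult_zero_left sc_simps)
next
  case (Suc k)
  have zk: "z ^ k \<in> above 0" using above_power[OF z, of k] by simp
  have "cong (d (z * z ^ k)) (sc z (d (z ^ k)) + sc (z ^ k) (d z))" by (rule d_mult[OF z zk])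
  also have "cong \<dots> (sc z (sc (of_nat k * z ^ (k - 1)) (d z)) + sc (z ^ k) (d z))"
    by (intro cong_add cong_sc Suc z cong_refl)
  also have "sc z (sc (of_nat k * z ^ (k - 1)) (d z)) + sc (z ^ k) (d z) = sc (of_nat (Suc k) * z ^ k) (d z)"
    by (cases k) (simp_all add: sc_simps(8) sc_simps(2)[symmetric] algebra_simps)
  finally show ?case by simp
qed

text \<open>An adapted \<open>x\<close> is a polynomial in \<open>z = c * y\<close> over
  \<open>O_K\<close>, so its differential is the derivative times \<open>d z\<close>. Rescaling
  \<open>y\<close> by a constant does not affect \<open>euler\<close>, hence the derivative is
  \<open>euler y x / z\<close>.\<close>

lemma d_adapted:
  assumes c: "c \<in> K" "c \<noteq> 0" "0 < v (c * y)" and x: "adapted x (v (c * y))"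
  shows "euler y x / (c * y) \<in> above 0" "cong (d x) (sc (euler y x / (c * y)) (d (c * y)))"
proof -
  define z where "z = c * y"
  have z: "z \<noteq> 0" "z \<in> above 0" using c y by (auto simp: z_def above_def)
  define a where "a = (\<lambda>k. coord y x k / c ^ k)"
  have ac: "a k \<in> K \<inter> above 0" "coord y x k * y ^ k = a k * z ^ k" if "k < p" for k
    using adapted_coeff[OF x c(1,2) that] by (simp_all only: a_def z_def)
  have zk: "z ^ k \<in> above 0" for k using above_power[OF z(2), of k] by simp
  show "euler y x / (c * y) \<in> above 0"
    using euler_adapted[OF x c(3)] c y by (simp add: above_divide_iff)
  have "x = (\<Sum>k<p. coord y x k * y ^ k)" by (rule coord_sum[OF y])
  also have "\<dots> = (\<Sum>k<p. a k * z ^ k)" by (rule sum.cong[OF refl], rule ac(2)) simp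
  finally have "x = (\<Sum>k<p. a k * z ^ k)" .
  then have "cong (d x) (\<Sum>k<p. d (a k * z ^ k))"
    using d_sum[of "{..<p}" "\<lambda>k. a k * z ^ k"] ac(1) zk by (auto intro: above_mult0)
  also have "cong \<dots> (\<Sum>k<p. sc (a k) (d (z ^ k)))"
    using ac(1) zk by (intro cong_sum d_const_mult) (auto simp: O_K_eq)
  also have "cong \<dots> (\<Sum>k<p. sc (a k) (sc (of_nat k * z ^ (k - 1)) (d z)))"
    using ac(1) z by (intro cong_sum cong_sc d_power) auto
  also have "\<dots> = sc (\<Sum>k<p. a k * (of_nat k * z ^ (k - 1))) (d z)"
    by (simp add: sc_sum sc_simps)
  also have "(\<Sum>k<p. a k * (of_nat k * z ^ (k - 1))) = euler y x / z"
    unfolding euler_def[OF y] sum_divide_distrib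
  proof (rule sum.cong)
    fix k assume "k \<in> {..<p}"
    then show "a k * (of_nat k * z ^ (k - 1)) = of_nat k * (coord y x k * y ^ k) / z"
      using ac(2)[of k] z(1) by (cases k) auto
  qed simp
  finally show "cong (d x) (sc (euler y x / (c * y)) (d (c * y)))" by (simp only: z_def)
qed

text \<open>Compares two evaluations of \<open>d (z ^ p)\<close>: by the power rule, and after
  reducing \<open>z ^ p\<close> to a polynomial of degree below \<open>p\<close> in
  \<open>z\<close>.\<close>

lemma d_top:
  assumes c: "c \<in> K" "c \<noteq> 0" "0 < v (c * y)"
  shows "cong (sc (euler y ((c * y) ^ p) / (c * y)) (d (c * y))) 0"
proof -
  define z where "z = c * y"
  have z: "z \<noteq> 0" "z \<in> above 0" using c y by (auto simp: z_def above_def)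
  have "adapted (z ^ p) (v z)"
    unfolding adapted_def
  proof (intro allI impI)
    fix k assume k: "k < p"
    have "coord y (z ^ p) k * y ^ k \<in> above (v (z ^ p))" by (rule coord_above[OF y above_v k])
    moreover have "nmul k (v z) \<le> v (z ^ p)"
      using z k c by (auto simp: v_power z_def intro: nmul_mono_left)
    ultimately show "coord y (z ^ p) k * y ^ k \<in> above (nmul k (v z))" by (rule above_mono)
  qed
  then have "cong (d (z ^ p)) (sc (euler y (z ^ p) / z) (d z))"
    using d_adapted(2)[OF c] by (simp add: z_def)
  moreover have "cong (d (z ^ p)) 0"
    using d_power[OF z(2), of p] char of_nat_CHAR[where 'a = 'a] by (simp add: sc_simps)
  ultimately show ?thesis unfolding z_def by (meson cong_sym cong_trans)
qed

section \<open>The comparison map from differentials to ideals\<close>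

definition Psi :: "('a \<Rightarrow> 'a) \<Rightarrow> 'a" where
  "Psi f = (\<Sum>x | f x \<noteq> 0. f x * (euler y x / \<theta>))"

lemma Psi_superset: "finite S \<Longrightarrow> {x. f x \<noteq> 0} \<subseteq> S \<Longrightarrow> Psi f = (\<Sum>x\<in>S. f x * (euler y x / \<theta>))"
  unfolding Psi_def by (rule sum.mono_neutral_left) auto

lemma Psi_add:
  assumes "f \<in> carrier F" "g \<in> carrier F"
  shows "Psi (f + g) = Psi f + Psi g"
proof -
  let ?S = "{x. f x \<noteq> 0} \<union> {x. g x \<noteq> 0}"
  have "finite ?S" using assms by (simp add: F_carrier)
  then have "Psi (f + g) = (\<Sum>x\<in>?S. (f + g) x * (euler y x / \<theta>))"
    "Psi f = (\<Sum>x\<in>?S. f x * (euler y x / \<theta>))" "Psi g = (\<Sum>x\<in>?S. g x * (euler y x / \<theta>))"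
    by (intro Psi_superset; auto)+
  then show ?thesis by (simp only: plus_fun_apply distrib_right sum.distrib)
qed

lemma Psi_sc:
  assumes "f \<in> carrier F"
  shows "Psi (sc b f) = b * Psi f"
proof -
  have "finite {x. f x \<noteq> 0}" using assms by (simp add: F_carrier)
  then have "Psi (sc b f) = (\<Sum>x | f x \<noteq> 0. sc b f x * (euler y x / \<theta>))"
    by (rule Psi_superset) (auto simp: sc_def)
  then show ?thesis by (simp add: Psi_def sc_def sum_distrib_left mult.assoc)
qed

lemma Psi_diff:
  assumes "f \<in> carrier F" "g \<in> carrier F"
  shows "Psi (f - g) = Psi f - Psi g"
  using Psi_add[of f "sc (- 1) g"] Psi_sc[of g "- 1"] assms F_closed(2)[OF above_minus[OF above_one], of g]
  by (simp add: sc_simps)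

lemma Psi_d: "Psi (d b) = euler y b / \<theta>"
  using Psi_superset[of "{b}" "d b"] by (auto simp: d_apply)

lemma Psi_in_J: "f \<in> carrier F \<Longrightarrow> Psi f \<in> J 1"
proof -
  assume f: "f \<in> carrier F"
  have sum: "sum g S \<in> J 1" if "\<And>x. x \<in> S \<Longrightarrow> g x \<in> J 1" for g and S :: "'a set"
    using that by (induction S rule: infinite_finite_induct) (auto intro: J_zero J_add)
  show ?thesis
    unfolding Psi_def
  proof (rule sum)
    fix x assume "x \<in> {x. f x \<noteq> 0}"
    then have "x \<in> above 0" "f x \<in> above 0" using f by (auto simp: F_carrier)
    then show "f x * (euler y x / \<theta>) \<in> J 1" by (intro J_mult euler_in_J)
  qed
qed

lemma Psi_surj: "t \<in> J 1 \<Longrightarrow> \<exists>f\<in>carrier F. Psi f = t"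
proof -
  assume "t \<in> J 1"
  then obtain b u where "b \<in> above 0" "u \<in> above 0" "t = u * (euler y b / \<theta>)"
    using J_generated by blast
  then show ?thesis by (intro bexI[of _ "sc u (d b)"]) (auto simp: Psi_sc Psi_d d_carrier F_closed)
qed

text \<open>By linearity only generators matter: additivity and constants are sent to 0, and the
  Leibniz relations to the error bounded by \<open>euler_leibniz\<close>.\<close>

lemma N_imp_Psi:
  assumes "f \<in> N"
  shows "Psi f \<in> J p"
proof -
  let ?P = "{f \<in> carrier F. Psi f \<in> J p}"
  have "Psi 0 = 0" by (simp add: Psi_def)
  have "submodule ?P O_L F"
  proof (rule F.submoduleI)
    fix f assume "f \<in> ?P"
    then show "\<ominus>\<^bsub>F\<^esub> f \<in> ?P"
      using F.M.a_inv_closed[of f] Psi_diff[of 0 f] J_minus[of "Psi f" p] \<open>Psi 0 = 0\<close> F_closed(3)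
      by (auto simp: F_uminus)
  qed (auto simp: \<open>Psi 0 = 0\<close> J_zero F_closed Psi_add J_add Psi_sc J_mult)
  moreover have "kaehler_relations O_L O_K \<subseteq> ?P"
  proof
    fix r assume r: "r \<in> kaehler_relations O_L O_K"
    then have "r \<in> carrier F" using relations_carrier by blast
    moreover have "Psi r \<in> J p"
    proof -
      from r consider (add) b c where "b \<in> above 0" "c \<in> above 0" "r = d (b + c) - (d b + d c)"
        | (mult) b c where "b \<in> above 0" "c \<in> above 0" "r = d (b * c) - (sc b (d c) + sc c (d b))"
        | (const) a where "a \<in> O_K" "r = d a"
        unfolding relations_eq by blast
      then show ?thesis
      proof cases
        case add
        then have "Psi r = 0"
          by (simp add: Psi_diff Psi_add Psi_d d_carrier F_closed above_add euler_add[OF y] add_divide_distrib)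
        then show ?thesis by (simp add: J_zero)
      next
        case mult
        then have "Psi r = (euler y (b * c) - b * euler y c - c * euler y b) / \<theta>"
          by (simp add: Psi_diff Psi_add Psi_sc Psi_d d_carrier F_closed above_mult0 diff_divide_distrib)
        then show ?thesis using euler_leibniz mult by simp
      next
        case const
        then show ?thesis by (simp add: Psi_d O_K_eq euler_K[OF y] J_zero)
      qed
    qed
    ultimately show "r \<in> ?P" by simp
  qed
  ultimately show ?thesis using N_least assms by blast
qed

text \<open>For one sufficiently small \<open>z\<close>, all elements in the support of
  \<open>f\<close> are polynomials in \<open>z\<close>, and \<open>f\<close> reduces to the multiple
  \<open>\<theta> * Psi f / z\<close> of \<open>d z\<close>. Membership of \<open>Psi f\<close> in
  \<open>J p\<close> makes this coefficient divisible by \<open>R\<close>, which annihilates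
  \<open>d z\<close>. The condition \<open>e \<le> e'\<close> transports the bound on
  \<open>Psi f\<close> to the value of \<open>z\<close>.\<close>

lemma Psi_imp_N:
  assumes f: "f \<in> carrier F" and Psi: "Psi f \<in> J p"
  shows "f \<in> N"
proof -
  let ?S = "{x. f x \<noteq> 0}"
  have S: "finite ?S" and SO: "\<And>x. x \<in> ?S \<Longrightarrow> x \<in> above 0 \<and> f x \<in> above 0"
    using f by (auto simp: F_carrier)
  obtain e' where e': "e' \<in> Pos" "Psi f \<in> above (nmul p (e' - \<eta>))" using Psi by (auto simp: J_def)
  have "small (\<lambda>e. (\<forall>x\<in>?S. adapted x e) \<and> e \<le> e')"
    using S SO e' by (intro small_conj small_ball small_adapted small_le) auto
  then obtain e where e: "good e" "\<forall>x\<in>?S. adapted x e" "e \<le> e'" using small_ex by blast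
  obtain c where c: "c \<in> K" "c \<noteq> 0" "v (c * y) = e" using good_coeff[OF e(1)] by blast
  have e0: "0 < v (c * y)" using e c by (simp add: good_def)
  define z where "z = c * y"
  have z: "z \<noteq> 0" "v z = e" using c y by (auto simp: z_def)
  have "f = (\<Sum>x\<in>?S. sc (f x) (d x))"
  proof
    fix w
    have "(\<Sum>x\<in>?S. sc (f x) (d x)) w = (\<Sum>x\<in>?S. if x = w then f w else 0)"
      unfolding sum_fun_apply by (rule sum.cong) (auto simp: sc_def d_apply)
    then show "f w = (\<Sum>x\<in>?S. sc (f x) (d x)) w" using S by simp
  qed
  then have "cong f (\<Sum>x\<in>?S. sc (f x) (d x))" by simp
  also have "cong \<dots> (\<Sum>x\<in>?S. sc (f x) (sc (euler y x / z) (d z)))"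
    unfolding z_def using SO e c by (intro cong_sum cong_sc d_adapted(2)[OF c(1,2) e0]) auto
  also have "\<dots> = sc (\<theta> * Psi f / z) (d z)"
    using theta by (simp add: sc_simps sc_sum[symmetric] Psi_def sum_distrib_left sum_divide_distrib mult_ac)
  also have "cong \<dots> 0"
  proof -
    \<comment> \<open>For the Leibniz rule the value of \<open>euler y (y ^ p)\<close> was bounded
      from below; here it is needed from above, so that the quotient by \<open>R\<close> is
      integral.\<close>
    define R where "R = euler y (z ^ p) / z"
    have yp: "euler y (y ^ p) \<noteq> 0" "v (euler y (y ^ p)) = v (y ^ p) - nmul (p - 1) \<eta>"
      using v_euler_top[OF j_bounds] by auto
    have ez: "euler y (z ^ p) = c ^ p * euler y (y ^ p)"
      using euler_scale[OF y K_power[OF c(1)]] by (simp add: z_def power_mult_distrib)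
    have "v (euler y (z ^ p)) = v (c ^ p) + v (euler y (y ^ p))"
      unfolding ez using c(2) yp(1) by (intro v_mult) auto
    moreover have "v (z ^ p) = v (c ^ p) + v (y ^ p)"
      unfolding z_def power_mult_distrib using c(2) y by (intro v_mult) auto
    ultimately have "v (euler y (z ^ p)) = v (z ^ p) - nmul (p - 1) \<eta>" using yp(2) by simp
    then have R: "R \<noteq> 0" "v R = nmul p e - nmul (p - 1) \<eta> - e"
      using yp c(2) z by (auto simp: R_def ez v_divide v_power)
    have "nmul p (e - \<eta>) \<le> nmul p (e' - \<eta>)" using e(3) by (intro nmul_mono diff_right_mono)
    then have "Psi f \<in> above (nmul p (e - \<eta>))" using e'(2) above_mono by blast
    then have "\<theta> * Psi f / z \<in> above (\<eta> + nmul p (e - \<eta>) - e)"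
      using above_divide[OF above_mult[OF above_v], of "Psi f" _ z \<theta>] z by simp
    also have "\<eta> + nmul p (e - \<eta>) - e = v R"
      by (simp add: R nmul_diff nmul_p_Suc[of \<eta>] algebra_simps)
    finally have "\<theta> * Psi f / z / R \<in> above (v R - v R)" using R(1) by (rule above_divide)
    then have "\<theta> * Psi f / z / R \<in> above 0" by (simp only: diff_self)
    then have "cong (sc (\<theta> * Psi f / z / R) (sc R (d z))) (sc (\<theta> * Psi f / z / R) 0)"
      unfolding R_def z_def by (intro cong_sc d_top[OF c(1,2) e0])
    then show ?thesis using R(1) by (simp add: sc_simps)
  qed
  finally show ?thesis by (simp add: cong_def)
qed

theorem kaehler_isomorphic:
  "module_isomorphic O_L (kaehler_differentials O_L O_K) (quotient_module (ideal_module O_L (J 1)) (J p))"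
proof -
  have "J p \<subseteq> J 1" using J_antimono[of 1 p] p_gt_1 by simp
  then have sub: "submodule (J p) O_L (ideal_module O_L (J 1))"
    by (intro ideal_module_submodule J_ideal)
  have "module_isomorphic O_L (quotient_module F N) (quotient_module (ideal_module O_L (J 1)) (J p))"
  proof (rule quotient_module_isomorphic[OF F_module N_submodule ideal_module_module[OF J_ideal] sub])
    fix f assume f: "f \<in> carrier F"
    show "Psi f \<in> carrier (ideal_module O_L (J 1))" using Psi_in_J[OF f] by simp
    show "Psi (f \<oplus>\<^bsub>F\<^esub> g) = Psi f \<oplus>\<^bsub>ideal_module O_L (J 1)\<^esub> Psi g" if "g \<in> carrier F" for g
      using Psi_add[OF f that] by simp
    show "Psi (b \<odot>\<^bsub>F\<^esub> f) = b \<odot>\<^bsub>ideal_module O_L (J 1)\<^esub> Psi f" for b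
      using Psi_sc[OF f] by simp
    show "Psi f \<in> J p \<longleftrightarrow> f \<in> N" using N_imp_Psi Psi_imp_N[OF f] by blast
  next
    fix t assume "t \<in> carrier (ideal_module O_L (J 1))"
    then show "\<exists>f\<in>carrier F. Psi f = t" using Psi_surj by simp
  qed
  then show ?thesis by (simp only: kaehler_differentials_def Let_def O_L_simps)
qed

lemma kaehler_nonzero:
  "carrier (kaehler_differentials O_L O_K) \<noteq> {\<zero>\<^bsub>kaehler_differentials O_L O_K\<^esub>}"
proof -
  have k: "kaehler_differentials O_L O_K = quotient_module F N"
    by (simp add: kaehler_differentials_def Let_def)
  obtain f where f: "f \<in> carrier F" "Psi f = inverse (\<theta> ^ 2)" using Psi_surj[OF J_p_witness(1)] by blast
  then have "f \<notin> N" using N_imp_Psi J_p_witness(2) by metis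
  moreover have "f \<in> N +>\<^bsub>F\<^esub> f"
    by (rule abelian_subgroup.a_rcos_self[OF submodule_abelian_subgroup[OF F_module N_submodule] f(1)])
  ultimately have "N +>\<^bsub>F\<^esub> f \<noteq> N" by blast
  moreover have "N +>\<^bsub>F\<^esub> f \<in> carrier (quotient_module F N)"
    using f(1) by (auto simp: quotient_module_def A_RCOSETS_def')
  moreover have "\<zero>\<^bsub>quotient_module F N\<^esub> = N" by (simp add: quotient_module_def)
  ultimately show ?thesis unfolding k by blast
qed

text \<open>Horner's scheme, which matches the inductive rule generating
  \<open>simple_extension\<close>.\<close>

lemma simple_extension_sum:
  "(\<And>k. k < n \<Longrightarrow> a k \<in> A) \<Longrightarrow> (\<Sum>k<n. a k * z ^ k) \<in> FR.simple_extension A z"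
proof (induction n arbitrary: a)
  case 0
  show ?case using FR.simple_extension.zero[of A z] by simp
next
  case (Suc n)
  have "(\<Sum>k<Suc n. a k * z ^ k) = (\<Sum>k<n. a (Suc k) * z ^ k) * z + a 0"
    unfolding sum.lessThan_Suc_shift by (simp add: sum_distrib_left mult_ac add.commute)
  also have "\<dots> \<in> FR.simple_extension A z"
    using FR.simple_extension.lin[of "\<Sum>k<n. a (Suc k) * z ^ k" A z "a 0"] Suc.IH[of "\<lambda>k. a (Suc k)"] Suc.prems
    by simp
  finally show ?case .
qed

text \<open>A single \<open>x\<close> requires just one \<open>c * y\<close> of sufficiently small
  value; adaptedness is what makes the rescaled coordinates integral. The alternative
  \<open>c * y = 0\<close> stands for infinite value.\<close>

theorem O_L_union:
  "carrier O_L = (\<Union>c\<in>{c \<in> K. c * y = 0 \<or> 0 < v (c * y)}. FR.simple_extension O_K (c * y))"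
proof (intro equalityI subsetI)
  fix x assume "x \<in> carrier O_L"
  then have "x \<in> above 0" by simp
  then obtain e where e: "good e" "adapted x e" using small_ex[OF small_adapted] by blast
  obtain c where c: "c \<in> K" "c \<noteq> 0" "v (c * y) = e" using good_coeff[OF e(1)] by blast
  note ac = adapted_coeff[of x c, unfolded c(3), OF e(2) c(1,2)]
  have "x = (\<Sum>k<p. coord y x k / c ^ k * (c * y) ^ k)" using coord_sum[OF y, of x] ac(2) by simp
  also have "\<dots> \<in> FR.simple_extension O_K (c * y)"
    using ac(1) by (intro simple_extension_sum) (auto simp: O_K_eq)
  finally show "x \<in> (\<Union>c\<in>{c \<in> K. c * y = 0 \<or> 0 < v (c * y)}. FR.simple_extension O_K (c * y))"
    using c e(1) by (auto simp: good_def)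
next
  fix x assume "x \<in> (\<Union>c\<in>{c \<in> K. c * y = 0 \<or> 0 < v (c * y)}. FR.simple_extension O_K (c * y))"
  then obtain c where c: "c * y = 0 \<or> 0 < v (c * y)" "x \<in> FR.simple_extension O_K (c * y)" by blast
  then have "c * y \<in> above 0" by (auto simp: above_def)
  from c(2) show "x \<in> carrier O_L"
  proof (induction rule: FR.simple_extension.induct)
    case (lin k1 k2)
    then show ?case using \<open>c * y \<in> above 0\<close> by (auto simp: O_K_eq intro: above_add above_mult0)
  qed simp
qed

end

section \<open>Value groups of prime index\<close>

text \<open>Translation by \<open>a\<close> permutes the cosets, so the sum of their representatives
  changes only by an element of \<open>V\<close>, while each summand moves by \<open>a\<close>
  modulo \<open>V\<close>. Positivity of the index expresses finiteness, as \<open>card\<close> is 0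
  on infinite sets.\<close>

lemma group_index_nmul:
  fixes U V :: "'g::linordered_ab_group_add set"
  assumes pos: "0 < group_index U V"
    and U: "\<And>a b. a \<in> U \<Longrightarrow> b \<in> U \<Longrightarrow> a + b \<in> U"
    and V: "0 \<in> V" "\<And>a b. a \<in> V \<Longrightarrow> b \<in> V \<Longrightarrow> a - b \<in> V"
    and a: "a \<in> U"
  shows "nmul (group_index U V) a \<in> V"
proof -
  have V_add: "x + y \<in> V" if "x \<in> V" "y \<in> V" for x y
    using V(2)[of x "0 - y"] V(2)[of 0 y] V(1) that by simp
  define Q where "Q = (\<lambda>\<gamma>. (+) \<gamma> ` V) ` U"
  have fin: "finite Q" using pos by (auto simp: group_index_def Q_def intro: card_ge_0_finite)
  define T where "T = (\<lambda>q::'g set. (+) a ` q)"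
  have "T ` Q \<subseteq> Q"
  proof
    fix q assume "q \<in> T ` Q"
    then obtain g where g: "g \<in> U" "q = (+) a ` ((+) g ` V)" by (auto simp: T_def Q_def)
    then have "q = (+) (a + g) ` V" by (simp add: image_image add.assoc)
    then show "q \<in> Q" using U[OF a g(1)] by (auto simp: Q_def)
  qed
  moreover have "inj_on T Q"
    by (rule inj_onI) (simp add: T_def inj_image_eq_iff)
  ultimately have bij: "bij_betw T Q Q" using fin by (simp add: bij_betw_def endo_inj_surj)
  define rep where "rep = (\<lambda>q. SOME r. r \<in> U \<and> q = (+) r ` V)"
  have rep: "rep q \<in> U \<and> q = (+) (rep q) ` V" if "q \<in> Q" for q
    unfolding rep_def by (rule someI_ex) (use that in \<open>auto simp: Q_def\<close>)
  have diff: "rep (T q) - (a + rep q) \<in> V" if q: "q \<in> Q" for q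
  proof -
    have "T q \<in> Q" using q bij by (auto simp: bij_betw_def)
    then have "T q = (+) (rep (T q)) ` V" using rep by blast
    then have "rep (T q) + 0 \<in> T q" using V(1) by blast
    moreover have "T q = (+) a ` ((+) (rep q) ` V)" using rep[OF q] by (simp add: T_def)
    ultimately obtain x where "x \<in> V" "rep (T q) + 0 = a + (rep q + x)" by blast
    then show ?thesis by simp
  qed
  have "(\<Sum>q\<in>Q. rep (T q) - (a + rep q)) \<in> V"
    using diff by (induction Q rule: infinite_finite_induct) (auto simp: V V_add)
  moreover have "(\<Sum>q\<in>Q. rep (T q)) = (\<Sum>q\<in>Q. rep q)" by (rule sum.reindex_bij_betw[OF bij])
  moreover have "(\<Sum>q\<in>Q. a) = nmul (card Q) a"
    using fin by (induction Q rule: finite_induct) auto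
  ultimately have "- nmul (card Q) a \<in> V" by (simp add: sum_subtractf sum.distrib)
  then show ?thesis using V(2)[of 0 "- nmul (card Q) a"] V(1) by (simp add: group_index_def Q_def)
qed

theorem theorem4p6:
  fixes K :: "'a::field set"
    and v :: "'a \<Rightarrow> 'g::linordered_ab_group_add"
    and p :: nat
  defines "O_L \<equiv> valuation_ring v UNIV"
    and "O_K \<equiv> carrier (valuation_ring v K)"
    and "M \<equiv> M_ideal v K"
    and "I \<equiv> ramification_ideal v K"
  assumes v: "krull_valuation v"
    and AS: "artin_schreier_extension K"
    and p: "p = CHAR('a)"
    and index: "group_index (value_group v UNIV) (value_group v K) = p"
  shows "\<exists>\<theta>. artin_schreier_generator K \<theta> \<and> v \<theta> < 0 \<and>
      value_group v UNIV = {\<gamma> + int_multiple n (v \<theta>) | \<gamma> n. \<gamma> \<in> value_group v K} \<and>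
      (\<exists>j\<in>{1..p - 1}.
        carrier O_L =
          (\<Union>c\<in>{c \<in> K. c * \<theta> ^ j = 0 \<or> 0 < v (c * \<theta> ^ j)}.
            ring.simple_extension field_ring O_K (c * \<theta> ^ j))) \<and>
      (let J = (\<lambda>a. inverse \<theta> * a) ` M; IM = I \<cdot>\<^bsub>O_L\<^esub> M in
        module_isomorphic O_L
          (kaehler_differentials O_L O_K)
          (quotient_module (ideal_module O_L J) (ideal_power O_L J p)) \<and>
        quotient_module (ideal_module O_L J) (ideal_power O_L J p) =
          quotient_module (ideal_module O_L IM) (ideal_power O_L IM p)) \<and>
      carrier (kaehler_differentials O_L O_K) \<noteq> {\<zero>\<^bsub>kaehler_differentials O_L O_K\<^esub>}"
proof -
  interpret krull_valued v by standard (rule v)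
  have sub: "subfield K field_ring" and dim: "ring.dimension field_ring p K (UNIV :: 'a set)"
    and fixed: "{x. \<forall>\<sigma>\<in>galois_group K. \<sigma> x = x} = K"
    using AS by (auto simp: artin_schreier_extension_def galois_extension_of_degree_def p)
  have prime: "prime p" using AS by (auto simp: artin_schreier_extension_def p intro: prime_CHAR_semidom)
  have V0: "0 \<in> value_group v K"
    unfolding value_group_def using subfield_field_ring(2)[OF sub] by (intro image_eqI[of _ _ 1]) auto
  have U_add: "a + b \<in> value_group v UNIV" if ab: "a \<in> value_group v UNIV" "b \<in> value_group v UNIV" for a b
  proof -
    obtain c where "c \<noteq> 0" "a = v c" using ab(1) unfolding value_group_def by blast
    moreover obtain d where "d \<noteq> 0" "b = v d" using ab(2) unfolding value_group_def by blast
    ultimately have "c * d \<noteq> 0" "a + b = v (c * d)" by (simp_all add: v_mult)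
    then show ?thesis by (auto simp: value_group_def)
  qed
  have p_value: "nmul p (v x) \<in> value_group v K" if "x \<noteq> 0" for x
    unfolding index[symmetric]
  proof (rule group_index_nmul)
    show "0 < group_index (value_group v UNIV) (value_group v K)"
      unfolding index by (rule prime_gt_0_nat[OF prime])
    show "v x \<in> value_group v UNIV" unfolding value_group_def using that by simp
  qed (fact U_add V0 value_group_diff[OF sub])+
  interpret totally_ramified v K p
    by (intro totally_ramified.intro totally_ramified_axioms.intro krull_valued_axioms sub prime dim p_value)
      (rule p[symmetric])
  \<comment> \<open>If every value lay in \<open>vK\<close>, there would be a single coset and the
    index would be 1.\<close>
  have ram: "\<exists>y. y \<noteq> 0 \<and> v y \<notin> value_group v K"
  proof (rule ccontr)
    assume "\<not> ?thesis"
    then have "vL \<subseteq> vK" unfolding value_group_def[of v UNIV] by blast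
    then have *: "vL = vK" using V_sub by (rule equalityI)
    have "(+) g ` vK = vK" if "g \<in> vK" for g
    proof (intro equalityI subsetI)
      fix h assume "h \<in> vK"
      then show "h \<in> (+) g ` vK" using that V_diff by (intro image_eqI[of _ _ "h - g"]) auto
    qed (use that V_add in auto)
    then have "(\<lambda>g. (+) g ` vK) ` vK = {vK}" using V_zero by auto
    then have "p = 1" using index * by (simp add: group_index_def)
    then show False using p_gt_1 by simp
  qed
  interpret artin_schreier v K p
    by standard (use fixed ram in auto)
  obtain \<theta> where th: "\<theta> \<noteq> 0" "v \<theta> \<notin> vK" "v \<theta> < 0" "\<theta> ^ p - \<theta> \<in> K"
    using generator_exists by blast
  interpret artin_schreier_generated v K p \<theta>
    by standard (use th in auto)
  obtain j where j: "j \<in> {1..p - 1}" and small: "\<forall>k\<in>{1..p - 1}. \<forall>d. 0 < d \<and> d - nmul (k * j) (v \<theta>) \<in> vK \<longrightarrow>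
      (\<exists>e. 0 < e \<and> e - nmul j (v \<theta>) \<in> vK \<and> nmul k e \<le> d)"
    using small_coset[OF v_in_vL[OF th(1)] th(2)] by blast
  interpret artin_schreier_coset v K p \<theta> j
    by standard (use j small in auto)
  have "artin_schreier_generator K \<theta>"
    using generate_theta th(4) by (simp add: artin_schreier_generator_def p)
  moreover have "\<exists>j\<in>{1..p - 1}. carrier O_L =
      (\<Union>c\<in>{c \<in> K. c * \<theta> ^ j = 0 \<or> 0 < v (c * \<theta> ^ j)}. FR.simple_extension O_K (c * \<theta> ^ j))"
    unfolding O_L_def O_K_def using j O_L_union by (rule rev_bexI)
  moreover have "I \<cdot>\<^bsub>O_L\<^esub> M = (\<lambda>a. inverse \<theta> * a) ` M"
    unfolding O_L_def M_def I_def theta_M I_M ..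
  moreover have "module_isomorphic O_L (kaehler_differentials O_L O_K)
      (quotient_module (ideal_module O_L ((\<lambda>a. inverse \<theta> * a) ` M))
        (ideal_power O_L ((\<lambda>a. inverse \<theta> * a) ` M) p))"
    unfolding O_L_def O_K_def M_def theta_M J_power by (rule kaehler_isomorphic)
  moreover have "carrier (kaehler_differentials O_L O_K) \<noteq> {\<zero>\<^bsub>kaehler_differentials O_L O_K\<^esub>}"
    unfolding O_L_def O_K_def by (rule kaehler_nonzero)
  ultimately show ?thesis
    unfolding Let_def using th(3) value_group_theta by (intro exI[of _ \<theta>]) simp
qed

end
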